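(* Let $\mu$ be the fractional $P(\phi)_1$-measure for the Kato-decomposable potential $V$. For every $T>0$ and $A\in\mathcal{F}$, the function $\bar\omega\mapsto\mu_T(A,\bar\omega)$, $\bar\omega\in\Omega$, is a version of the conditional probability $\mu(A\,|\,\mathcal{T}_T)(\bar\omega)$; hence $\mu$ is a Gibbs measure for $V$.
   Context: Let $d\ge 1$, $\alpha\in(0,2)$, and let $(X_t)_{t\ge 0}$ be the rotationally invariant $\alpha$-stable process on $\mathbf{R}^d$ with càdlàg paths, $\mathbf{E}^0[e^{i\xi\cdot X_t}]=e^{-t|\xi|^\alpha}$, with transition density $p(t,x)$; $\mathbf{P}^x,\mathbf{E}^x$ are law and expectation for the process started at $x$. A Borel function $W$ on $\mathbf{R}^d$ is in $\mathcal{K}^\alpha$ if $\lim_{t\to 0}\sup_x\int_0^t\mathbf{E}^x[|W(X_s)|]ds=0$, and in $\mathcal{K}^\alpha_{\rm loc}$ if $W\mathbf{1}_B\in\mathcal{K}^\alpha$ for every ball $B$. A Borel function $V:\mathbf{R}^d\to\mathbf{R}$ is Kato-decomposable if its positive and negative parts ($V=V_+-V_-$) satisfy $V_+\in\mathcal{K}^\alpha_{\rm loc}$, $V_-\in\mathcal{K}^\alpha$. The Feynman-Kac semigroup is $T_tf(x)=\mathbf{E}^x[e^{-\int_0^tV(X_s)ds}f(X_t)]$; it is a strongly continuous symmetric semigroup on $L^2(\mathbf{R}^d)$, and $H_\alpha$ denotes the self-adjoint operator bounded from below with $e^{-tH_\alpha}=T_t$. For $t>0$, $T_t$ has a bounded,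 continuous, symmetric, strictly positive integral kernel $u(t,x,y)$. Standing assumption: $\lambda_0=\inf\operatorname{Spec}H_\alpha$ is an isolated eigenvalue; the corresponding eigenfunction with $\|\varphi_0\|_2=1$ is the ground state $\varphi_0$, taken in its strictly positive, bounded, continuous version. Put $\widetilde u(t,x,y)=\frac{e^{\lambda_0t}u(t,x,y)}{\varphi_0(x)\varphi_0(y)}$. For $I\subset\mathbf{R}$ an interval or union of intervals, $\Omega_I=D_{\rm r}(I,\mathbf{R}^d)$ is the space of right continuous functions with left limits and $\mathcal{F}_I$ the $\sigma$-field generated by the coordinates $\omega(t)$, $t\in I$; $\Omega=\Omega_{\mathbf{R}}$, $\mathcal{F}=\mathcal{F}_{\mathbf{R}}$, $\mathcal{T}_T=\mathcal{F}_{(-\infty,-T]\cup[T,\infty)}$, and $\widetilde X_t(\omega)=X_t(\omega)=\omega(t)$ on $\Omega$. Fractional $P(\phi)_1$-measure: for $x\in\mathbf{R}^d$, $\mu^x$ is the probability measure on $(\Omega,\mathcal{F})$ under which $\widetilde X_0=x$ a.s., $(\widetilde X_t)_{t\ge0}$ and $(\widetilde X_{-t})_{t\ge0}$ are independent, and each of them is a Markov process with transition probabilities $\widetilde u(t,y,z)\varphi_0^2(z)dz$; and $\mu(A)=\int_{\mathbf{R}^d}\mu^x(A)\varphi_0^2(x)dx$. Bridge measures: for $s<t$, $\nu^{x,y}_{[s,t]}$ is the (non-normalized) measure on $(\Omega_{[s,t]},\mathcal{F}_{[s,t]})$ equal to $p(t-s,y-x)$ times the law of the $\alpha$-stable bridge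 from $x$ at time $s$ to $y$ at time $t$; thus $\omega(s)=x,\ \omega(t)=y$ almost everywhere, and for $s=t_0<t_1<\dots<t_n<t_{n+1}=t$, $\nu^{x,y}_{[s,t]}(\omega(t_1)\in A_1,\dots,\omega(t_n)\in A_n)=\int_{A_1}\!\cdots\!\int_{A_n}\prod_{i=1}^{n+1}p(t_i-t_{i-1},z_i-z_{i-1})dz_1\cdots dz_n$ with $z_0=x$, $z_{n+1}=y$. Write $\nu^{x,y}_T=\nu^{x,y}_{[-T,T]}$. For $\bar\omega\in\Omega$ let $\delta_T^{\bar\omega}$ be the point measure on $\Omega_{[-T,T]^c}$ at (the restriction of) $\bar\omega$, and let $\nu_T^{\bar\omega}=\nu_T^{\bar\omega(-T),\bar\omega(T)}\otimes\delta_T^{\bar\omega}$, regarded as a measure on $(\Omega,\mathcal{F})$. Set $Z_T(x,y)=\int e^{-\int_{-T}^TV(X_s(\omega))ds}d\nu_T^{x,y}(\omega)$, which equals $u(2T,x,y)$, and $$\mu_T(A,\bar\omega)=\frac{1}{Z_T(\bar\omega(-T),\bar\omega(T))}\int_\Omega\mathbf{1}_A(\omega)e^{-\int_{-T}^TV(X_s(\omega))ds}d\nu_T^{\bar\omega}(\omega),\quad A\in\mathcal{F},\ \bar\omega\in\Omega.$$ A probability measure $P$ on $(\Omega,\mathcal{F})$ is called a Gibbs measure for $V$ if for every $A\in\mathcal{F}$ and $T>0$, $\bar\omega\mapsto\mu_T(A,\bar\omega)$ is a version of $P(A|\mathcal{T}_T)$. *)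

theory Defs
  imports "HOL-Probability.Probability"
begin

section \<open>Path spaces\<close>

text \<open>Euclidean space is a type \<open>'a :: euclidean_space\<close>.\<close>

definition cadlag_on :: "real set \<Rightarrow> (real \<Rightarrow> 'a::euclidean_space) set" where
  "cadlag_on I = {\<omega>. \<forall>t\<in>I. (\<omega> \<longlongrightarrow> \<omega> t) (at t within I \<inter> {t<..}) \<and>
                          (\<exists>l. (\<omega> \<longlongrightarrow> l) (at t within I \<inter> {..<t}))}"

text \<open>The measurable space \<open>(\<Omega>\<^sub>I, \<F>\<^sub>I)\<close>; only \<^const>\<open>space\<close> and \<^const>\<open>sets\<close> of it are meaningful.
  Paths are extensional outside \<open>I\<close>, and the trace of the product sigma-algebra is the
  sigma-algebra generated by the coordinates.\<close>

definition paths :: "real set \<Rightarrow> (real \<Rightarrow> 'a::euclidean_space) measure" where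
  "paths I = restrict_space (PiM I (\<lambda>_. borel)) (cadlag_on I)"

definition gen_algebra :: "'w measure \<Rightarrow> (real \<Rightarrow> 'w \<Rightarrow> 'a::euclidean_space) \<Rightarrow> real set \<Rightarrow> 'w measure" where
  "gen_algebra M Y I =
     sigma (space M) {{\<omega> \<in> space M. Y t \<omega> \<in> B} | t B. t \<in> I \<and> B \<in> sets borel}"

definition version_of_cond_prob :: "'w measure \<Rightarrow> 'w measure \<Rightarrow> 'w set \<Rightarrow> ('w \<Rightarrow> real) \<Rightarrow> bool" where
  "version_of_cond_prob M G A f \<longleftrightarrow>
     f \<in> borel_measurable G \<and> (AE \<omega> in M. f \<omega> = real_cond_exp M G (indicator A) \<omega>)"

section \<open>The rotationally invariant stable process\<close>

text \<open>\<open>P x\<close> is the law of the process started at \<open>x\<close>: a Levy process with the prescribed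
  characteristic function, and its translates.\<close>

definition stable_process :: "real \<Rightarrow> ('a::euclidean_space \<Rightarrow> (real \<Rightarrow> 'a) measure) \<Rightarrow> bool" where
  "stable_process \<alpha> P \<longleftrightarrow>
     prob_space (P 0) \<and> sets (P 0) = sets (paths {0..}) \<and>
     (AE \<omega> in P 0. \<omega> 0 = 0) \<and>
     (\<forall>s t. 0 \<le> s \<and> s \<le> t \<longrightarrow>
        prob_space.indep_set (P 0)
          (sets (gen_algebra (P 0) (\<lambda>r \<omega>. \<omega> r) {0..s}))
          {{\<omega> \<in> space (P 0). \<omega> t - \<omega> s \<in> B} | B. B \<in> sets borel} \<and>
        distr (P 0) borel (\<lambda>\<omega>. \<omega> t - \<omega> s) = distr (P 0) borel (\<lambda>\<omega>. \<omega> (t - s))) \<and>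
     (\<forall>t\<ge>0. \<forall>\<xi>. (\<integral>\<omega>. iexp (\<xi> \<bullet> \<omega> t) \<partial>P 0) = complex_of_real (exp (- t * norm \<xi> powr \<alpha>))) \<and>
     (\<forall>x. P x = distr (P 0) (paths {0..}) (\<lambda>\<omega>. \<lambda>t\<in>{0..}. x + \<omega> t))"

text \<open>Continuity selects the version of the density that enters the bridge measures pointwise.\<close>

definition transition_density ::
    "('a::euclidean_space \<Rightarrow> (real \<Rightarrow> 'a) measure) \<Rightarrow> (real \<Rightarrow> 'a \<Rightarrow> real) \<Rightarrow> bool" where
  "transition_density P p \<longleftrightarrow>
     (\<forall>t>0. continuous_on UNIV (p t) \<and> (\<forall>x. 0 \<le> p t x) \<and>
        distr (P 0) borel (\<lambda>\<omega>. \<omega> t) = density lborel (\<lambda>x. ennreal (p t x)))"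

definition kato_class ::
    "('a::euclidean_space \<Rightarrow> (real \<Rightarrow> 'a) measure) \<Rightarrow> ('a \<Rightarrow> real) \<Rightarrow> bool" where
  "kato_class P W \<longleftrightarrow>
     W \<in> borel_measurable borel \<and>
     ((\<lambda>t. SUP x. \<integral>\<^sup>+s\<in>{0..t}. (\<integral>\<^sup>+\<omega>. ennreal \<bar>W (\<omega> s)\<bar> \<partial>P x) \<partial>lborel) \<longlongrightarrow> 0) (at_right 0)"

definition kato_class_loc ::
    "('a::euclidean_space \<Rightarrow> (real \<Rightarrow> 'a) measure) \<Rightarrow> ('a \<Rightarrow> real) \<Rightarrow> bool" where
  "kato_class_loc P W \<longleftrightarrow>
     W \<in> borel_measurable borel \<and> (\<forall>c r. kato_class P (\<lambda>x. W x * indicator (ball c r) x))"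

definition kato_decomposable ::
    "('a::euclidean_space \<Rightarrow> (real \<Rightarrow> 'a) measure) \<Rightarrow> ('a \<Rightarrow> real) \<Rightarrow> bool" where
  "kato_decomposable P V \<longleftrightarrow>
     V \<in> borel_measurable borel \<and>
     kato_class_loc P (\<lambda>x. max (V x) 0) \<and> kato_class P (\<lambda>x. max (- V x) 0)"

section \<open>Operators on complex \<open>L\<^sup>2\<close>\<close>

text \<open>Elements of \<open>L\<^sup>2\<close> are represented by functions, identified when equal almost everywhere.
  The scalar product is conjugate linear in the first argument.\<close>

definition l2 :: "('a::euclidean_space \<Rightarrow> complex) set" where
  "l2 = {f \<in> borel_measurable lborel. integrable lborel (\<lambda>x. (cmod (f x))\<^sup>2)}"

definition l2_inner :: "('a::euclidean_space \<Rightarrow> complex) \<Rightarrow> ('a \<Rightarrow> complex) \<Rightarrow> complex" where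
  "l2_inner f g = (\<integral>x. cnj (f x) * g x \<partial>lborel)"

definition l2_norm :: "('a::euclidean_space \<Rightarrow> complex) \<Rightarrow> real" where
  "l2_norm f = sqrt (\<integral>x. (cmod (f x))\<^sup>2 \<partial>lborel)"

text \<open>A possibly unbounded operator is given by its graph, saturated under almost everywhere equality.\<close>

type_synonym 'a l2_operator = "(('a \<Rightarrow> complex) \<times> ('a \<Rightarrow> complex)) set"

definition l2_linear_operator :: "'a::euclidean_space l2_operator \<Rightarrow> bool" where
  "l2_linear_operator H \<longleftrightarrow>
     H \<subseteq> l2 \<times> l2 \<and> (\<lambda>_. 0, \<lambda>_. 0) \<in> H \<and>
     (\<forall>f h g k c. (f, h) \<in> H \<and> (g, k) \<in> H \<longrightarrow> (\<lambda>x. f x + c * g x, \<lambda>x. h x + c * k x) \<in> H) \<and>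
     (\<forall>f h f' h'. (f, h) \<in> H \<and> f' \<in> l2 \<and> h' \<in> l2 \<and>
        (AE x in lborel. f' x = f x) \<and> (AE x in lborel. h' x = h x) \<longrightarrow> (f', h') \<in> H) \<and>
     (\<forall>h. (\<lambda>_. 0, h) \<in> H \<longrightarrow> (AE x in lborel. h x = 0))"

definition l2_adjoint :: "'a::euclidean_space l2_operator \<Rightarrow> 'a l2_operator" where
  "l2_adjoint H = {(g, k) \<in> l2 \<times> l2. \<forall>(f, h)\<in>H. l2_inner g h = l2_inner k f}"

definition l2_self_adjoint :: "'a::euclidean_space l2_operator \<Rightarrow> bool" where
  "l2_self_adjoint H \<longleftrightarrow>
     l2_linear_operator H \<and>
     (\<forall>f\<in>l2. \<forall>\<epsilon>>0. \<exists>g\<in>Domain H. l2_norm (\<lambda>x. f x - g x) < \<epsilon>) \<and>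
     l2_adjoint H = H"

definition l2_bounded_below :: "'a::euclidean_space l2_operator \<Rightarrow> bool" where
  "l2_bounded_below H \<longleftrightarrow> (\<exists>c. \<forall>(f, h)\<in>H. c * (l2_norm f)\<^sup>2 \<le> Re (l2_inner f h))"

definition l2_resolvent_set :: "'a::euclidean_space l2_operator \<Rightarrow> complex set" where
  "l2_resolvent_set H =
     {z. (\<forall>g\<in>l2. \<exists>(f, h)\<in>H. AE x in lborel. h x - z * f x = g x) \<and>
         (\<exists>C. \<forall>(f, h)\<in>H. l2_norm f \<le> C * l2_norm (\<lambda>x. h x - z * f x))}"

definition l2_spectrum :: "'a::euclidean_space l2_operator \<Rightarrow> complex set" where
  "l2_spectrum H = - l2_resolvent_set H"

definition l2_eigenvector :: "'a::euclidean_space l2_operator \<Rightarrow> complex \<Rightarrow> ('a \<Rightarrow> complex) \<Rightarrow> bool" where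
  "l2_eigenvector H z f \<longleftrightarrow> (f, \<lambda>x. z * f x) \<in> H \<and> \<not> (AE x in lborel. f x = 0)"

subsection \<open>Exponentials of self-adjoint operators\<close>

text \<open>Linearity of \<open>Q\<close> and compatibility with almost everywhere equality follow from symmetry.\<close>

definition l2_orthogonal_projection ::
    "(('a::euclidean_space \<Rightarrow> complex) \<Rightarrow> ('a \<Rightarrow> complex)) \<Rightarrow> bool" where
  "l2_orthogonal_projection Q \<longleftrightarrow>
     (\<forall>f\<in>l2. Q f \<in> l2 \<and> (AE x in lborel. Q (Q f) x = Q f x)) \<and>
     (\<forall>f\<in>l2. \<forall>g\<in>l2. l2_inner (Q f) g = l2_inner f (Q g))"

definition projection_valued_measure ::
    "(real set \<Rightarrow> ('a::euclidean_space \<Rightarrow> complex) \<Rightarrow> ('a \<Rightarrow> complex)) \<Rightarrow> bool" where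
  "projection_valued_measure E \<longleftrightarrow>
     (\<forall>B\<in>sets borel. l2_orthogonal_projection (E B)) \<and>
     (\<forall>f\<in>l2. AE x in lborel. E UNIV f x = f x) \<and>
     (\<forall>A\<in>sets borel. \<forall>B\<in>sets borel. \<forall>f\<in>l2. AE x in lborel. E (A \<inter> B) f x = E A (E B f) x) \<and>
     (\<forall>B :: nat \<Rightarrow> real set. range B \<subseteq> sets borel \<and> disjoint_family B \<longrightarrow>
        (\<forall>f\<in>l2. (\<lambda>n. l2_inner f (E (B n) f)) sums l2_inner f (E (\<Union>n. B n) f)))"

definition spectral_distribution ::
    "(real set \<Rightarrow> ('a::euclidean_space \<Rightarrow> complex) \<Rightarrow> ('a \<Rightarrow> complex)) \<Rightarrow> ('a \<Rightarrow> complex) \<Rightarrow> real measure" where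
  "spectral_distribution E f =
     measure_of UNIV (sets borel) (\<lambda>B. ennreal (Re (l2_inner f (E B f))))"

text \<open>\<open>H = \<integral>\<lambda> dE(\<lambda>)\<close>. The quadratic form determines \<open>H\<close> by polarization.\<close>

definition spectral_resolution ::
    "'a::euclidean_space l2_operator \<Rightarrow> (real set \<Rightarrow> ('a \<Rightarrow> complex) \<Rightarrow> ('a \<Rightarrow> complex)) \<Rightarrow> bool" where
  "spectral_resolution H E \<longleftrightarrow>
     projection_valued_measure E \<and>
     Domain H = {f \<in> l2. (\<integral>\<^sup>+l. ennreal (l\<^sup>2) \<partial>spectral_distribution E f) < \<infinity>} \<and>
     (\<forall>(f, h)\<in>H. has_bochner_integral (spectral_distribution E f) complex_of_real (l2_inner f h))"

text \<open>\<open>S = exp (- t H) = \<integral>exp (- t \<lambda>) dE(\<lambda>)\<close>, for the spectral resolution \<open>E\<close> of \<open>H\<close>.\<close>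

definition is_exp_neg ::
    "'a::euclidean_space l2_operator \<Rightarrow> real \<Rightarrow> (('a \<Rightarrow> complex) \<Rightarrow> ('a \<Rightarrow> complex)) \<Rightarrow> bool" where
  "is_exp_neg H t S \<longleftrightarrow>
     (\<forall>f\<in>l2. S f \<in> l2) \<and>
     (\<forall>f\<in>l2. \<forall>g\<in>l2. \<forall>c. AE x in lborel. S (\<lambda>y. f y + c * g y) x = S f x + c * S g x) \<and>
     (\<exists>E. spectral_resolution H E \<and>
        (\<forall>f\<in>l2. has_bochner_integral (spectral_distribution E f)
           (\<lambda>l. complex_of_real (exp (- t * l))) (l2_inner f (S f))))"

section \<open>The Feynman-Kac semigroup, its generator and ground state\<close>

text \<open>For Kato-decomposable potentials the action integral converges absolutely outside a null set
  of paths; on that null set the value of the Lebesgue integral is irrelevant.\<close>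

definition action :: "('a::euclidean_space \<Rightarrow> real) \<Rightarrow> real \<Rightarrow> real \<Rightarrow> (real \<Rightarrow> 'a) \<Rightarrow> real" where
  "action V a b \<omega> = (LBINT s:{a..b}. V (\<omega> s))"

definition feynman_kac ::
    "('a::euclidean_space \<Rightarrow> (real \<Rightarrow> 'a) measure) \<Rightarrow> ('a \<Rightarrow> real) \<Rightarrow> real \<Rightarrow> ('a \<Rightarrow> complex) \<Rightarrow> 'a \<Rightarrow> complex" where
  "feynman_kac P V t f x = (\<integral>\<omega>. exp (- action V 0 t \<omega>) *\<^sub>R f (\<omega> t) \<partial>P x)"

definition fractional_schroedinger_operator ::
    "('a::euclidean_space \<Rightarrow> (real \<Rightarrow> 'a) measure) \<Rightarrow> ('a \<Rightarrow> real) \<Rightarrow> 'a l2_operator \<Rightarrow> bool" where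
  "fractional_schroedinger_operator P V H \<longleftrightarrow>
     l2_self_adjoint H \<and> l2_bounded_below H \<and> (\<forall>t\<ge>0. is_exp_neg H t (feynman_kac P V t))"

definition feynman_kac_kernel ::
    "('a::euclidean_space \<Rightarrow> (real \<Rightarrow> 'a) measure) \<Rightarrow> ('a \<Rightarrow> real) \<Rightarrow> (real \<Rightarrow> 'a \<Rightarrow> 'a \<Rightarrow> real) \<Rightarrow> bool" where
  "feynman_kac_kernel P V u \<longleftrightarrow>
     (\<forall>t>0. bounded (range (\<lambda>(x, y). u t x y)) \<and>
        continuous_on UNIV (\<lambda>(x, y). u t x y) \<and>
        (\<forall>x y. u t x y = u t y x) \<and> (\<forall>x y. 0 < u t x y) \<and>
        (\<forall>f\<in>l2. AE x in lborel. feynman_kac P V t f x = (\<integral>y. u t x y *\<^sub>R f y \<partial>lborel)))"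

text \<open>The spectrum of a self-adjoint operator is real.\<close>

definition bottom_of_spectrum :: "'a::euclidean_space l2_operator \<Rightarrow> real" where
  "bottom_of_spectrum H = Inf {l. complex_of_real l \<in> l2_spectrum H}"

definition isolated_eigenvalue :: "'a::euclidean_space l2_operator \<Rightarrow> complex \<Rightarrow> bool" where
  "isolated_eigenvalue H z \<longleftrightarrow> (\<exists>f. l2_eigenvector H z f) \<and> z isolated_in l2_spectrum H"

definition ground_state :: "'a::euclidean_space l2_operator \<Rightarrow> ('a \<Rightarrow> real) \<Rightarrow> bool" where
  "ground_state H \<phi> \<longleftrightarrow>
     l2_eigenvector H (complex_of_real (bottom_of_spectrum H)) (\<lambda>x. complex_of_real (\<phi> x)) \<and>
     l2_norm (\<lambda>x. complex_of_real (\<phi> x)) = 1 \<and>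
     (\<forall>x. 0 < \<phi> x) \<and> bounded (range \<phi>) \<and> continuous_on UNIV \<phi>"

definition u_tilde ::
    "real \<Rightarrow> (real \<Rightarrow> 'a \<Rightarrow> 'a \<Rightarrow> real) \<Rightarrow> ('a::euclidean_space \<Rightarrow> real) \<Rightarrow> real \<Rightarrow> 'a \<Rightarrow> 'a \<Rightarrow> real" where
  "u_tilde l u \<phi> t x y = exp (l * t) * u t x y / (\<phi> x * \<phi> y)"

section \<open>The fractional \<open>P(\<phi>)\<^sub>1\<close>-measure\<close>

definition markov_process ::
    "'w measure \<Rightarrow> (real \<Rightarrow> 'w \<Rightarrow> 'a::euclidean_space) \<Rightarrow> (real \<Rightarrow> 'a \<Rightarrow> 'a measure) \<Rightarrow> bool" where
  "markov_process M Y K \<longleftrightarrow>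
     (\<forall>s\<ge>0. \<forall>t>0. \<forall>A\<in>sets borel.
        AE \<omega> in M. real_cond_exp M (gen_algebra M Y {0..s}) (indicator {\<omega> \<in> space M. Y (s + t) \<omega> \<in> A}) \<omega>
                 = measure (K t (Y s \<omega>)) A)"

definition pphi1_path_measure ::
    "real \<Rightarrow> (real \<Rightarrow> 'a \<Rightarrow> 'a \<Rightarrow> real) \<Rightarrow> ('a::euclidean_space \<Rightarrow> real) \<Rightarrow> 'a \<Rightarrow> (real \<Rightarrow> 'a) measure \<Rightarrow> bool" where
  "pphi1_path_measure l u \<phi> x M \<longleftrightarrow>
     (let K = \<lambda>t y. density lborel (\<lambda>z. ennreal (u_tilde l u \<phi> t y z * (\<phi> z)\<^sup>2)) in
      prob_space M \<and> sets M = sets (paths UNIV) \<and>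
      (AE \<omega> in M. \<omega> 0 = x) \<and>
      prob_space.indep_set M (sets (gen_algebra M (\<lambda>t \<omega>. \<omega> t) {0..}))
                             (sets (gen_algebra M (\<lambda>t \<omega>. \<omega> (- t)) {0..})) \<and>
      markov_process M (\<lambda>t \<omega>. \<omega> t) K \<and>
      markov_process M (\<lambda>t \<omega>. \<omega> (- t)) K)"

definition pphi1_measure ::
    "('a::euclidean_space \<Rightarrow> real) \<Rightarrow> ('a \<Rightarrow> (real \<Rightarrow> 'a) measure) \<Rightarrow> (real \<Rightarrow> 'a) measure" where
  "pphi1_measure \<phi> M =
     measure_of (space (paths UNIV)) (sets (paths UNIV))
       (\<lambda>A. \<integral>\<^sup>+x. emeasure (M x) A * ennreal ((\<phi> x)\<^sup>2) \<partial>lborel)"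

section \<open>Bridge measures and Gibbs measures\<close>

text \<open>The intermediate times are \<open>\<tau> 1 < \<dots> < \<tau> n\<close>. The case \<open>n = 0\<close> says that the total mass is
  \<open>p (t - s) (y - x)\<close>.\<close>

definition bridge_measure ::
    "(real \<Rightarrow> 'a \<Rightarrow> real) \<Rightarrow> real \<Rightarrow> real \<Rightarrow> 'a::euclidean_space \<Rightarrow> 'a \<Rightarrow> (real \<Rightarrow> 'a) measure \<Rightarrow> bool" where
  "bridge_measure p s t x y N \<longleftrightarrow>
     sets N = sets (paths {s..t}) \<and>
     (AE \<omega> in N. \<omega> s = x \<and> \<omega> t = y) \<and>
     (\<forall>n::nat. \<forall>\<tau>::nat \<Rightarrow> real. \<forall>A::nat \<Rightarrow> 'a set.
        \<tau> 0 = s \<and> \<tau> (Suc n) = t \<and> (\<forall>i\<le>n. \<tau> i < \<tau> (Suc i)) \<and> (\<forall>i\<in>{1..n}. A i \<in> sets borel) \<longrightarrow>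
        emeasure N {\<omega> \<in> space N. \<forall>i\<in>{1..n}. \<omega> (\<tau> i) \<in> A i} =
          (\<integral>\<^sup>+z. (\<Prod>i\<in>{1..n}. indicator (A i) (z i)) *
                ennreal (let z' = z(0 := x, Suc n := y) in
                         \<Prod>i\<in>{1..Suc n}. p (\<tau> i - \<tau> (i - 1)) (z' i - z' (i - 1)))
             \<partial>PiM {1..n} (\<lambda>_. lborel)))"

text \<open>In the following, \<open>N s t x y\<close> is the bridge measure from \<open>x\<close> at time \<open>s\<close> to \<open>y\<close> at time \<open>t\<close>.

  The product of a bridge measure on \<open>[-T, T]\<close> with the point measure at the restriction of \<open>\<omega>'\<close>
  to the complement, as a measure on two-sided paths, is the image of the bridge measure under
  gluing to \<open>\<omega>'\<close>. Since \<open>\<omega> T = \<omega>' T\<close> almost everywhere, the value at \<open>T\<close> may be taken from \<open>\<omega>'\<close>;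
  then every glued path is right continuous with left limits.\<close>

definition glued_bridge ::
    "(real \<Rightarrow> real \<Rightarrow> 'a \<Rightarrow> 'a \<Rightarrow> (real \<Rightarrow> 'a) measure) \<Rightarrow> real \<Rightarrow> (real \<Rightarrow> 'a::euclidean_space) \<Rightarrow> (real \<Rightarrow> 'a) measure" where
  "glued_bridge N T \<omega>' =
     distr (N (- T) T (\<omega>' (- T)) (\<omega>' T)) (paths UNIV)
       (\<lambda>\<omega> t. if - T \<le> t \<and> t < T then \<omega> t else \<omega>' t)"

definition partition_function ::
    "(real \<Rightarrow> real \<Rightarrow> 'a \<Rightarrow> 'a \<Rightarrow> (real \<Rightarrow> 'a) measure) \<Rightarrow> ('a::euclidean_space \<Rightarrow> real) \<Rightarrow> real \<Rightarrow> 'a \<Rightarrow> 'a \<Rightarrow> real" where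
  "partition_function N V T x y = (\<integral>\<omega>. exp (- action V (- T) T \<omega>) \<partial>N (- T) T x y)"

definition gibbs_kernel ::
    "(real \<Rightarrow> real \<Rightarrow> 'a \<Rightarrow> 'a \<Rightarrow> (real \<Rightarrow> 'a) measure) \<Rightarrow> ('a::euclidean_space \<Rightarrow> real) \<Rightarrow> real \<Rightarrow>
     (real \<Rightarrow> 'a) set \<Rightarrow> (real \<Rightarrow> 'a) \<Rightarrow> real" where
  "gibbs_kernel N V T A \<omega>' =
     1 / partition_function N V T (\<omega>' (- T)) (\<omega>' T) *
     (\<integral>\<omega>. indicator A \<omega> * exp (- action V (- T) T \<omega>) \<partial>glued_bridge N T \<omega>')"

definition exterior_algebra :: "real \<Rightarrow> (real \<Rightarrow> 'a::euclidean_space) measure" where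
  "exterior_algebra T = gen_algebra (paths UNIV) (\<lambda>t \<omega>. \<omega> t) ({..- T} \<union> {T..})"

definition gibbs_measure ::
    "(real \<Rightarrow> real \<Rightarrow> 'a \<Rightarrow> 'a \<Rightarrow> (real \<Rightarrow> 'a) measure) \<Rightarrow> ('a::euclidean_space \<Rightarrow> real) \<Rightarrow> (real \<Rightarrow> 'a) measure \<Rightarrow> bool" where
  "gibbs_measure N V M \<longleftrightarrow>
     prob_space M \<and> sets M = sets (paths UNIV) \<and>
     (\<forall>A\<in>sets (paths UNIV). \<forall>T>0.
        version_of_cond_prob M (exterior_algebra T) A (gibbs_kernel N V T A))"

end

theory Submission
  imports Defs
begin

text \<open>Write $v(t,x,y) = e^{\lambda_0 t} u(t,x,y)$. The Gibbs property is proved as an invariance statement.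
  Erase a path sampled from \<open>\<mu>\<close> inside the window $(-T,T)$ and fill the gap with the bridge between the
  two boundary values, tilted by the exponential of minus the action and normalised. The law of the new
  path is again \<open>\<mu>\<close> (\<open>resample_invariant\<close>). Since resampling does not affect an event \<open>E\<close> that depends only on
  the path outside the window, invariance applied to \<open>A \<inter> E\<close> is the identity that defines the conditional
  probability of \<open>A\<close> given the exterior (\<open>gibbs_kernel_conditional\<close>).

  Invariance is an equality of finite measures and can be tested on cylinder sets, where both sides become
  iterated integrals of \<open>v\<close> with a ground state factor at either end. For \<open>\<mu>\<close> itself: under \<open>\<mu>x x\<close> the two
  halves of the path are independent Markov processes with transition density $v(t,y,z)\varphi(z)/\varphi(y)$, and
  the ground state factors telescope. This gives an integral with pivot at time \<open>0\<close>. Symmetry of \<open>v\<close> lets the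
  pivot move along the list of times (\<open>zigzag_integral_move\<close>), in particular to the time \<open>- T\<close>
  (\<open>\<mu>_zigzag\<close>), and as a by-product the pair of boundary values has a density (\<open>joint_law\<close>).

  For the resampled path one has to know the mass that the tilted bridge gives to a cylinder. For almost all end
  points it is an iterated integral of \<open>v\<close> (\<open>G_integral_AE\<close>); without constraints this says that the partition
  function is \<open>v (2 * T)\<close> (\<open>Z_eq_v\<close>). The exceptional end points are harmless because the boundary values have
  a density. The formula is the Feynman-Kac formula at several times (\<open>feynman_kac_visits\<close>), transported to
  bridges by disintegrating the stable law with respect to the end point (\<open>bridge_disintegration\<close>). The formula
  at several times follows from the one at a single time by the Markov property of the stable process on path
  space (\<open>P_markov\<close>) and additivity of the action, which holds because the action converges absolutely
  (\<open>kato_decomposable_AE\<close>). All these identities are between integrals of nonnegative functions; that the single-time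
  Feynman-Kac formula is one, and not an equation between default values, is the content of
  \<open>feynman_kac_set\<close>.\<close>

section \<open>Right continuous paths with left limits\<close>

lemma space_paths: "space (paths I) = {\<omega> \<in> extensional I. \<omega> \<in> cadlag_on I}"
  by (auto simp: paths_def space_restrict_space space_PiM PiE_def)

lemma measurable_coordinate:
  "t \<in> I \<Longrightarrow> (\<lambda>\<omega>. \<omega> t) \<in> borel_measurable (paths I)"
  unfolding paths_def by (intro measurable_restrict_space1) measurable

lemma measurable_coordinate':
  assumes "sets M = sets (paths I)" "t \<in> I"
  shows "(\<lambda>\<omega>. \<omega> t) \<in> borel_measurable M"
  using measurable_coordinate[OF assms(2)] measurable_cong_sets[OF assms(1) refl] by blast

lemma measurable_pathsI:
  assumes "\<And>x. x \<in> space M \<Longrightarrow> f x \<in> space (paths I)"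
    and "\<And>t. t \<in> I \<Longrightarrow> (\<lambda>x. f x t) \<in> borel_measurable M"
  shows "f \<in> measurable M (paths I)"
  unfolding paths_def
proof (rule measurable_restrict_space2)
  show "f \<in> space M \<rightarrow> cadlag_on I" using assms(1) by (auto simp: space_paths)
  show "f \<in> measurable M (PiM I (\<lambda>_. borel))"
  proof (rule measurable_PiM_single')
    show "f \<in> space M \<rightarrow> (\<Pi>\<^sub>E i\<in>I. space borel)"
      using assms(1) by (auto simp: space_paths PiE_def)
  qed (use assms in auto)
qed

text \<open>One-sided limits of shifted and of glued paths all reduce to the following situation: close to \<open>t\<close> the
  path \<open>f\<close> is a copy of the path \<open>g\<close> read at a time shifted by \<open>c\<close>.\<close>

lemma tendsto_relocate:
  fixes t t' c :: real
  assumes "(g \<longlongrightarrow> l) (at t' within J')" "t' = t + c" "0 < e"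
    and eq: "\<And>r. r \<in> J \<Longrightarrow> r \<noteq> t \<Longrightarrow> \<bar>r - t\<bar> < e \<Longrightarrow> r + c \<in> J' \<and> f r = g (r + c)"
  shows "(f \<longlongrightarrow> l) (at t within J)"
proof (rule topological_tendstoI)
  fix S assume "open S" "l \<in> S"
  then obtain d where d: "0 < d" "\<And>r. r \<in> J' \<Longrightarrow> r \<noteq> t' \<Longrightarrow> dist r t' < d \<Longrightarrow> g r \<in> S"
    using topological_tendstoD[OF assms(1)] unfolding eventually_at by blast
  show "\<forall>\<^sub>F r in at t within J. f r \<in> S"
    unfolding eventually_at
  proof (intro exI[of _ "min d e"] conjI ballI impI)
    show "0 < min d e" using d assms by simp
    fix r assume "r \<in> J" "r \<noteq> t \<and> dist r t < min d e"
    then show "f r \<in> S" using eq[of r] d(2)[of "r + c"] assms(2) by (auto simp: dist_real_def)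
  qed
qed

lemma cadlag_onD:
  assumes "\<omega> \<in> cadlag_on I" "t \<in> I"
  shows "(\<omega> \<longlongrightarrow> \<omega> t) (at t within I \<inter> {t<..})" "\<exists>l. (\<omega> \<longlongrightarrow> l) (at t within I \<inter> {..<t})"
  using assms by (auto simp: cadlag_on_def)

text \<open>By right continuity, evaluation at \<open>s\<close> is the limit of the evaluations at the next point to the right of
  \<open>s\<close> in a grid of mesh \<open>1 / Suc n\<close>, and these depend on \<open>s\<close> through countably many values only. The right end
  point is excluded because no grid point of the interval lies to the right of it.\<close>

lemma measurable_evaluation:
  fixes a b :: real
  assumes "{a..b} \<subseteq> I"
  shows "(\<lambda>(s, \<omega>). if a \<le> s \<and> s < b then \<omega> s else 0)
           \<in> borel_measurable (borel \<Otimes>\<^sub>M (paths I :: (real \<Rightarrow> 'a::euclidean_space) measure))"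
proof (cases "a < b")
  case False
  then have "(\<lambda>(s, \<omega>). if a \<le> s \<and> s < b then \<omega> s else (0::'a)) = (\<lambda>_. 0)" by (auto simp: fun_eq_iff)
  then show ?thesis by simp
next
  case True
  \<comment> \<open>The grid point is clipped so that it stays in the interval on which paths are defined.\<close>
  define r where "r n k = max a (min b (a + (real_of_int k + 1) / real (Suc n)))" for n :: nat and k :: int
  define F where "F n z = (if a \<le> fst z \<and> fst z < b then snd z (r n \<lfloor>(fst z - a) * real (Suc n)\<rfloor>) else 0)"
    for n :: nat and z :: "real \<times> (real \<Rightarrow> 'a)"
  have rI: "r n k \<in> I" for n k using assms True by (auto simp: r_def)
  have "F n \<in> borel_measurable (borel \<Otimes>\<^sub>M paths I)" for n
  proof -
    have 1: "(\<lambda>z. \<lfloor>(fst z - a) * real (Suc n)\<rfloor>) \<in> measurable (borel \<Otimes>\<^sub>M (paths I :: (real \<Rightarrow> 'a) measure)) (count_space UNIV)"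
      by measurable
    have "(\<lambda>z. snd z (r n k)) \<in> borel_measurable (borel \<Otimes>\<^sub>M (paths I :: (real \<Rightarrow> 'a) measure))" for k
      using measurable_compose[OF measurable_snd measurable_coordinate[OF rI]] .
    from measurable_compose_countable[OF this 1]
    have [measurable]: "(\<lambda>z. snd z (r n \<lfloor>(fst z - a) * real (Suc n)\<rfloor>)) \<in> borel_measurable (borel \<Otimes>\<^sub>M (paths I :: (real \<Rightarrow> 'a) measure))"
      by simp
    show ?thesis unfolding F_def by measurable
  qed
  moreover have "(\<lambda>n. F n z) \<longlonglongrightarrow> (case z of (s, \<omega>) \<Rightarrow> if a \<le> s \<and> s < b then \<omega> s else 0)"
    if z: "z \<in> space (borel \<Otimes>\<^sub>M paths I)" for z
  proof -
    obtain s \<omega> where zz: "z = (s, \<omega>)" by force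
    have w: "\<omega> \<in> cadlag_on I" using z zz by (auto simp: space_pair_measure space_paths)
    show ?thesis
    proof (cases "a \<le> s \<and> s < b")
      case False then show ?thesis by (auto simp: zz F_def)
    next
      case s: True
      define q where "q n = r n \<lfloor>(s - a) * real (Suc n)\<rfloor>" for n
      have gt: "a + (real_of_int \<lfloor>(s - a) * real (Suc n)\<rfloor> + 1) / real (Suc n) > s" for n
      proof -
        have "(s - a) * real (Suc n) < real_of_int \<lfloor>(s - a) * real (Suc n)\<rfloor> + 1" by linarith
        then show ?thesis by (simp add: field_simps)
      qed
      have le: "a + (real_of_int \<lfloor>(s - a) * real (Suc n)\<rfloor> + 1) / real (Suc n) \<le> s + 1 / real (Suc n)" for n
      proof -
        have "(real_of_int \<lfloor>(s - a) * real (Suc n)\<rfloor> + 1) / real (Suc n) \<le> ((s - a) * real (Suc n) + 1) / real (Suc n)"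
          by (intro divide_right_mono add_right_mono of_int_floor_le) simp
        also have "\<dots> = s - a + 1 / real (Suc n)" by (simp add: add_divide_distrib del: of_nat_Suc)
        finally show ?thesis by simp
      qed
      have "q n \<in> I" for n by (simp add: q_def rI)
      moreover have "s < q n" "q n \<le> s + 1 / real (Suc n)" for n
        using s gt[of n] le[of n] by (auto simp: q_def r_def)
      ultimately have q: "s < q n" "q n \<in> I" "q n \<le> s + 1 / real (Suc n)" for n by auto
      have "q \<longlonglongrightarrow> s"
      proof (rule tendsto_sandwich)
        show "\<forall>\<^sub>F n in sequentially. s \<le> q n" "\<forall>\<^sub>F n in sequentially. q n \<le> s + 1 / real (Suc n)"
          using q by (auto intro!: always_eventually less_imp_le)
        show "(\<lambda>n. s + 1 / real (Suc n)) \<longlonglongrightarrow> s"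
          using tendsto_add[OF tendsto_const LIMSEQ_inverse_real_of_nat, of s] by (simp add: inverse_eq_divide)
      qed simp
      then have "filterlim q (at s within I \<inter> {s<..}) sequentially"
        unfolding filterlim_at using q by (auto intro!: always_eventually simp: less_imp_neq[symmetric])
      moreover have "s \<in> I" using s assms by auto
      ultimately have "(\<lambda>n. \<omega> (q n)) \<longlonglongrightarrow> \<omega> s"
        using filterlim_compose[OF cadlag_onD(1)[OF w]] by blast
      then show ?thesis using s by (simp add: zz F_def q_def)
    qed
  qed
  ultimately show ?thesis by (rule borel_measurable_LIMSEQ_metric)
qed

lemma measurable_path_segment:
  fixes \<omega> :: "real \<Rightarrow> 'a::euclidean_space"
  assumes "{a..b} \<subseteq> I" "\<omega> \<in> space (paths I)"
  shows "(\<lambda>s. if a \<le> s \<and> s < b then \<omega> s else 0) \<in> borel_measurable borel"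
  using measurable_compose[OF measurable_Pair2'[OF assms(2)] measurable_evaluation[OF assms(1)]]
  by simp

text \<open>The action does not see the value of the path at the right end point. This matters because gluing a bridge to
  its exterior takes that value from the exterior.\<close>

lemma action_half_open:
  fixes \<omega> :: "real \<Rightarrow> 'a::euclidean_space"
  assumes [measurable]: "V \<in> borel_measurable borel"
  shows "action V a b \<omega> = (\<integral>s. indicator {a..<b} s *\<^sub>R V (if a \<le> s \<and> s < b then \<omega> s else 0) \<partial>lborel)"
proof -
  have eq: "indicator {a..b} s *\<^sub>R V (\<omega> s)
      = indicator {a..<b} s *\<^sub>R V (if a \<le> s \<and> s < b then \<omega> s else 0) + indicator ({b} \<inter> {a..b}) s *\<^sub>R V (\<omega> b)" for s
    by (auto simp: indicator_def)
  have "has_bochner_integral lborel (\<lambda>s. indicator ({b} \<inter> {a..b}) s *\<^sub>R V (\<omega> b)) 0"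
    by (rule has_bochner_integral_cong_AE[THEN iffD2, OF _ _ _ has_bochner_integral_zero])
      (use AE_lborel_singleton[of b] in \<open>auto simp: indicator_def elim: eventually_mono\<close>)
  then have i: "integrable lborel (\<lambda>s. indicator ({b} \<inter> {a..b}) s *\<^sub>R V (\<omega> b))"
    "(\<integral>s. indicator ({b} \<inter> {a..b}) s *\<^sub>R V (\<omega> b) \<partial>lborel) = 0"
    by (auto simp: has_bochner_integral_iff)
  show ?thesis
  proof (cases "integrable lborel (\<lambda>s. indicator {a..<b} s *\<^sub>R V (if a \<le> s \<and> s < b then \<omega> s else 0))")
    case True
    then show ?thesis using i
      unfolding action_def set_lebesgue_integral_def eq
      by (subst Bochner_Integration.integral_add) simp_all
  next
    case False
    moreover have "\<not> integrable lborel (\<lambda>s. indicator {a..b} s *\<^sub>R V (\<omega> s))"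
    proof
      assume "integrable lborel (\<lambda>s. indicator {a..b} s *\<^sub>R V (\<omega> s))"
      from Bochner_Integration.integrable_diff[OF this i(1)] False show False unfolding eq by simp
    qed
    ultimately show ?thesis
      by (simp add: action_def set_lebesgue_integral_def not_integrable_integral_eq)
  qed
qed

lemma action_cong:
  fixes \<omega> \<omega>' :: "real \<Rightarrow> 'a::euclidean_space"
  assumes "V \<in> borel_measurable borel" "\<And>s. a \<le> s \<Longrightarrow> s < b \<Longrightarrow> \<omega> s = \<omega>' s"
  shows "action V a b \<omega> = action V a b \<omega>'"
  unfolding action_half_open[OF assms(1)]
  by (intro Bochner_Integration.integral_cong) (auto simp: assms(2))

lemma action_shift:
  "action V (a + c) (b + c) \<omega> = action V a b (\<lambda>s. \<omega> (s + c))"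
proof -
  have "action V (a + c) (b + c) \<omega> = (\<integral>s. indicator {a + c..b + c} s *\<^sub>R V (\<omega> s) \<partial>lborel)"
    by (simp add: action_def set_lebesgue_integral_def)
  also have "\<dots> = (\<integral>s. indicator {a + c..b + c} (c + 1 * s) *\<^sub>R V (\<omega> (c + 1 * s)) \<partial>lborel)"
    by (subst lborel_integral_real_affine[where c = 1 and t = c]) simp_all
  also have "\<dots> = action V a b (\<lambda>s. \<omega> (s + c))"
    unfolding action_def set_lebesgue_integral_def
    by (intro Bochner_Integration.integral_cong) (auto simp: indicator_def add.commute)
  finally show ?thesis .
qed

lemma measurable_evaluation':
  fixes a b :: real
  assumes "{a..b} \<subseteq> I"
  shows "(\<lambda>z. if a \<le> snd z \<and> snd z < b then fst z (snd z) else 0)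
           \<in> borel_measurable ((paths I :: (real \<Rightarrow> 'a::euclidean_space) measure) \<Otimes>\<^sub>M lborel)"
proof -
  have "(\<lambda>z. (\<lambda>(s, \<omega>). if a \<le> s \<and> s < b then \<omega> s else (0::'a)) (snd z, fst z)) \<in> borel_measurable (paths I \<Otimes>\<^sub>M lborel)"
    by (rule measurable_compose[OF _ measurable_evaluation[OF assms]]) measurable
  moreover have "(\<lambda>z. (\<lambda>(s, \<omega>). if a \<le> s \<and> s < b then \<omega> s else (0::'a)) (snd z, fst z))
      = (\<lambda>z. if a \<le> snd z \<and> snd z < b then fst z (snd z) else 0)"
    by (simp only: prod.case)
  ultimately show ?thesis by simp
qed

lemma measurable_action:
  assumes [measurable]: "V \<in> borel_measurable borel" and ab: "{a..b} \<subseteq> I"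
  shows "action V a b \<in> borel_measurable (paths I :: (real \<Rightarrow> 'a::euclidean_space) measure)"
proof -
  note [measurable] = measurable_evaluation'[OF ab]
  have "(\<lambda>\<omega>. \<integral>s. indicator {a..<b} s *\<^sub>R V (if a \<le> s \<and> s < b then \<omega> s else (0::'a)) \<partial>lborel)
      \<in> borel_measurable (paths I)"
    by (rule lborel.borel_measurable_lebesgue_integral) (simp add: case_prod_beta')
  then show ?thesis
    unfolding action_half_open[OF assms(1), abs_def] by simp
qed

section \<open>Cylinder sets and itineraries\<close>

definition cylinder :: "real set \<Rightarrow> real set \<Rightarrow> (real \<Rightarrow> 'a::euclidean_space set) \<Rightarrow> (real \<Rightarrow> 'a) set" where
  "cylinder I J A = {\<omega> \<in> space (paths I). \<forall>j\<in>J. \<omega> j \<in> A j}"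

definition cylinders :: "real set \<Rightarrow> real set \<Rightarrow> (real \<Rightarrow> 'a::euclidean_space) set set" where
  "cylinders I J\<^sub>0 = {cylinder I J A | J A. finite J \<and> J\<^sub>0 \<subseteq> J \<and> J \<subseteq> I \<and> (\<forall>j. A j \<in> sets borel)}"

lemma sets_cylinder:
  assumes "finite J" "J \<subseteq> I" "\<And>j. A j \<in> sets borel"
  shows "cylinder I J A \<in> sets (paths I)"
  unfolding cylinder_def
proof (rule sets.sets_Collect_finite_All[OF _ assms(1)])
  fix j assume "j \<in> J"
  then have "(\<lambda>\<omega>. \<omega> j) \<in> borel_measurable (paths I)" using assms(2) by (auto intro: measurable_coordinate)
  from measurable_sets[OF this assms(3)[of j]]
  show "{\<omega> \<in> space (paths I). \<omega> j \<in> A j} \<in> sets (paths I)" by (simp add: vimage_def Int_def conj_commute)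
qed

lemma cylinders_subset: "cylinders I J\<^sub>0 \<subseteq> sets (paths I)"
  by (auto simp: cylinders_def intro!: sets_cylinder)

lemma Int_stable_cylinders: "Int_stable (cylinders I J\<^sub>0)"
proof (rule Int_stableI)
  fix X Y :: "(real \<Rightarrow> 'a) set" assume "X \<in> cylinders I J\<^sub>0" "Y \<in> cylinders I J\<^sub>0"
  then obtain J A K B where X: "X = cylinder I J A" "finite J" "J\<^sub>0 \<subseteq> J" "J \<subseteq> I" "\<forall>j. A j \<in> sets borel"
    and Y: "Y = cylinder I K B" "finite K" "J\<^sub>0 \<subseteq> K" "K \<subseteq> I" "\<forall>j. B j \<in> sets borel"
    unfolding cylinders_def by blast
  define C where "C j = (if j \<in> J then A j else UNIV) \<inter> (if j \<in> K then B j else UNIV)" for j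
  have "X \<inter> Y = cylinder I (J \<union> K) C"
    by (auto simp: X Y cylinder_def C_def)
  moreover have "\<forall>j. C j \<in> sets borel" using X Y by (auto simp: C_def)
  ultimately show "X \<inter> Y \<in> cylinders I J\<^sub>0"
    unfolding cylinders_def using X Y by blast
qed

text \<open>Any finite set \<open>J\<^sub>0\<close> of times may be prescribed to occur in all cylinders, since a constraint at a
  further time can be left void.\<close>

lemma sets_paths_eq_sigma_cylinders:
  assumes "finite J\<^sub>0" "J\<^sub>0 \<subseteq> I"
  shows "sets (paths I) = sigma_sets (space (paths I)) (cylinders I J\<^sub>0 :: (real \<Rightarrow> 'a::euclidean_space) set set)"
proof
  show "sigma_sets (space (paths I)) (cylinders I J\<^sub>0) \<subseteq> sets (paths I :: (real \<Rightarrow> 'a) measure)"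
    by (intro sets.sigma_sets_subset cylinders_subset)
  let ?S = "sigma (space (paths I)) (cylinders I J\<^sub>0 :: (real \<Rightarrow> 'a) set set)"
  have pow: "cylinders I J\<^sub>0 \<subseteq> Pow (space (paths I :: (real \<Rightarrow> 'a) measure))"
    using cylinders_subset sets.sets_into_space by blast
  have "(\<lambda>\<omega>. \<omega>) \<in> measurable ?S (paths I)"
  proof (rule measurable_pathsI)
    fix t assume t: "t \<in> I"
    show "(\<lambda>\<omega>. \<omega> t) \<in> borel_measurable ?S"
    proof (rule measurableI)
      fix B :: "'a set" assume B: "B \<in> sets borel"
      have "(\<lambda>\<omega>. \<omega> t) -` B \<inter> space ?S = cylinder I (insert t J\<^sub>0) (\<lambda>j. if j = t then B else UNIV)"
        by (auto simp: cylinder_def space_measure_of[OF pow])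
      also have "\<dots> \<in> cylinders I J\<^sub>0"
        unfolding cylinders_def using assms t B by (auto intro!: exI[of _ "insert t J\<^sub>0"])
      finally show "(\<lambda>\<omega>. \<omega> t) -` B \<inter> space ?S \<in> sets ?S"
        by (simp add: sets_measure_of[OF pow] sigma_sets.Basic)
    qed simp
  qed (simp add: space_measure_of[OF pow])
  from measurable_sets[OF this]
  show "sets (paths I) \<subseteq> sigma_sets (space (paths I)) (cylinders I J\<^sub>0 :: (real \<Rightarrow> 'a) set set)"
    by (auto simp: sets_measure_of[OF pow] space_measure_of[OF pow] Int_absorb2 dest: sets.sets_into_space)
qed

lemma space_paths_in_cylinders:
  assumes "finite J\<^sub>0" "J\<^sub>0 \<subseteq> I"
  shows "space (paths I) \<in> cylinders I J\<^sub>0"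
proof -
  have "space (paths I) = cylinder I J\<^sub>0 (\<lambda>_. UNIV)" by (auto simp: cylinder_def)
  then show ?thesis unfolding cylinders_def using assms by (auto intro!: exI[of _ J\<^sub>0])
qed

text \<open>The prescribed times \<open>J\<^sub>0\<close> are those at which the two measures are known to split, such as the time of a
  Markov property or the ends of a window.\<close>

lemma paths_measure_eqI:
  fixes M N :: "(real \<Rightarrow> 'a::euclidean_space) measure"
  assumes "sets M = sets (paths I)" "sets N = sets (paths I)" "finite J\<^sub>0" "J\<^sub>0 \<subseteq> I"
    and fin: "emeasure M (space (paths I)) \<noteq> \<infinity>"
    and eq: "\<And>J A. finite J \<Longrightarrow> J\<^sub>0 \<subseteq> J \<Longrightarrow> J \<subseteq> I \<Longrightarrow> (\<And>j. A j \<in> sets borel) \<Longrightarrow>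
               emeasure M (cylinder I J A) = emeasure N (cylinder I J A)"
  shows "M = N"
proof (rule measure_eqI_generator_eq[where A = "\<lambda>_. space (paths I)"])
  show "Int_stable (cylinders I J\<^sub>0 :: (real \<Rightarrow> 'a) set set)" by (rule Int_stable_cylinders)
  show "cylinders I J\<^sub>0 \<subseteq> Pow (space (paths I :: (real \<Rightarrow> 'a) measure))"
    using cylinders_subset sets.sets_into_space by blast
qed (use assms sets_paths_eq_sigma_cylinders[OF assms(3,4)] space_paths_in_cylinders[OF assms(3,4)]
      in \<open>auto simp: cylinders_def\<close>)

lemma paths_kernel_measurable:
  fixes K :: "'b \<Rightarrow> (real \<Rightarrow> 'a::euclidean_space) measure"
  assumes "\<And>x. x \<in> space M \<Longrightarrow> subprob_space (K x)" "\<And>x. x \<in> space M \<Longrightarrow> sets (K x) = sets (paths I)"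
    and "finite J\<^sub>0" "J\<^sub>0 \<subseteq> I"
    and eq: "\<And>J A. finite J \<Longrightarrow> J\<^sub>0 \<subseteq> J \<Longrightarrow> J \<subseteq> I \<Longrightarrow> (\<And>j. A j \<in> sets borel) \<Longrightarrow>
               (\<lambda>x. emeasure (K x) (cylinder I J A)) \<in> borel_measurable M"
  shows "K \<in> measurable M (subprob_algebra (paths I))"
proof (rule measurable_subprob_algebra_generated[OF sets_paths_eq_sigma_cylinders[OF assms(3,4)] Int_stable_cylinders])
  show "cylinders I J\<^sub>0 \<subseteq> Pow (space (paths I :: (real \<Rightarrow> 'a) measure))"
    using cylinders_subset sets.sets_into_space by blast
  show m: "(\<lambda>a. emeasure (K a) A) \<in> borel_measurable M" if "A \<in> cylinders I J\<^sub>0" for A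
    using that eq unfolding cylinders_def by auto
  show "(\<lambda>a. emeasure (K a) (space (paths I))) \<in> borel_measurable M"
    by (rule m[OF space_paths_in_cylinders[OF assms(3,4)]])
qed (use assms in auto)

text \<open>An itinerary is a list of pairs \<open>(d, A)\<close>: after a further time \<open>d\<close> the path has to be in \<open>A\<close>. Gaps instead of
  absolute times make the description invariant under time shifts.\<close>

fun visits :: "real \<Rightarrow> (real \<times> 'a set) list \<Rightarrow> (real \<Rightarrow> 'a) \<Rightarrow> bool" where
  "visits s [] \<omega> \<longleftrightarrow> True"
| "visits s ((d, A) # L) \<omega> \<longleftrightarrow> \<omega> (s + d) \<in> A \<and> visits (s + d) L \<omega>"

fun visit_times :: "real \<Rightarrow> (real \<times> 'a set) list \<Rightarrow> real set" where
  "visit_times s [] = {s}"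
| "visit_times s ((d, A) # L) = insert s (visit_times (s + d) L)"

text \<open>The chain of an itinerary is an operator on terminal functions \<open>h\<close>. Concatenation of itineraries is then
  composition of operators, so cutting a multiple integral at an intermediate time costs no use of Fubini's
  theorem.\<close>
fun chain :: "(real \<Rightarrow> 'a \<Rightarrow> 'a \<Rightarrow> real) \<Rightarrow> (real \<times> 'a::euclidean_space set) list \<Rightarrow> ('a \<Rightarrow> ennreal) \<Rightarrow> 'a \<Rightarrow> ennreal" where
  "chain q [] h x = h x"
| "chain q ((d, A) # L) h x = (\<integral>\<^sup>+y. ennreal (q d x y) * (indicator A y * chain q L h y) \<partial>lborel)"

abbreviation duration :: "(real \<times> 'a set) list \<Rightarrow> real" where
  "duration L \<equiv> sum_list (map fst L)"

definition itinerary :: "(real \<times> 'a::euclidean_space set) list \<Rightarrow> bool" where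
  "itinerary L \<longleftrightarrow> (\<forall>(d, A) \<in> set L. 0 < d \<and> A \<in> sets borel)"

lemma itinerary_simps [simp]:
  "itinerary []"
  "itinerary ((d, A) # L) \<longleftrightarrow> 0 < d \<and> A \<in> sets borel \<and> itinerary L"
  "itinerary (L @ L') \<longleftrightarrow> itinerary L \<and> itinerary L'"
  by (auto simp: itinerary_def)

lemma duration_nonneg: "itinerary L \<Longrightarrow> 0 \<le> duration L"
  by (induction L) (auto simp: less_imp_le)

lemma visits_append: "visits s (L @ L') \<omega> \<longleftrightarrow> visits s L \<omega> \<and> visits (s + duration L) L' \<omega>"
  by (induction L arbitrary: s) (auto simp: add.assoc)

lemma visits_shift: "visits s L (\<lambda>t. \<omega> (t + c)) \<longleftrightarrow> visits (s + c) L \<omega>"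
  by (induction L arbitrary: s) (auto simp: algebra_simps)

text \<open>The starting time itself carries no constraint, so paths need to agree at later times only. Glued paths
  are compared with this.\<close>

lemma visits_cong: "(\<And>t. t \<in> visit_times s L \<Longrightarrow> s < t \<Longrightarrow> \<omega> t = \<omega>' t) \<Longrightarrow> itinerary L \<Longrightarrow> visits s L \<omega> \<longleftrightarrow> visits s L \<omega>'"
proof (induction L arbitrary: s)
  case (Cons a L)
  obtain d A where a: "a = (d, A)" by force
  have "s + d \<in> visit_times (s + d) L" by (cases L) auto
  then show ?case using Cons.IH[of "s + d"] Cons.prems by (auto simp: a)
qed simp

lemma times_append: "visit_times s (L @ L') = visit_times s L \<union> visit_times (s + duration L) L'"
  by (induction L arbitrary: s) (auto simp: add.assoc, (metis insertI1 visit_times.elims)+)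

lemma times_bounds: "itinerary L \<Longrightarrow> t \<in> visit_times s L \<Longrightarrow> s \<le> t \<and> t \<le> s + duration L"
proof (induction L arbitrary: s)
  case (Cons a L)
  then show ?case using duration_nonneg[of L] by (cases a) (force simp: algebra_simps)
qed simp

lemma times_ends: "s \<in> visit_times s L" "s + duration L \<in> visit_times s L"
proof -
  show "s \<in> visit_times s L" for s by (cases L) auto
  show "s + duration L \<in> visit_times s L"
    by (induction L arbitrary: s) (auto simp: add.assoc[symmetric])
qed

lemma sets_visits:
  assumes "itinerary L" "\<And>t. t \<in> visit_times s L \<Longrightarrow> s < t \<Longrightarrow> (\<lambda>\<omega>. Y \<omega> t) \<in> borel_measurable N"
  shows "{\<omega> \<in> space N. visits s L (Y \<omega>)} \<in> sets N"
  using assms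
proof (induction L arbitrary: s)
  case (Cons a L)
  obtain d A where a: "a = (d, A)" by force
  have "(\<lambda>\<omega>. Y \<omega> (s + d)) \<in> borel_measurable N"
    using Cons.prems times_ends(1)[of "s + d" L] by (auto simp: a)
  from measurable_sets[OF this, of A]
  have "{\<omega> \<in> space N. Y \<omega> (s + d) \<in> A} \<in> sets N" using Cons.prems by (simp add: a vimage_def Int_def conj_commute)
  moreover have "{\<omega> \<in> space N. visits (s + d) L (Y \<omega>)} \<in> sets N"
    using Cons by (auto simp: a)
  moreover have "{\<omega> \<in> space N. visits s (a # L) (Y \<omega>)}
      = {\<omega> \<in> space N. Y \<omega> (s + d) \<in> A} \<inter> {\<omega> \<in> space N. visits (s + d) L (Y \<omega>)}" by (auto simp: a)
  ultimately show ?case by simp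
qed simp

lemma pred_visits:
  assumes "itinerary L" "\<And>t. t \<in> visit_times s L \<Longrightarrow> s < t \<Longrightarrow> (\<lambda>\<omega>. Y \<omega> t) \<in> borel_measurable N"
  shows "Measurable.pred N (\<lambda>\<omega>. visits s L (Y \<omega>))"
  using sets_visits[OF assms] by (simp add: pred_def)

lemma finite_times_itinerary:
  assumes "finite J" "J \<subseteq> {s<..}" "\<And>j. A j \<in> sets (borel :: 'a::euclidean_space measure)"
  obtains L where "itinerary L" "visit_times s L = insert s J" "\<And>\<omega>. visits s L \<omega> \<longleftrightarrow> (\<forall>j\<in>J. \<omega> j \<in> A j)"
proof -
  have "\<exists>L. itinerary L \<and> visit_times s L = insert s J \<and> (\<forall>\<omega>. visits s L \<omega> \<longleftrightarrow> (\<forall>j\<in>J. \<omega> j \<in> A j))"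
    using assms(1,2)
  proof (induction J arbitrary: s rule: finite_linorder_min_induct)
    case empty
    show ?case by (intro exI[of _ "[]"]) auto
  next
    case (insert b J)
    then obtain L where L: "itinerary L" "visit_times b L = insert b J" "\<forall>\<omega>. visits b L \<omega> \<longleftrightarrow> (\<forall>j\<in>J. \<omega> j \<in> A j)"
      using insert.IH[of b] insert.hyps(2) by blast
    show ?case
      using L insert.prems assms(3) by (intro exI[of _ "(b - s, A b) # L"]) auto
  qed
  then show ?thesis using that by blast
qed

lemma chain_append: "chain q (L @ L') h x = chain q L (chain q L' h) x"
  by (induction L arbitrary: x) auto

lemma measurable_chain:
  assumes "\<And>d. 0 < d \<Longrightarrow> (\<lambda>(x, y). q d x y) \<in> borel_measurable (borel \<Otimes>\<^sub>M borel)"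
    and "itinerary L" and h [measurable]: "h \<in> borel_measurable borel"
  shows "chain q L h \<in> borel_measurable borel"
  using assms(2)
proof (induction L)
  case (Cons a L)
  obtain d A where a: "a = (d, A)" by force
  have [measurable]: "A \<in> sets borel" "chain q L h \<in> borel_measurable borel" "(\<lambda>(x, y). q d x y) \<in> borel_measurable (borel \<Otimes>\<^sub>M borel)"
    using Cons assms(1)[of d] by (auto simp: a)
  have "(\<lambda>x. \<integral>\<^sup>+y. ennreal (q d x y) * (indicator A y * chain q L h y) \<partial>lborel) \<in> borel_measurable borel"
    by measurable
  then show ?case by (simp add: a fun_eq_iff[symmetric] cong: measurable_cong)
next
  case Nil
  have "chain q [] h = h" by (rule ext) simp
  then show ?case by simp
qed

section \<open>The stable process\<close>

lemma space_gen_algebra [simp]: "space (gen_algebra M Y I) = space M"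
  by (auto simp: gen_algebra_def intro!: space_measure_of)

lemma measurable_gen_algebra:
  fixes Y :: "real \<Rightarrow> 'w \<Rightarrow> 'a::euclidean_space"
  assumes "t \<in> I"
  shows "Y t \<in> borel_measurable (gen_algebra M Y I)"
proof (rule measurableI)
  fix B :: "'a set" assume "B \<in> sets borel"
  then have "Y t -` B \<inter> space (gen_algebra M Y I) \<in> {{\<omega> \<in> space M. Y t \<omega> \<in> B} | t B. t \<in> I \<and> B \<in> sets borel}"
    using assms by (auto simp: vimage_def Int_def conj_commute)
  then show "Y t -` B \<inter> space (gen_algebra M Y I) \<in> sets (gen_algebra M Y I)"
    unfolding gen_algebra_def by (subst sets_measure_of) auto
qed simp

lemma gen_algebra_subset:
  fixes Y :: "real \<Rightarrow> 'w \<Rightarrow> 'a::euclidean_space"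
  assumes "\<And>t. t \<in> I \<Longrightarrow> Y t \<in> borel_measurable M"
  shows "sets (gen_algebra M Y I) \<subseteq> sets M"
proof -
  have "{\<omega> \<in> space M. Y t \<omega> \<in> B} \<in> sets M" if "t \<in> I" "B \<in> sets borel" for t B
    using measurable_sets[OF assms[OF that(1)] that(2)] by (simp add: vimage_def Int_def conj_commute)
  then show ?thesis unfolding gen_algebra_def by (subst sets_measure_of) (auto intro!: sets.sigma_sets_subset)
qed

text \<open>The joint law of the past and of \<open>D\<close> is a product measure, so \<open>D\<close> can be integrated out with the past
  frozen.\<close>

lemma nn_integral_indep:
  assumes M: "prob_space M" and sub: "subalgebra M S" and D [measurable]: "D \<in> measurable M N"
    and ind: "prob_space.indep_set M (sets S) {{\<omega> \<in> space M. D \<omega> \<in> B} | B. B \<in> sets N}"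
    and G: "G \<in> borel_measurable (S \<Otimes>\<^sub>M N)"
  shows "(\<integral>\<^sup>+\<omega>. G (\<omega>, D \<omega>) \<partial>M) = (\<integral>\<^sup>+\<omega>. \<integral>\<^sup>+z. G (\<omega>, z) \<partial>distr M N D \<partial>M)"
proof -
  interpret M: prob_space M by fact
  let ?R = "restr_to_subalg M S" and ?D = "distr M N D"
  interpret R: prob_space ?R by (rule prob_space_restr_to_subalg) fact+
  interpret D: prob_space ?D by (rule M.prob_space_distr) fact
  have id: "(\<lambda>\<omega>. \<omega>) \<in> measurable M S" by (rule measurable_from_subalg[OF sub]) simp
  then have pr [measurable]: "(\<lambda>\<omega>. (\<omega>, D \<omega>)) \<in> measurable M (S \<Otimes>\<^sub>M N)" by measurable
  have setsRD: "sets (?R \<Otimes>\<^sub>M ?D) = sets (S \<Otimes>\<^sub>M N)"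
    by (intro sets_pair_measure_cong) (simp_all add: sets_restr_to_subalg[OF sub])
  have setsSD: "sets (S \<Otimes>\<^sub>M ?D) = sets (S \<Otimes>\<^sub>M N)"
    by (intro sets_pair_measure_cong) simp_all
  have "?R \<Otimes>\<^sub>M ?D = distr M (S \<Otimes>\<^sub>M N) (\<lambda>\<omega>. (\<omega>, D \<omega>))"
  proof (rule pair_measure_eqI)
    show "sets (?R \<Otimes>\<^sub>M ?D) = sets (distr M (S \<Otimes>\<^sub>M N) (\<lambda>\<omega>. (\<omega>, D \<omega>)))"
      using setsRD by simp
    fix A B assume "A \<in> sets ?R" "B \<in> sets ?D"
    then have A: "A \<in> sets S" and B [measurable]: "B \<in> sets N" by (auto simp: sets_restr_to_subalg[OF sub])
    have AM [measurable]: "A \<in> sets M" using A sub by (auto simp: subalgebra_def)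
    have eq: "(\<lambda>\<omega>. (\<omega>, D \<omega>)) -` (A \<times> B) \<inter> space M = A \<inter> {\<omega> \<in> space M. D \<omega> \<in> B}"
      using sets.sets_into_space[OF AM] by auto
    have "M.prob (A \<inter> {\<omega> \<in> space M. D \<omega> \<in> B}) = M.prob A * M.prob {\<omega> \<in> space M. D \<omega> \<in> B}"
      by (rule M.indep_setD[OF ind A]) (use B in auto)
    then have pr: "emeasure M (A \<inter> {\<omega> \<in> space M. D \<omega> \<in> B}) = emeasure M A * emeasure M {\<omega> \<in> space M. D \<omega> \<in> B}"
      by (simp add: M.emeasure_eq_measure ennreal_mult')
    have eq': "D -` B \<inter> space M = {\<omega> \<in> space M. D \<omega> \<in> B}" by auto
    show "emeasure ?R A * emeasure ?D B = emeasure (distr M (S \<Otimes>\<^sub>M N) (\<lambda>\<omega>. (\<omega>, D \<omega>))) (A \<times> B)"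
      using A by (subst emeasure_distr) (simp_all add: eq eq' pr emeasure_restr_to_subalg[OF sub] emeasure_distr)
  qed (intro R.sigma_finite_measure_axioms D.sigma_finite_measure_axioms)+
  moreover have "(\<integral>\<^sup>+\<omega>. G (\<omega>, D \<omega>) \<partial>M) = (\<integral>\<^sup>+z. G z \<partial>distr M (S \<Otimes>\<^sub>M N) (\<lambda>\<omega>. (\<omega>, D \<omega>)))"
    using G by (subst nn_integral_distr) auto
  moreover have G': "G \<in> borel_measurable (?R \<Otimes>\<^sub>M ?D)"
    using G measurable_cong_sets[OF setsRD refl] by blast
  have GS: "(\<lambda>(\<omega>, z). G (\<omega>, z)) \<in> borel_measurable (S \<Otimes>\<^sub>M ?D)"
    using G measurable_cong_sets[OF setsSD refl] by (simp add: case_prod_beta')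
  have "(\<integral>\<^sup>+z. G z \<partial>(?R \<Otimes>\<^sub>M ?D)) = (\<integral>\<^sup>+\<omega>. \<integral>\<^sup>+z. G (\<omega>, z) \<partial>?D \<partial>?R)"
    by (rule D.nn_integral_fst[symmetric, OF G'])
  moreover have "\<dots> = (\<integral>\<^sup>+\<omega>. \<integral>\<^sup>+z. G (\<omega>, z) \<partial>?D \<partial>M)"
    by (rule nn_integral_subalgebra2[OF sub D.borel_measurable_nn_integral[OF GS]])
  ultimately show ?thesis by simp
qed

locale stable =
  fixes \<alpha> :: real and P :: "'a::euclidean_space \<Rightarrow> (real \<Rightarrow> 'a) measure" and p :: "real \<Rightarrow> 'a \<Rightarrow> real"
  assumes stable: "stable_process \<alpha> P" and density: "transition_density P p"
begin

lemma prob_space_P0: "prob_space (P 0)"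
  using stable unfolding stable_process_def by (elim conjE)

lemma sets_P0: "sets (P 0) = sets (paths {0..})"
  using stable unfolding stable_process_def by (elim conjE)

lemma P0_start: "AE \<omega> in P 0. \<omega> 0 = 0"
  using stable unfolding stable_process_def by (elim conjE)

lemma P_eq: "P x = distr (P 0) (paths {0..}) (\<lambda>\<omega>. \<lambda>t\<in>{0..}. x + \<omega> t)"
proof -
  have "\<forall>x. P x = distr (P 0) (paths {0..}) (\<lambda>\<omega>. \<lambda>t\<in>{0..}. x + \<omega> t)"
    using stable unfolding stable_process_def by (elim conjE)
  then show ?thesis by (rule spec)
qed

lemma p_measurable [measurable]: "0 < d \<Longrightarrow> p d \<in> borel_measurable borel"
  using density by (auto simp: transition_density_def intro: borel_measurable_continuous_onI)

lemma p_nonneg: "0 < d \<Longrightarrow> 0 \<le> p d x"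
  using density by (auto simp: transition_density_def)

definition pk :: "real \<Rightarrow> 'a \<Rightarrow> 'a \<Rightarrow> real" where "pk d x y = p d (y - x)"

lemma pk_measurable: "0 < d \<Longrightarrow> (\<lambda>(x, y). pk d x y) \<in> borel_measurable (borel \<Otimes>\<^sub>M borel)"
  unfolding pk_def by measurable

lemma translate_space:
  fixes x :: 'a
  assumes "\<omega> \<in> space (paths {0..})"
  shows "(\<lambda>t\<in>{0..}. x + \<omega> t) \<in> space (paths {0..})"
proof -
  from assms have w: "\<omega> \<in> cadlag_on {0..}" by (auto simp: space_paths)
  have "(\<lambda>t\<in>{0..}. x + \<omega> t) \<in> cadlag_on {0..}"
    unfolding cadlag_on_def
  proof (intro CollectI ballI conjI)
    fix t :: real assume t: "t \<in> {0..}"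
    have "((\<lambda>t. x + \<omega> t) \<longlongrightarrow> x + \<omega> t) (at t within {0..} \<inter> {t<..})"
      by (intro tendsto_add tendsto_const cadlag_onD(1)[OF w t])
    then have "((\<lambda>t\<in>{0..}. x + \<omega> t) \<longlongrightarrow> x + \<omega> t) (at t within {0..} \<inter> {t<..})"
      by (rule tendsto_relocate[where c = 0 and e = 1]) auto
    then show "((\<lambda>t\<in>{0..}. x + \<omega> t) \<longlongrightarrow> (\<lambda>t\<in>{0..}. x + \<omega> t) t) (at t within {0..} \<inter> {t<..})"
      using t by simp
    obtain l where "(\<omega> \<longlongrightarrow> l) (at t within {0..} \<inter> {..<t})" using cadlag_onD(2)[OF w t] by blast
    then have "((\<lambda>t. x + \<omega> t) \<longlongrightarrow> x + l) (at t within {0..} \<inter> {..<t})" by (intro tendsto_add tendsto_const)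
    then have "((\<lambda>t\<in>{0..}. x + \<omega> t) \<longlongrightarrow> x + l) (at t within {0..} \<inter> {..<t})"
      by (rule tendsto_relocate[where c = 0 and e = 1]) auto
    then show "\<exists>l. ((\<lambda>t\<in>{0..}. x + \<omega> t) \<longlongrightarrow> l) (at t within {0..} \<inter> {..<t})" by blast
  qed
  then show ?thesis by (auto simp: space_paths)
qed

lemma translate_measurable:
  "(\<lambda>(x :: 'a, \<omega>). \<lambda>t\<in>{0..}. x + \<omega> t) \<in> measurable (borel \<Otimes>\<^sub>M paths {0..}) (paths {0..})"
proof (rule measurable_pathsI)
  fix z :: "'a \<times> (real \<Rightarrow> 'a)" assume "z \<in> space (borel \<Otimes>\<^sub>M paths {0..})"
  then show "(case z of (x, \<omega>) \<Rightarrow> \<lambda>t\<in>{0..}. x + \<omega> t) \<in> space (paths {0..})"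
    by (cases z) (auto simp: space_pair_measure intro!: translate_space)
next
  fix t :: real assume t: "t \<in> {0..}"
  have [measurable]: "(\<lambda>\<omega>. \<omega> t) \<in> borel_measurable (paths {0..})" using t by (rule measurable_coordinate)
  have "(\<lambda>z. fst z + snd z t) \<in> borel_measurable (borel \<Otimes>\<^sub>M (paths {0..} :: (real \<Rightarrow> 'a) measure))" by measurable
  then show "(\<lambda>z. (case z of (x, \<omega>) \<Rightarrow> \<lambda>t\<in>{0..}. x + \<omega> t) t) \<in> borel_measurable (borel \<Otimes>\<^sub>M paths {0..})"
    using t by (simp add: case_prod_beta')
qed

lemma translate_measurable1: "(\<lambda>\<omega>. \<lambda>t\<in>{0..}. (x :: 'a) + \<omega> t) \<in> measurable (P 0) (paths {0..})"
proof -
  have "Pair x \<in> measurable (paths {0..}) (borel \<Otimes>\<^sub>M (paths {0..} :: (real \<Rightarrow> 'a) measure))"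
    by (rule measurable_Pair1') simp
  from measurable_compose[OF this translate_measurable] show ?thesis
    by (simp add: measurable_cong_sets[OF sets_P0 refl])
qed

lemma P_kernel [measurable]: "P \<in> measurable borel (subprob_algebra (paths {0..}))"
proof -
  have "(\<lambda>x. distr (P 0) (paths {0..}) (\<lambda>\<omega>. \<lambda>t\<in>{0..}. x + \<omega> t)) \<in> measurable borel (subprob_algebra (paths {0..}))"
    using prob_space_P0 sets_P0
    by (intro measurable_distr2[OF translate_measurable] measurable_const)
      (auto simp: space_subprob_algebra prob_space_imp_subprob_space)
  moreover have "(\<lambda>x. distr (P 0) (paths {0..}) (\<lambda>\<omega>. \<lambda>t\<in>{0..}. x + \<omega> t)) = P"
    by (rule ext) (rule P_eq[symmetric])
  ultimately show ?thesis by simp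
qed

lemma prob_space_P: "prob_space (P x)"
  by (subst P_eq) (rule prob_space.prob_space_distr[OF prob_space_P0 translate_measurable1])

lemma sets_P: "sets (P x) = sets (paths {0..})" by (subst P_eq) simp

lemma space_P: "space (P x) = space (paths {0..})"
  using sets_eq_imp_space_eq[OF sets_P] .

lemma nn_integral_P:
  "f \<in> borel_measurable (paths {0..}) \<Longrightarrow> (\<integral>\<^sup>+\<omega>. f \<omega> \<partial>P x) = (\<integral>\<^sup>+\<omega>. f (\<lambda>t\<in>{0..}. x + \<omega> t) \<partial>P 0)"
  by (subst P_eq) (simp add: nn_integral_distr[OF translate_measurable1])

lemma P_start: "AE \<omega> in P x. \<omega> 0 = x"
proof -
  have *: "{\<omega> \<in> space (paths {0..}). \<omega> 0 = x} \<in> sets (paths {0..} :: (real \<Rightarrow> 'a) measure)"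
    using measurable_sets[OF measurable_coordinate[of "0::real" "{0..}"], of "{x}"]
    by (simp add: vimage_def Int_def conj_commute)
  from P0_start show ?thesis
    unfolding P_eq[of x] AE_distr_iff[OF translate_measurable1 *] by (auto elim: eventually_mono)
qed

text \<open>The one-step case of the finite-dimensional distributions: the increment after time \<open>s\<close> is
  independent of the past and has density \<open>p d\<close>.\<close>

lemma P0_step:
  assumes "0 \<le> s" "0 < d"
    and Q: "{\<omega> \<in> space (P 0). Q \<omega>} \<in> sets (gen_algebra (P 0) (\<lambda>r \<omega>. \<omega> r) {0..s})"
    and k [measurable]: "k \<in> borel_measurable borel"
  shows "(\<integral>\<^sup>+\<omega>. indicator {\<omega>. Q \<omega>} \<omega> * k (\<omega> (s + d)) \<partial>P 0)
       = (\<integral>\<^sup>+\<omega>. indicator {\<omega>. Q \<omega>} \<omega> * (\<integral>\<^sup>+y. ennreal (p d (y - \<omega> s)) * k y \<partial>lborel) \<partial>P 0)"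
proof -
  let ?S = "gen_algebra (P 0) (\<lambda>r \<omega>. \<omega> r) {0..s}"
  define G where "G z = indicator {\<omega> \<in> space ?S. Q \<omega>} (fst z) * k (fst z s + snd z)" for z :: "(real \<Rightarrow> 'a) \<times> 'a"
  have [measurable]: "{\<omega> \<in> space ?S. Q \<omega>} \<in> sets ?S" using Q by simp
  have [measurable]: "(\<lambda>\<omega>. \<omega> s) \<in> borel_measurable ?S" using assms by (intro measurable_gen_algebra) auto
  have coord: "(\<lambda>\<omega>. \<omega> t) \<in> borel_measurable (P 0)" if "0 \<le> t" for t
    using that by (intro measurable_coordinate'[OF sets_P0]) auto
  have [measurable]: "(\<lambda>\<omega>. \<omega> s) \<in> borel_measurable (P 0)" "(\<lambda>\<omega>. \<omega> (s + d)) \<in> borel_measurable (P 0)"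
    using coord assms by auto
  have sub: "subalgebra (P 0) ?S"
    unfolding subalgebra_def by (intro conjI space_gen_algebra gen_algebra_subset coord) auto
  have D: "(\<lambda>\<omega>. \<omega> (s + d) - \<omega> s) \<in> borel_measurable (P 0)" by measurable
  have ind: "prob_space.indep_set (P 0) (sets ?S) {{\<omega> \<in> space (P 0). \<omega> (s + d) - \<omega> s \<in> B} | B. B \<in> sets borel}"
    and dd: "distr (P 0) borel (\<lambda>\<omega>. \<omega> (s + d) - \<omega> s) = distr (P 0) borel (\<lambda>\<omega>. \<omega> (s + d - s))"
  proof -
    have "\<forall>s t. 0 \<le> s \<and> s \<le> t \<longrightarrow>
        prob_space.indep_set (P 0) (sets (gen_algebra (P 0) (\<lambda>r \<omega>. \<omega> r) {0..s}))
          {{\<omega> \<in> space (P 0). \<omega> t - \<omega> s \<in> B} | B. B \<in> sets borel} \<and>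
        distr (P 0) borel (\<lambda>\<omega>. \<omega> t - \<omega> s) = distr (P 0) borel (\<lambda>\<omega>. \<omega> (t - s))"
      using stable unfolding stable_process_def by (elim conjE)
    from this[rule_format, of s "s + d"]
    show "prob_space.indep_set (P 0) (sets ?S) {{\<omega> \<in> space (P 0). \<omega> (s + d) - \<omega> s \<in> B} | B. B \<in> sets borel}"
      "distr (P 0) borel (\<lambda>\<omega>. \<omega> (s + d) - \<omega> s) = distr (P 0) borel (\<lambda>\<omega>. \<omega> (s + d - s))"
      using assms by simp_all
  qed
  have dd': "distr (P 0) borel (\<lambda>\<omega>. \<omega> (s + d) - \<omega> s) = density lborel (\<lambda>x. ennreal (p d x))"
    using density assms unfolding dd by (simp add: transition_density_def)
  have GM: "G \<in> borel_measurable (?S \<Otimes>\<^sub>M borel)" unfolding G_def by measurable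
  have "(\<integral>\<^sup>+\<omega>. indicator {\<omega>. Q \<omega>} \<omega> * k (\<omega> (s + d)) \<partial>P 0) = (\<integral>\<^sup>+\<omega>. G (\<omega>, \<omega> (s + d) - \<omega> s) \<partial>P 0)"
    by (intro nn_integral_cong) (auto simp: G_def indicator_def)
  also have "\<dots> = (\<integral>\<^sup>+\<omega>. \<integral>\<^sup>+z. G (\<omega>, z) \<partial>density lborel (\<lambda>x. ennreal (p d x)) \<partial>P 0)"
    using nn_integral_indep[OF prob_space_P0 sub D ind GM] unfolding dd' by simp
  also have "\<dots> = (\<integral>\<^sup>+\<omega>. indicator {\<omega>. Q \<omega>} \<omega> * (\<integral>\<^sup>+y. ennreal (p d (y - \<omega> s)) * k y \<partial>lborel) \<partial>P 0)"
  proof (intro nn_integral_cong)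
    fix \<omega> assume w: "\<omega> \<in> space (P 0)"
    have "(\<integral>\<^sup>+z. G (\<omega>, z) \<partial>density lborel (\<lambda>x. ennreal (p d x)))
        = (\<integral>\<^sup>+z. ennreal (p d z) * (indicator {\<omega>. Q \<omega>} \<omega> * k (\<omega> s + z)) \<partial>lborel)"
      using assms w by (subst nn_integral_density) (auto simp: G_def indicator_def)
    also have "\<dots> = indicator {\<omega>. Q \<omega>} \<omega> * (\<integral>\<^sup>+z. ennreal (p d z) * k (\<omega> s + z) \<partial>lborel)"
      using assms by (subst nn_integral_cmult[symmetric]) (auto simp: ac_simps)
    also have "(\<integral>\<^sup>+z. ennreal (p d z) * k (\<omega> s + z) \<partial>lborel)
        = (\<integral>\<^sup>+z. ennreal (p d z) * k (\<omega> s + z) \<partial>distr lborel borel ((+) (- \<omega> s)))"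
      by (simp add: lborel_distr_plus)
    also have "\<dots> = (\<integral>\<^sup>+y. ennreal (p d (y - \<omega> s)) * k y \<partial>lborel)"
      using assms by (subst nn_integral_distr) auto
    finally show "(\<integral>\<^sup>+z. G (\<omega>, z) \<partial>density lborel (\<lambda>x. ennreal (p d x)))
        = indicator {\<omega>. Q \<omega>} \<omega> * (\<integral>\<^sup>+y. ennreal (p d (y - \<omega> s)) * k y \<partial>lborel)" .
  qed
  finally show ?thesis .
qed

text \<open>Induction from the right end of the itinerary: the last increment is independent of everything before and
  turns the terminal function \<open>h\<close> into a one-step chain.\<close>

lemma P_visits:
  assumes "itinerary L" "h \<in> borel_measurable borel"
  shows "(\<integral>\<^sup>+\<omega>. indicator {\<omega>. visits 0 L \<omega>} \<omega> * h (\<omega> (duration L)) \<partial>P x) = chain pk L h x"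
proof -
  have cong: "visits 0 L (\<lambda>t\<in>{0..}. x + \<omega> t) = visits 0 L (\<lambda>t. x + \<omega> t)" if "itinerary L" for L \<omega>
    by (rule visits_cong) (use that in auto)
  have coord: "(\<lambda>\<omega>. \<omega> t) \<in> borel_measurable (paths {0..} :: (real \<Rightarrow> 'a) measure)" if "0 \<le> t" for t
    using that by (intro measurable_coordinate) auto
  have "(\<integral>\<^sup>+\<omega>. indicator {\<omega>. visits 0 L (\<lambda>t. x + \<omega> t)} \<omega> * h (x + \<omega> (duration L)) \<partial>P 0) = chain pk L h x"
    using assms
  proof (induction L arbitrary: h rule: rev_induct)
    case Nil
    have "(\<integral>\<^sup>+\<omega>. h (x + \<omega> 0) \<partial>P 0) = (\<integral>\<^sup>+\<omega>. h x \<partial>P 0)"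
      by (rule nn_integral_cong_AE) (use P0_start in \<open>auto elim: eventually_mono\<close>)
    then show ?case using prob_space.emeasure_space_1[OF prob_space_P0] by simp
  next
    case (snoc a L)
    obtain d A where a: "a = (d, A)" by force
    have [measurable]: "A \<in> sets borel" "h \<in> borel_measurable borel" and d: "0 < d" and L: "itinerary L"
      using snoc.prems by (auto simp: a)
    let ?s = "duration L"
    have s: "0 \<le> ?s" by (rule duration_nonneg[OF L])
    define k where "k w = (\<integral>\<^sup>+y. ennreal (p d (y - w)) * (indicator A y * h y) \<partial>lborel)" for w
    have k: "k = chain pk [a] h" by (auto simp: k_def a pk_def fun_eq_iff)
    have "k \<in> borel_measurable borel" unfolding k using snoc.prems by (intro measurable_chain pk_measurable) (auto simp: a)
    have Q: "{\<omega> \<in> space (P 0). visits 0 L (\<lambda>t. x + \<omega> t)} \<in> sets (gen_algebra (P 0) (\<lambda>r \<omega>. \<omega> r) {0..?s})"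
    proof -
      have "(\<lambda>\<omega>. \<omega> t) \<in> borel_measurable (gen_algebra (P 0) (\<lambda>r \<omega>. \<omega> r :: 'a) {0..?s})" if "t \<in> visit_times 0 L" for t
        using times_bounds[OF L that] by (intro measurable_gen_algebra) auto
      then have "{\<omega> \<in> space (gen_algebra (P 0) (\<lambda>r \<omega>. \<omega> r) {0..?s}). visits 0 L (\<lambda>t. x + \<omega> t)}
          \<in> sets (gen_algebra (P 0) (\<lambda>r \<omega>. \<omega> r) {0..?s})"
        by (intro sets_visits[OF L] borel_measurable_add) auto
      then show ?thesis by simp
    qed
    have "(\<integral>\<^sup>+\<omega>. indicator {\<omega>. visits 0 (L @ [a]) (\<lambda>t. x + \<omega> t)} \<omega> * h (x + \<omega> (duration (L @ [a]))) \<partial>P 0)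
        = (\<integral>\<^sup>+\<omega>. indicator {\<omega>. visits 0 L (\<lambda>t. x + \<omega> t)} \<omega> *
             (indicator A (x + \<omega> (?s + d)) * h (x + \<omega> (?s + d))) \<partial>P 0)"
      by (intro nn_integral_cong) (auto simp: a visits_append indicator_def)
    also have "\<dots> = (\<integral>\<^sup>+\<omega>. indicator {\<omega>. visits 0 L (\<lambda>t. x + \<omega> t)} \<omega> *
             (\<integral>\<^sup>+y. ennreal (p d (y - \<omega> ?s)) * (indicator A (x + y) * h (x + y)) \<partial>lborel) \<partial>P 0)"
      by (rule P0_step[OF s d Q]) measurable
    also have "\<dots> = (\<integral>\<^sup>+\<omega>. indicator {\<omega>. visits 0 L (\<lambda>t. x + \<omega> t)} \<omega> * k (x + \<omega> ?s) \<partial>P 0)"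
    proof (intro nn_integral_cong arg_cong2[where f = "(*)"] refl)
      fix \<omega> :: "real \<Rightarrow> 'a"
      have "k (x + \<omega> ?s) = (\<integral>\<^sup>+y. ennreal (p d (y - (x + \<omega> ?s))) * (indicator A y * h y) \<partial>distr lborel borel ((+) x))"
        by (simp add: k_def lborel_distr_plus)
      also have "\<dots> = (\<integral>\<^sup>+y. ennreal (p d (y - \<omega> ?s)) * (indicator A (x + y) * h (x + y)) \<partial>lborel)"
        using d by (subst nn_integral_distr) (auto simp: algebra_simps)
      finally show "(\<integral>\<^sup>+y. ennreal (p d (y - \<omega> ?s)) * (indicator A (x + y) * h (x + y)) \<partial>lborel) = k (x + \<omega> ?s)" ..
    qed
    also have "\<dots> = chain pk L k x"
      by (rule snoc.IH[OF L \<open>k \<in> _\<close>])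
    also have "\<dots> = chain pk (L @ [a]) h x"
      unfolding k by (simp add: chain_append)
    finally show ?case .
  qed
  moreover have "(\<integral>\<^sup>+\<omega>. indicator {\<omega>. visits 0 L \<omega>} \<omega> * h (\<omega> (duration L)) \<partial>P x)
      = (\<integral>\<^sup>+\<omega>. indicator {\<omega>. visits 0 L (\<lambda>t. x + \<omega> t)} \<omega> * h (x + \<omega> (duration L)) \<partial>P 0)"
  proof -
    have [measurable]: "Measurable.pred (paths {0..}) (visits 0 L :: (real \<Rightarrow> 'a) \<Rightarrow> bool)"
      using pred_visits[OF assms(1) coord, of 0 "\<lambda>\<omega>. \<omega>"] by auto
    have [measurable]: "(\<lambda>\<omega>. \<omega> (duration L)) \<in> borel_measurable (paths {0..} :: (real \<Rightarrow> 'a) measure)"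
      using duration_nonneg[OF assms(1)] by (rule coord)
    note assms(2)[measurable]
    have "(\<lambda>\<omega>. indicator {\<omega>. visits 0 L \<omega>} \<omega> * h (\<omega> (duration L))) \<in> borel_measurable (paths {0..})"
      by measurable
    from nn_integral_P[OF this] show ?thesis
      using duration_nonneg[OF assms(1)] by (simp add: cong[OF assms(1)] indicator_def)
  qed
  ultimately show ?thesis by simp
qed

end

section \<open>The Markov property on path space\<close>

definition markov_glue :: "real \<Rightarrow> (real \<Rightarrow> 'a) \<Rightarrow> (real \<Rightarrow> 'a) \<Rightarrow> real \<Rightarrow> 'a" where
  "markov_glue t\<^sub>1 \<omega> \<omega>' = (\<lambda>t\<in>{0..}. if t < t\<^sub>1 then \<omega> t else \<omega>' (t - t\<^sub>1))"

lemma markov_glue_space: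
  assumes "0 \<le> t\<^sub>1" "\<omega> \<in> space (paths {0..})" "\<omega>' \<in> space (paths {0..})"
  shows "markov_glue t\<^sub>1 \<omega> \<omega>' \<in> space (paths {0..} :: (real \<Rightarrow> 'a::euclidean_space) measure)"
proof -
  let ?g = "markov_glue t\<^sub>1 \<omega> \<omega>'"
  have w: "\<omega> \<in> cadlag_on {0..}" "\<omega>' \<in> cadlag_on {0..}" using assms by (auto simp: space_paths)
  have "?g \<in> cadlag_on {0..}"
    unfolding cadlag_on_def
  proof (intro CollectI ballI conjI)
    fix t :: real assume t: "t \<in> {0..}"
    show "(?g \<longlongrightarrow> ?g t) (at t within {0..} \<inter> {t<..})"
    proof (cases "t < t\<^sub>1")
      case True
      have "?g t = \<omega> t" using t True by (simp add: markov_glue_def)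
      moreover have "(?g \<longlongrightarrow> \<omega> t) (at t within {0..} \<inter> {t<..})"
        by (rule tendsto_relocate[where c = 0 and e = "t\<^sub>1 - t", OF cadlag_onD(1)[OF w(1) t]])
          (use True in \<open>auto simp: markov_glue_def\<close>)
      ultimately show ?thesis by simp
    next
      case False
      then have t': "t - t\<^sub>1 \<in> {0..}" by simp
      have "?g t = \<omega>' (t - t\<^sub>1)" using t False by (simp add: markov_glue_def)
      moreover have "(?g \<longlongrightarrow> \<omega>' (t - t\<^sub>1)) (at t within {0..} \<inter> {t<..})"
        by (rule tendsto_relocate[where c = "- t\<^sub>1" and e = 1, OF cadlag_onD(1)[OF w(2) t']])
          (use False in \<open>auto simp: markov_glue_def\<close>)
      ultimately show ?thesis by simp
    qed
    show "\<exists>l. (?g \<longlongrightarrow> l) (at t within {0..} \<inter> {..<t})"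
    proof (cases "t \<le> t\<^sub>1")
      case True
      obtain l where l: "(\<omega> \<longlongrightarrow> l) (at t within {0..} \<inter> {..<t})" using cadlag_onD(2)[OF w(1) t] by blast
      have "(?g \<longlongrightarrow> l) (at t within {0..} \<inter> {..<t})"
        by (rule tendsto_relocate[where c = 0 and e = 1, OF l])
          (use True in \<open>auto simp: markov_glue_def\<close>)
      then show ?thesis by blast
    next
      case False
      then have t': "t - t\<^sub>1 \<in> {0..}" by simp
      obtain l where l: "(\<omega>' \<longlongrightarrow> l) (at (t - t\<^sub>1) within {0..} \<inter> {..<t - t\<^sub>1})"
        using cadlag_onD(2)[OF w(2) t'] by blast
      have "(?g \<longlongrightarrow> l) (at t within {0..} \<inter> {..<t})"
        by (rule tendsto_relocate[where c = "- t\<^sub>1" and e = "t - t\<^sub>1", OF l])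
          (use False in \<open>auto simp: markov_glue_def\<close>)
      then show ?thesis by blast
    qed
  qed
  then show ?thesis by (auto simp: space_paths markov_glue_def)
qed

lemma markov_glue_measurable:
  assumes "0 \<le> t\<^sub>1"
  shows "(\<lambda>(\<omega>, \<omega>'). markov_glue t\<^sub>1 \<omega> \<omega>')
     \<in> measurable (paths {0..} \<Otimes>\<^sub>M paths {0..}) (paths {0..} :: (real \<Rightarrow> 'a::euclidean_space) measure)"
proof (rule measurable_pathsI)
  fix z :: "(real \<Rightarrow> 'a) \<times> (real \<Rightarrow> 'a)" assume "z \<in> space (paths {0..} \<Otimes>\<^sub>M paths {0..})"
  then show "(case z of (\<omega>, \<omega>') \<Rightarrow> markov_glue t\<^sub>1 \<omega> \<omega>') \<in> space (paths {0..})"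
    using assms by (cases z) (auto simp: space_pair_measure intro!: markov_glue_space)
next
  fix t :: real assume t: "t \<in> {0..}"
  have 1: "(\<lambda>z. fst z t) \<in> borel_measurable ((paths {0..} :: (real \<Rightarrow> 'a) measure) \<Otimes>\<^sub>M (paths {0..} :: (real \<Rightarrow> 'a) measure))"
    using measurable_compose[OF measurable_fst measurable_coordinate[OF t]] .
  have 2: "(\<lambda>z. snd z (t - t\<^sub>1)) \<in> borel_measurable ((paths {0..} :: (real \<Rightarrow> 'a) measure) \<Otimes>\<^sub>M (paths {0..} :: (real \<Rightarrow> 'a) measure))"
    if "\<not> t < t\<^sub>1"
    using measurable_compose[OF measurable_snd measurable_coordinate[of "t - t\<^sub>1" "{0..}"]] that by auto
  show "(\<lambda>z. (case z of (\<omega>, \<omega>') \<Rightarrow> markov_glue t\<^sub>1 \<omega> \<omega>') t)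
      \<in> borel_measurable ((paths {0..} :: (real \<Rightarrow> 'a) measure) \<Otimes>\<^sub>M (paths {0..} :: (real \<Rightarrow> 'a) measure))"
    using t 1 2 by (cases "t < t\<^sub>1") (simp_all add: case_prod_beta' markov_glue_def)
qed

lemma cylinder_nonneg_times:
  fixes A :: "real \<Rightarrow> 'a::euclidean_space set"
  assumes "finite J" "{0, t\<^sub>1} \<subseteq> J" "J \<subseteq> {0..}" "0 < t\<^sub>1" "\<And>j. A j \<in> sets borel"
  obtains L\<^sub>1 L\<^sub>2 where "itinerary L\<^sub>1" "itinerary L\<^sub>2" "visit_times 0 L\<^sub>1 \<subseteq> {0..<t\<^sub>1}"
    "\<And>\<omega>. (\<forall>j\<in>J. \<omega> j \<in> A j) \<longleftrightarrow> \<omega> 0 \<in> A 0 \<and> visits 0 L\<^sub>1 \<omega> \<and> \<omega> t\<^sub>1 \<in> A t\<^sub>1 \<and> visits t\<^sub>1 L\<^sub>2 \<omega>"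
proof -
  obtain L\<^sub>1 where L1: "itinerary L\<^sub>1" "visit_times 0 L\<^sub>1 = insert 0 (J \<inter> {0<..<t\<^sub>1})"
      "\<And>\<omega>. visits 0 L\<^sub>1 \<omega> \<longleftrightarrow> (\<forall>j\<in>J \<inter> {0<..<t\<^sub>1}. \<omega> j \<in> A j)"
    by (rule finite_times_itinerary[of "J \<inter> {0<..<t\<^sub>1}" 0 A]) (use assms in auto)
  obtain L\<^sub>2 where L2: "itinerary L\<^sub>2" "visit_times t\<^sub>1 L\<^sub>2 = insert t\<^sub>1 (J \<inter> {t\<^sub>1<..})"
      "\<And>\<omega>. visits t\<^sub>1 L\<^sub>2 \<omega> \<longleftrightarrow> (\<forall>j\<in>J \<inter> {t\<^sub>1<..}. \<omega> j \<in> A j)"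
    by (rule finite_times_itinerary[of "J \<inter> {t\<^sub>1<..}" t\<^sub>1 A]) (use assms in auto)
  have split: "J = {0, t\<^sub>1} \<union> (J \<inter> {0<..<t\<^sub>1}) \<union> (J \<inter> {t\<^sub>1<..})"
  proof
    show "J \<subseteq> {0, t\<^sub>1} \<union> (J \<inter> {0<..<t\<^sub>1}) \<union> (J \<inter> {t\<^sub>1<..})"
      using assms(3) by (auto simp: less_le)
  qed (use assms(2) in auto)
  have "(\<forall>j\<in>J. \<omega> j \<in> A j) \<longleftrightarrow> \<omega> 0 \<in> A 0 \<and> visits 0 L\<^sub>1 \<omega> \<and> \<omega> t\<^sub>1 \<in> A t\<^sub>1 \<and> visits t\<^sub>1 L\<^sub>2 \<omega>" for \<omega>
    unfolding L1(3) L2(3) by (subst split) blast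
  with L1(1,2) L2(1) assms(4) show ?thesis by (intro that) auto
qed

lemma visits_markov_glue:
  assumes "0 < t\<^sub>1" "itinerary L\<^sub>1" "visit_times 0 L\<^sub>1 \<subseteq> {0..<t\<^sub>1}" "itinerary L\<^sub>2"
  shows "visits 0 L\<^sub>1 (markov_glue t\<^sub>1 \<omega> \<omega>') \<longleftrightarrow> visits 0 L\<^sub>1 \<omega>"
    and "visits t\<^sub>1 L\<^sub>2 (markov_glue t\<^sub>1 \<omega> \<omega>') \<longleftrightarrow> visits 0 L\<^sub>2 \<omega>'"
proof -
  show "visits 0 L\<^sub>1 (markov_glue t\<^sub>1 \<omega> \<omega>') \<longleftrightarrow> visits 0 L\<^sub>1 \<omega>"
    by (rule visits_cong) (use assms in \<open>auto simp: markov_glue_def\<close>)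
  have "visits t\<^sub>1 L\<^sub>2 (markov_glue t\<^sub>1 \<omega> \<omega>') \<longleftrightarrow> visits 0 L\<^sub>2 (\<lambda>t. markov_glue t\<^sub>1 \<omega> \<omega>' (t + t\<^sub>1))"
    by (simp add: visits_shift)
  also have "\<dots> \<longleftrightarrow> visits 0 L\<^sub>2 \<omega>'"
    by (rule visits_cong) (use assms in \<open>auto simp: markov_glue_def\<close>)
  finally show "visits t\<^sub>1 L\<^sub>2 (markov_glue t\<^sub>1 \<omega> \<omega>') \<longleftrightarrow> visits 0 L\<^sub>2 \<omega>'" .
qed

context stable
begin

definition markov_kernel :: "real \<Rightarrow> (real \<Rightarrow> 'a) \<Rightarrow> (real \<Rightarrow> 'a) measure" where
  "markov_kernel t\<^sub>1 \<omega> = distr (P (\<omega> t\<^sub>1)) (paths {0..}) (markov_glue t\<^sub>1 \<omega>)"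

lemma markov_kernel_measurable:
  assumes "0 \<le> t\<^sub>1"
  shows "markov_kernel t\<^sub>1 \<in> measurable (paths {0..}) (subprob_algebra (paths {0..}))"
  unfolding markov_kernel_def[abs_def]
  by (rule measurable_distr2[OF markov_glue_measurable measurable_compose[OF measurable_coordinate P_kernel]])
    (use assms in auto)

lemma markov_glue_measurable1:
  assumes "0 \<le> t\<^sub>1" "\<omega> \<in> space (paths {0..})"
  shows "markov_glue t\<^sub>1 \<omega> \<in> measurable (P y) (paths {0..} :: (real \<Rightarrow> 'a) measure)"
proof -
  have "Pair \<omega> \<in> measurable (paths {0..}) (paths {0..} \<Otimes>\<^sub>M (paths {0..} :: (real \<Rightarrow> 'a) measure))"
    by (rule measurable_Pair1') (rule assms)
  from measurable_compose[OF this markov_glue_measurable[OF assms(1)]] show ?thesis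
    by (simp add: measurable_cong_sets[OF sets_P refl])
qed

lemma pred_visits_paths: "itinerary L \<Longrightarrow> Measurable.pred (paths {0..} :: (real \<Rightarrow> 'a) measure) (visits 0 L)"
  by (rule pred_visits[where Y = "\<lambda>\<omega>. \<omega>"]) (auto intro: measurable_coordinate)

lemma nn_integral_P_start:
  assumes "f \<in> borel_measurable (paths {0..})" "A \<in> sets borel"
  shows "(\<integral>\<^sup>+\<omega>. indicator A (\<omega> 0) * f \<omega> \<partial>P x) = indicator A x * (\<integral>\<^sup>+\<omega>. f \<omega> \<partial>P x)"
proof -
  have "(\<integral>\<^sup>+\<omega>. indicator A (\<omega> 0) * f \<omega> \<partial>P x) = (\<integral>\<^sup>+\<omega>. indicator A x * f \<omega> \<partial>P x)"
    by (rule nn_integral_cong_AE) (use P_start[of x] in \<open>auto elim: eventually_mono\<close>)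
  also have "\<dots> = indicator A x * (\<integral>\<^sup>+\<omega>. f \<omega> \<partial>P x)"
    using assms by (intro nn_integral_cmult) (simp add: measurable_cong_sets[OF sets_P refl])
  finally show ?thesis .
qed

text \<open>On a cylinder containing the time \<open>t\<^sub>1\<close> both sides are the chain of the itinerary, cut at \<open>t\<^sub>1\<close>. Stating
  the Markov property as invariance of the path measure under replacing the future by an independent
  path makes it available for functionals of whole path segments, such as the action.\<close>

theorem P_markov:
  assumes t1: "0 < t\<^sub>1"
  shows "P x = P x \<bind> markov_kernel t\<^sub>1"
proof (rule paths_measure_eqI[where I = "{0..}" and J\<^sub>0 = "{0, t\<^sub>1}"])
  interpret prob_space "P x" by (rule prob_space_P)
  have mk: "markov_kernel t\<^sub>1 \<in> measurable (P x) (subprob_algebra (paths {0..}))"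
    using markov_kernel_measurable[of t\<^sub>1] t1 by (simp add: measurable_cong_sets[OF sets_P refl])
  show "sets (P x) = sets (paths {0..})" by (rule sets_P)
  show "sets (P x \<bind> markov_kernel t\<^sub>1) = sets (paths {0..})"
    by (rule sets_bind[OF sets_kernel[OF mk]]) (auto simp: not_empty)
  show "finite {0, t\<^sub>1}" "{0, t\<^sub>1} \<subseteq> {0..}" using t1 by auto
  show "emeasure (P x) (space (paths {0..})) \<noteq> \<infinity>" by (simp add: emeasure_eq_measure)
  fix J and A :: "real \<Rightarrow> 'a set"
  assume J: "finite J" "{0, t\<^sub>1} \<subseteq> J" "J \<subseteq> {0..}" and A [measurable]: "\<And>j. A j \<in> sets borel"
  obtain L1 L2 where L: "itinerary L1" "itinerary L2" "visit_times 0 L1 \<subseteq> {0..<t\<^sub>1}"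
    and eq: "\<And>\<omega>. (\<forall>j\<in>J. \<omega> j \<in> A j) \<longleftrightarrow> \<omega> 0 \<in> A 0 \<and> visits 0 L1 \<omega> \<and> \<omega> t\<^sub>1 \<in> A t\<^sub>1 \<and> visits t\<^sub>1 L2 \<omega>"
    by (rule cylinder_nonneg_times[OF J t1, of A, OF A]) blast
  have dur: "duration L1 < t\<^sub>1" using times_ends(2)[of 0 L1] L(3) by auto
  let ?L1 = "L1 @ [(t\<^sub>1 - duration L1, A t\<^sub>1)]"
  have it: "itinerary ?L1" "itinerary (?L1 @ L2)" using L dur by auto
  have v: "visits 0 ?L1 \<omega> \<longleftrightarrow> visits 0 L1 \<omega> \<and> \<omega> t\<^sub>1 \<in> A t\<^sub>1"
    "visits 0 (?L1 @ L2) \<omega> \<longleftrightarrow> visits 0 L1 \<omega> \<and> \<omega> t\<^sub>1 \<in> A t\<^sub>1 \<and> visits t\<^sub>1 L2 \<omega>" for \<omega>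
    by (auto simp: visits_append)
  note [measurable] = pred_visits_paths[OF it(1)] pred_visits_paths[OF it(2)] pred_visits_paths[OF L(2)]
  have cyl: "cylinder {0..} J A \<in> sets (paths {0..})" by (rule sets_cylinder[OF J(1,3) A])
  have "emeasure (P x) (cylinder {0..} J A) = (\<integral>\<^sup>+\<omega>. indicator (A 0) (\<omega> 0) * indicator {\<omega>. visits 0 (?L1 @ L2) \<omega>} \<omega> \<partial>P x)"
  proof -
    have "emeasure (P x) (cylinder {0..} J A) = (\<integral>\<^sup>+\<omega>. indicator (cylinder {0..} J A) \<omega> \<partial>P x)"
      using cyl by (simp add: sets_P)
    also have "\<dots> = (\<integral>\<^sup>+\<omega>. indicator (A 0) (\<omega> 0) * indicator {\<omega>. visits 0 (?L1 @ L2) \<omega>} \<omega> \<partial>P x)"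
      unfolding v by (intro nn_integral_cong) (auto simp: space_P cylinder_def eq indicator_def)
    finally show ?thesis .
  qed
  also have "\<dots> = indicator (A 0) x * (\<integral>\<^sup>+\<omega>. indicator {\<omega>. visits 0 (?L1 @ L2) \<omega>} \<omega> \<partial>P x)"
    by (rule nn_integral_P_start) measurable
  also have "(\<integral>\<^sup>+\<omega>. indicator {\<omega>. visits 0 (?L1 @ L2) \<omega>} \<omega> \<partial>P x) = chain pk (?L1 @ L2) (\<lambda>_. 1) x"
    using P_visits[OF it(2), of "\<lambda>_. 1" x] by simp
  also have "\<dots> = chain pk ?L1 (chain pk L2 (\<lambda>_. 1)) x" by (rule chain_append)
  finally have 1: "emeasure (P x) (cylinder {0..} J A)
      = indicator (A 0) x * chain pk ?L1 (chain pk L2 (\<lambda>_. 1)) x" .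
  have c2 [measurable]: "chain pk L2 (\<lambda>_. 1) \<in> borel_measurable borel"
    by (rule measurable_chain[OF pk_measurable L(2)]) auto
  have t1m [measurable]: "(\<lambda>\<omega>. \<omega> t\<^sub>1) \<in> borel_measurable (paths {0..} :: (real \<Rightarrow> 'a) measure)"
    using t1 by (intro measurable_coordinate) auto
  have "emeasure (markov_kernel t\<^sub>1 \<omega>) (cylinder {0..} J A)
      = indicator (A 0) (\<omega> 0) * (indicator {\<omega>. visits 0 ?L1 \<omega>} \<omega> * chain pk L2 (\<lambda>_. 1) (\<omega> t\<^sub>1))"
    if w: "\<omega> \<in> space (P x)" for \<omega>
  proof -
    have w': "\<omega> \<in> space (paths {0..})" using w space_P by auto
    have g: "\<omega>' 0 = \<omega> t\<^sub>1 \<Longrightarrow> (\<forall>j\<in>J. markov_glue t\<^sub>1 \<omega> \<omega>' j \<in> A j)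
        \<longleftrightarrow> \<omega> 0 \<in> A 0 \<and> visits 0 ?L1 \<omega> \<and> visits 0 L2 \<omega>'" for \<omega>'
      unfolding eq visits_markov_glue[OF t1 L(1,3,2)] v using t1 by (auto simp: markov_glue_def)
    have "emeasure (markov_kernel t\<^sub>1 \<omega>) (cylinder {0..} J A)
        = (\<integral>\<^sup>+\<omega>'. indicator (cylinder {0..} J A) (markov_glue t\<^sub>1 \<omega> \<omega>') \<partial>P (\<omega> t\<^sub>1))"
      unfolding markov_kernel_def using cyl t1 w'
      by (subst nn_integral_distr[symmetric, OF markov_glue_measurable1]) auto
    also have "\<dots> = (\<integral>\<^sup>+\<omega>'. (indicator (A 0) (\<omega> 0) * indicator {\<omega>. visits 0 ?L1 \<omega>} \<omega>) * indicator {\<omega>'. visits 0 L2 \<omega>'} \<omega>' \<partial>P (\<omega> t\<^sub>1))"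
    proof (rule nn_integral_cong_AE)
      have gs: "markov_glue t\<^sub>1 \<omega> \<omega>' \<in> space (paths {0..})" if "\<omega>' \<in> space (P (\<omega> t\<^sub>1))" for \<omega>'
        using that t1 w' by (intro markov_glue_space) (auto simp: space_P)
      show "AE \<omega>' in P (\<omega> t\<^sub>1). indicator (cylinder {0..} J A) (markov_glue t\<^sub>1 \<omega> \<omega>')
          = indicator (A 0) (\<omega> 0) * indicator {\<omega>. visits 0 ?L1 \<omega>} \<omega> * (indicator {\<omega>'. visits 0 L2 \<omega>'} \<omega>' :: ennreal)"
        using P_start[of "\<omega> t\<^sub>1"] AE_space
        by eventually_elim (auto simp: cylinder_def g gs indicator_def)
    qed
    also have "\<dots> = (indicator (A 0) (\<omega> 0) * indicator {\<omega>. visits 0 ?L1 \<omega>} \<omega>) * chain pk L2 (\<lambda>_. 1) (\<omega> t\<^sub>1)"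
      using P_visits[OF L(2), of "\<lambda>_. 1" "\<omega> t\<^sub>1"]
      by (subst nn_integral_cmult) (auto simp: measurable_cong_sets[OF sets_P refl])
    finally show ?thesis by (simp add: mult.assoc)
  qed
  then have "emeasure (P x \<bind> markov_kernel t\<^sub>1) (cylinder {0..} J A)
      = (\<integral>\<^sup>+\<omega>. indicator (A 0) (\<omega> 0) * (indicator {\<omega>. visits 0 ?L1 \<omega>} \<omega> * chain pk L2 (\<lambda>_. 1) (\<omega> t\<^sub>1)) \<partial>P x)"
    by (subst emeasure_bind[OF not_empty mk cyl]) (rule nn_integral_cong)
  also have "\<dots> = indicator (A 0) x * (\<integral>\<^sup>+\<omega>. indicator {\<omega>. visits 0 ?L1 \<omega>} \<omega> * chain pk L2 (\<lambda>_. 1) (\<omega> t\<^sub>1) \<partial>P x)"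
    by (rule nn_integral_P_start) measurable
  also have "(\<integral>\<^sup>+\<omega>. indicator {\<omega>. visits 0 ?L1 \<omega>} \<omega> * chain pk L2 (\<lambda>_. 1) (\<omega> t\<^sub>1) \<partial>P x)
      = chain pk ?L1 (chain pk L2 (\<lambda>_. 1)) x"
    using P_visits[OF it(1) c2, of x] by simp
  finally show "emeasure (P x) (cylinder {0..} J A) = emeasure (P x \<bind> markov_kernel t\<^sub>1) (cylinder {0..} J A)"
    using 1 by simp
qed

corollary nn_integral_markov:
  assumes t1: "0 < t\<^sub>1" and f: "f \<in> borel_measurable (paths {0..})"
  shows "(\<integral>\<^sup>+\<omega>. f \<omega> \<partial>P x) = (\<integral>\<^sup>+\<omega>. \<integral>\<^sup>+\<omega>'. f (markov_glue t\<^sub>1 \<omega> \<omega>') \<partial>P (\<omega> t\<^sub>1) \<partial>P x)"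
proof -
  have mk: "markov_kernel t\<^sub>1 \<in> measurable (P x) (subprob_algebra (paths {0..}))"
    using markov_kernel_measurable[of t\<^sub>1] t1 by (simp add: measurable_cong_sets[OF sets_P refl])
  have "(\<integral>\<^sup>+\<omega>. f \<omega> \<partial>P x) = (\<integral>\<^sup>+\<omega>. f \<omega> \<partial>(P x \<bind> markov_kernel t\<^sub>1))"
    using P_markov[OF t1] by metis
  also have "\<dots> = (\<integral>\<^sup>+\<omega>. \<integral>\<^sup>+\<omega>'. f \<omega>' \<partial>markov_kernel t\<^sub>1 \<omega> \<partial>P x)"
    by (rule nn_integral_bind[OF f mk])
  also have "\<dots> = (\<integral>\<^sup>+\<omega>. \<integral>\<^sup>+\<omega>'. f (markov_glue t\<^sub>1 \<omega> \<omega>') \<partial>P (\<omega> t\<^sub>1) \<partial>P x)"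
    unfolding markov_kernel_def
    by (intro nn_integral_cong, subst nn_integral_distr[OF markov_glue_measurable1]) (use f t1 space_P in auto)
  finally show ?thesis .
qed

lemma AE_markov:
  assumes t1: "0 < t\<^sub>1" and Q: "Measurable.pred (paths {0..}) Q"
    and ae: "AE \<omega> in P x. AE \<omega>' in P (\<omega> t\<^sub>1). Q (markov_glue t\<^sub>1 \<omega> \<omega>')"
  shows "AE \<omega> in P x. Q \<omega>"
proof -
  have mk: "markov_kernel t\<^sub>1 \<in> measurable (P x) (subprob_algebra (paths {0..}))"
    using markov_kernel_measurable[of t\<^sub>1] t1 by (simp add: measurable_cong_sets[OF sets_P refl])
  have "AE \<omega> in P x. AE \<omega>' in markov_kernel t\<^sub>1 \<omega>. Q \<omega>'"
    using ae AE_space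
  proof eventually_elim
    case (elim \<omega>)
    then show ?case unfolding markov_kernel_def using Q t1
      by (subst AE_distr_iff[OF markov_glue_measurable1]) (auto simp: space_P pred_def)
  qed
  then have "AE \<omega> in P x \<bind> markov_kernel t\<^sub>1. Q \<omega>"
    by (subst AE_bind[OF mk Q])
  then show ?thesis using P_markov[OF t1] by metis
qed

end

section \<open>Absolute convergence of the action\<close>

text \<open>Each point has a neighbourhood in which the path is within distance one of its value or of its left limit; the
  Bolzano principle passes to the whole interval.\<close>

lemma cadlag_bounded:
  fixes \<omega> :: "real \<Rightarrow> 'a::euclidean_space"
  assumes w: "\<omega> \<in> cadlag_on I" and ab: "{a..b} \<subseteq> I" "a \<le> b"
  shows "bounded (\<omega> ` {a..b})"
proof -
  have "bounded (\<omega> ` ({a..b} \<inter> {a..b}))"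
  proof (rule Bolzano[of a b "\<lambda>c d. bounded (\<omega> ` ({c..d} \<inter> {a..b}))"])
    show "a \<le> b" by fact
    fix c d e assume "bounded (\<omega> ` ({c..d} \<inter> {a..b}))" "bounded (\<omega> ` ({d..e} \<inter> {a..b}))" "c \<le> d" "d \<le> e"
    moreover have "{c..e} \<inter> {a..b} = ({c..d} \<inter> {a..b}) \<union> ({d..e} \<inter> {a..b})"
      using \<open>c \<le> d\<close> \<open>d \<le> e\<close> by auto
    ultimately show "bounded (\<omega> ` ({c..e} \<inter> {a..b}))" by (simp add: image_Un)
  next
    fix x assume x: "a \<le> x" "x \<le> b"
    then have xI: "x \<in> I" using ab by auto
    obtain l where l: "(\<omega> \<longlongrightarrow> l) (at x within I \<inter> {..<x})" using cadlag_onD(2)[OF w xI] by blast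
    obtain d1 where d1: "0 < d1" "\<And>s. s \<in> I \<Longrightarrow> x < s \<Longrightarrow> dist s x < d1 \<Longrightarrow> dist (\<omega> s) (\<omega> x) < 1"
      using tendstoD[OF cadlag_onD(1)[OF w xI], of 1] unfolding eventually_at by auto
    obtain d2 where d2: "0 < d2" "\<And>s. s \<in> I \<Longrightarrow> s < x \<Longrightarrow> dist s x < d2 \<Longrightarrow> dist (\<omega> s) l < 1"
      using tendstoD[OF l, of 1] unfolding eventually_at by auto
    show "\<exists>d>0. \<forall>c e. c \<le> x \<and> x \<le> e \<and> e - c < d \<longrightarrow> bounded (\<omega> ` ({c..e} \<inter> {a..b}))"
    proof (intro exI[of _ "min d1 d2"] conjI allI impI)
      show "0 < min d1 d2" using d1 d2 by simp
      fix c e assume ce: "c \<le> x \<and> x \<le> e \<and> e - c < min d1 d2"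
      have "\<omega> ` ({c..e} \<inter> {a..b}) \<subseteq> ball (\<omega> x) 1 \<union> ball l 1"
      proof
        fix y assume "y \<in> \<omega> ` ({c..e} \<inter> {a..b})"
        then obtain s where s: "y = \<omega> s" "c \<le> s" "s \<le> e" "s \<in> I" using ab by auto
        have "dist s x < d1" "dist s x < d2" using s ce by (auto simp: dist_real_def)
        then show "y \<in> ball (\<omega> x) 1 \<union> ball l 1"
          using d1(2)[of s] d2(2)[of s] s by (cases s x rule: linorder_cases) (auto simp: dist_commute)
      qed
      then show "bounded (\<omega> ` ({c..e} \<inter> {a..b}))"
        by (rule bounded_subset[rotated]) (intro bounded_Un[THEN iffD2] conjI bounded_ball)
    qed
  qed
  then show ?thesis by simp
qed

definition abs_action :: "('a::euclidean_space \<Rightarrow> real) \<Rightarrow> real \<Rightarrow> real \<Rightarrow> (real \<Rightarrow> 'a) \<Rightarrow> ennreal" where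
  "abs_action W a b \<omega> = (\<integral>\<^sup>+s. indicator {a..<b} s * ennreal \<bar>W (\<omega> s)\<bar> \<partial>lborel)"

lemma abs_action_segment:
  "abs_action W a b \<omega>
     = (\<integral>\<^sup>+s. indicator {a..<b} s * ennreal \<bar>W (if a \<le> s \<and> s < b then \<omega> s else 0)\<bar> \<partial>lborel)"
  unfolding abs_action_def by (intro nn_integral_cong) (auto simp: indicator_def)

lemma measurable_abs_action:
  assumes [measurable]: "W \<in> borel_measurable borel" and ab: "{a..b} \<subseteq> I"
  shows "abs_action W a b \<in> borel_measurable (paths I :: (real \<Rightarrow> 'a::euclidean_space) measure)"
proof -
  note [measurable] = measurable_evaluation'[OF ab]
  have "(\<lambda>\<omega>. \<integral>\<^sup>+s. indicator {a..<b} s * ennreal \<bar>W (if a \<le> s \<and> s < b then \<omega> s else (0::'a))\<bar> \<partial>lborel)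
      \<in> borel_measurable (paths I)"
    by (rule lborel.borel_measurable_nn_integral) (simp add: case_prod_beta')
  then show ?thesis unfolding abs_action_segment[abs_def] by simp
qed

lemma measurable_segment:
  assumes [measurable]: "W \<in> borel_measurable borel" and ab: "{a..b} \<subseteq> I" and w: "\<omega> \<in> space (paths I)"
  shows "(\<lambda>s. indicator {a..<b} s *\<^sub>R (W (\<omega> s) :: real)) \<in> borel_measurable borel"
proof -
  note [measurable] = measurable_path_segment[OF ab w]
  have "(\<lambda>s. indicator {a..<b} s *\<^sub>R W (if a \<le> s \<and> s < b then \<omega> s else 0)) \<in> borel_measurable borel"
    by measurable
  also have "(\<lambda>s. indicator {a..<b} s *\<^sub>R W (if a \<le> s \<and> s < b then \<omega> s else 0)) = (\<lambda>s. indicator {a..<b} s *\<^sub>R W (\<omega> s))"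
    by (auto simp: indicator_def fun_eq_iff)
  finally show ?thesis .
qed

lemma action_lborel:
  assumes "V \<in> borel_measurable borel"
  shows "action V a b \<omega> = (\<integral>s. indicator {a..<b} s *\<^sub>R V (\<omega> s) \<partial>lborel)"
  unfolding action_half_open[OF assms]
  by (intro Bochner_Integration.integral_cong) (auto simp: indicator_def)

lemma integrable_iff_abs_action:
  assumes "W \<in> borel_measurable borel" "{a..b} \<subseteq> I" "\<omega> \<in> space (paths I)"
  shows "integrable lborel (\<lambda>s. indicator {a..<b} s *\<^sub>R W (\<omega> s)) \<longleftrightarrow> abs_action W a b \<omega> < \<infinity>"
proof -
  have "(\<integral>\<^sup>+s. ennreal (norm (indicator {a..<b} s *\<^sub>R W (\<omega> s))) \<partial>lborel) = abs_action W a b \<omega>"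
    unfolding abs_action_def by (intro nn_integral_cong) (auto simp: indicator_def)
  then show ?thesis unfolding integrable_iff_bounded using measurable_segment[OF assms] by simp
qed

lemma indicator_markov_glue:
  assumes "0 \<le> t\<^sub>1" "0 \<le> r"
  shows "indicator {0..<t\<^sub>1 + r} s *\<^sub>R f (markov_glue t\<^sub>1 \<omega> \<omega>' s)
       = indicator {0..<t\<^sub>1} s *\<^sub>R f (\<omega> s) + (indicator {0..<r} (- t\<^sub>1 + s) *\<^sub>R f (\<omega>' (- t\<^sub>1 + s)) :: real)"
  using assms by (auto simp: indicator_def markov_glue_def)

lemma abs_action_glue:
  assumes W [measurable]: "W \<in> borel_measurable borel" and t: "0 \<le> t\<^sub>1" "0 \<le> r"
    and w: "\<omega> \<in> space (paths {0..})" "\<omega>' \<in> space (paths {0..})"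
  shows "abs_action W 0 (t\<^sub>1 + r) (markov_glue t\<^sub>1 \<omega> \<omega>') = abs_action W 0 t\<^sub>1 \<omega> + abs_action W 0 r \<omega>'"
proof -
  have m: "(\<lambda>s. indicator {0..<b} s *\<^sub>R \<bar>W (\<omega> s)\<bar>) \<in> borel_measurable borel" if "\<omega> \<in> space (paths {0..})" for b \<omega>
    by (rule measurable_segment[where W = "\<lambda>y. \<bar>W y\<bar>" and I = "{0..}"]) (use that in auto)
  note [measurable] = m[OF w(1)] m[OF w(2)] m[OF w(1), unfolded real_scaleR_def] m[OF w(2), unfolded real_scaleR_def]
  have eq: "abs_action W a b \<omega> = (\<integral>\<^sup>+s. ennreal (indicator {a..<b} s *\<^sub>R \<bar>W (\<omega> s)\<bar>) \<partial>lborel)" for a b \<omega>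
    unfolding abs_action_def by (intro nn_integral_cong) (auto simp: indicator_def)
  have "abs_action W 0 (t\<^sub>1 + r) (markov_glue t\<^sub>1 \<omega> \<omega>')
      = (\<integral>\<^sup>+s. ennreal (indicator {0..<t\<^sub>1} s *\<^sub>R \<bar>W (\<omega> s)\<bar>)
              + ennreal (indicator {0..<r} (- t\<^sub>1 + s) *\<^sub>R \<bar>W (\<omega>' (- t\<^sub>1 + s))\<bar>) \<partial>lborel)"
    unfolding eq by (intro nn_integral_cong)
      (subst indicator_markov_glue[OF t, of _ "\<lambda>y. \<bar>W y\<bar>"], subst ennreal_plus, auto)
  also have "\<dots> = abs_action W 0 t\<^sub>1 \<omega> + (\<integral>\<^sup>+s. ennreal (indicator {0..<r} (- t\<^sub>1 + s) *\<^sub>R \<bar>W (\<omega>' (- t\<^sub>1 + s))\<bar>) \<partial>lborel)"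
    unfolding eq by (rule nn_integral_add) measurable
  also have "(\<integral>\<^sup>+s. ennreal (indicator {0..<r} (- t\<^sub>1 + s) *\<^sub>R \<bar>W (\<omega>' (- t\<^sub>1 + s))\<bar>) \<partial>lborel)
      = (\<integral>\<^sup>+s. ennreal (indicator {0..<r} s *\<^sub>R \<bar>W (\<omega>' s)\<bar>) \<partial>distr lborel borel ((+) (- t\<^sub>1)))"
    by (subst nn_integral_distr) auto
  also have "\<dots> = abs_action W 0 r \<omega>'" unfolding eq by (simp only: lborel_distr_plus)
  finally show ?thesis .
qed

lemma action_glue:
  assumes V [measurable]: "V \<in> borel_measurable borel" and t: "0 \<le> t\<^sub>1" "0 \<le> r"
    and w: "\<omega> \<in> space (paths {0..})" "\<omega>' \<in> space (paths {0..})"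
    and fin: "abs_action V 0 t\<^sub>1 \<omega> < \<infinity>" "abs_action V 0 r \<omega>' < \<infinity>"
  shows "action V 0 (t\<^sub>1 + r) (markov_glue t\<^sub>1 \<omega> \<omega>') = action V 0 t\<^sub>1 \<omega> + action V 0 r \<omega>'"
proof -
  have I: "{0..b} \<subseteq> {0::real..}" for b by auto
  let ?f = "\<lambda>s. indicator {0..<r} s *\<^sub>R V (\<omega>' s)"
  have i1: "integrable lborel (\<lambda>s. indicator {0..<t\<^sub>1} s *\<^sub>R V (\<omega> s))"
    using integrable_iff_abs_action[OF V I w(1)] fin by simp
  have i2: "integrable lborel ?f"
    using integrable_iff_abs_action[OF V I w(2)] fin by simp
  have i2': "integrable lborel (\<lambda>s. ?f (- t\<^sub>1 + s))"
    using lborel_integrable_real_affine[OF i2, of 1 "- t\<^sub>1"] by simp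
  have "action V 0 (t\<^sub>1 + r) (markov_glue t\<^sub>1 \<omega> \<omega>')
      = (\<integral>s. indicator {0..<t\<^sub>1} s *\<^sub>R V (\<omega> s) + ?f (- t\<^sub>1 + s) \<partial>lborel)"
    unfolding action_lborel[OF V] by (intro Bochner_Integration.integral_cong refl indicator_markov_glue t)
  also have "\<dots> = action V 0 t\<^sub>1 \<omega> + (\<integral>s. ?f (- t\<^sub>1 + s) \<partial>lborel)"
    unfolding action_lborel[OF V] by (rule Bochner_Integration.integral_add[OF i1 i2'])
  also have "(\<integral>s. ?f (- t\<^sub>1 + s) \<partial>lborel) = action V 0 r \<omega>'"
    unfolding action_lborel[OF V] using lborel_integral_real_affine[of 1 ?f "- t\<^sub>1"] by simp
  finally show ?thesis .
qed

context stable
begin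

text \<open>The Kato condition bounds the expectation of the absolute action on a short interval, uniformly in the
  starting point; a finite expectation forces almost sure finiteness.\<close>

lemma kato_AE_small:
  assumes "kato_class P W"
  obtains \<delta> where "0 < \<delta>" "\<And>x. AE \<omega> in P x. abs_action W 0 \<delta> \<omega> < \<infinity>"
proof -
  have W [measurable]: "W \<in> borel_measurable borel" using assms by (simp add: kato_class_def)
  have lim: "((\<lambda>t. SUP x. \<integral>\<^sup>+s\<in>{0..t}. (\<integral>\<^sup>+\<omega>. ennreal \<bar>W (\<omega> s)\<bar> \<partial>P x) \<partial>lborel) \<longlongrightarrow> 0) (at_right 0)"
    using assms by (simp add: kato_class_def)
  have "\<forall>\<^sub>F t in at_right 0. (SUP x. \<integral>\<^sup>+s\<in>{0..t}. (\<integral>\<^sup>+\<omega>. ennreal \<bar>W (\<omega> s)\<bar> \<partial>P x) \<partial>lborel) < 1"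
    using order_tendstoD(2)[OF lim, of 1] by simp
  then obtain b where b: "0 < b" "\<And>t. 0 < t \<Longrightarrow> t < b \<Longrightarrow>
      (SUP x. \<integral>\<^sup>+s\<in>{0..t}. (\<integral>\<^sup>+\<omega>. ennreal \<bar>W (\<omega> s)\<bar> \<partial>P x) \<partial>lborel) < 1"
    unfolding eventually_at_right_field by auto
  let ?d = "b / 2"
  have "AE \<omega> in P x. abs_action W 0 ?d \<omega> < \<infinity>" for x
  proof -
    interpret prob_space "P x" by (rule prob_space_P)
    have I: "{0..?d} \<subseteq> {0::real..}" by auto
    have [measurable]: "(\<lambda>z. if 0 \<le> snd z \<and> snd z < ?d then fst z (snd z) else (0::'a)) \<in> borel_measurable (P x \<Otimes>\<^sub>M lborel)"
      using measurable_evaluation'[OF I]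
      by (simp only: measurable_cong_sets[OF sets_pair_measure_cong[OF sets_P refl] refl])
    let ?f = "\<lambda>\<omega> s. indicator {0..<?d} s * ennreal \<bar>W (if 0 \<le> s \<and> s < ?d then \<omega> s else 0)\<bar>"
    have m: "case_prod ?f \<in> borel_measurable (P x \<Otimes>\<^sub>M lborel)"
      unfolding case_prod_beta' by measurable
    interpret pair_sigma_finite "P x" lborel
      by (intro pair_sigma_finite.intro sigma_finite_measure_axioms lborel.sigma_finite_measure_axioms)
    have "(\<integral>\<^sup>+\<omega>. abs_action W 0 ?d \<omega> \<partial>P x) = (\<integral>\<^sup>+s. \<integral>\<^sup>+\<omega>. ?f \<omega> s \<partial>P x \<partial>lborel)"
      unfolding abs_action_segment using Fubini'[OF m] by simp
    also have "\<dots> \<le> (\<integral>\<^sup>+s\<in>{0..?d}. (\<integral>\<^sup>+\<omega>. ennreal \<bar>W (\<omega> s)\<bar> \<partial>P x) \<partial>lborel)"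
      by (intro nn_integral_mono) (auto simp: indicator_def)
    also have "\<dots> \<le> (SUP x. \<integral>\<^sup>+s\<in>{0..?d}. (\<integral>\<^sup>+\<omega>. ennreal \<bar>W (\<omega> s)\<bar> \<partial>P x) \<partial>lborel)"
      by (rule SUP_upper) simp
    also have "\<dots> < 1" using b by simp
    finally have "(\<integral>\<^sup>+\<omega>. abs_action W 0 ?d \<omega> \<partial>P x) \<noteq> \<infinity>" by auto
    moreover have "abs_action W 0 ?d \<in> borel_measurable (P x)"
      using measurable_abs_action[OF W I] by (simp add: measurable_cong_sets[OF sets_P refl])
    ultimately have "AE \<omega> in P x. abs_action W 0 ?d \<omega> \<noteq> \<infinity>" by (intro nn_integral_PInf_AE)
    then show ?thesis by eventually_elim (simp add: less_top)
  qed
  then show ?thesis using that[of ?d] b by auto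
qed

lemma abs_action_mono: "b \<le> c \<Longrightarrow> abs_action W a b \<omega> \<le> abs_action W a c \<omega>"
  unfolding abs_action_def by (intro nn_integral_mono) (auto simp: indicator_def)

text \<open>Finiteness on a short interval, uniformly in the starting point, propagates to all times by the
  Markov property.\<close>

lemma kato_AE:
  assumes "kato_class P W"
  shows "AE \<omega> in P x. abs_action W 0 t \<omega> < \<infinity>"
proof -
  have W: "W \<in> borel_measurable borel" using assms by (simp add: kato_class_def)
  obtain \<delta> where \<delta>: "0 < \<delta>" "\<And>x. AE \<omega> in P x. abs_action W 0 \<delta> \<omega> < \<infinity>"
    using kato_AE_small[OF assms] by blast
  have n: "AE \<omega> in P x. abs_action W 0 (real n * \<delta>) \<omega> < \<infinity>" for n x
  proof (induction n arbitrary: x)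
    case 0
    have "abs_action W 0 0 \<omega> = 0" for \<omega> by (simp add: abs_action_def)
    then show ?case by simp
  next
    case (Suc n)
    have eq: "real (Suc n) * \<delta> = \<delta> + real n * \<delta>" by (simp add: algebra_simps)
    show ?case unfolding eq
    proof (rule AE_markov[OF \<delta>(1)])
      have [measurable]: "abs_action W 0 (\<delta> + real n * \<delta>) \<in> borel_measurable (paths {0..})"
        by (rule measurable_abs_action[OF W]) auto
      show "Measurable.pred (paths {0..}) (\<lambda>\<omega>. abs_action W 0 (\<delta> + real n * \<delta>) \<omega> < \<infinity>)" by measurable
      show "AE \<omega> in P x. AE \<omega>' in P (\<omega> \<delta>). abs_action W 0 (\<delta> + real n * \<delta>) (markov_glue \<delta> \<omega> \<omega>') < \<infinity>"
        using \<delta>(2) AE_space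
      proof eventually_elim
        case (elim \<omega>)
        show ?case using Suc.IH[of "\<omega> \<delta>"] AE_space
        proof eventually_elim
          case (elim \<omega>')
          then show ?case
            using \<open>\<omega> \<in> space (P x)\<close> \<open>abs_action W 0 \<delta> \<omega> < \<infinity>\<close> \<delta>(1)
            by (subst abs_action_glue[OF W]) (auto simp: space_P)
        qed
      qed
    qed
  qed
  obtain n where "t / \<delta> < real n" using reals_Archimedean2 by blast
  then have "t \<le> real n * \<delta>" using \<delta>(1) by (simp add: field_simps)
  from n[of n x] show ?thesis
    by eventually_elim (use abs_action_mono[OF \<open>t \<le> _\<close>, of W 0] in \<open>auto intro: le_less_trans\<close>)
qed

text \<open>On a compact time interval a path stays in some ball, where the positive part of \<open>V\<close> coincides with one of
  countably many truncations in the Kato class.\<close>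

lemma kato_decomposable_AE:
  assumes "kato_decomposable P V"
  shows "AE \<omega> in P x. abs_action V 0 t \<omega> < \<infinity>"
proof -
  let ?p = "\<lambda>n y. max (V y) 0 * indicator (ball 0 (real n)) y"
  have V [measurable]: "V \<in> borel_measurable borel"
    and plus: "\<And>n. kato_class P (?p n)"
    and minus: "kato_class P (\<lambda>y. max (- V y) 0)"
    using assms by (auto simp: kato_decomposable_def kato_class_loc_def)
  have ae: "AE \<omega> in P x. \<forall>n. abs_action (?p n) 0 t \<omega> < \<infinity>"
    unfolding AE_all_countable using kato_AE[OF plus] by blast
  show ?thesis using ae kato_AE[OF minus, where x = x and t = t] AE_space
  proof eventually_elim
    case (elim \<omega>)
    then have w: "\<omega> \<in> space (paths {0..})" by (simp add: space_P)
    show ?case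
    proof (cases "0 \<le> t")
      case False
      then show ?thesis by (simp add: abs_action_def)
    next
      case True
      have I: "{0..t} \<subseteq> {0::real..}" by auto
      have "bounded (\<omega> ` {0..t})"
        using w True by (intro cadlag_bounded[of _ "{0..}"]) (auto simp: space_paths)
      then obtain B where "\<forall>y\<in>\<omega> ` {0..t}. norm y \<le> B" unfolding bounded_iff by blast
      then have "\<And>s. s \<in> {0..t} \<Longrightarrow> norm (\<omega> s) \<le> B" by blast
      moreover obtain n where "B < real n" using reals_Archimedean2 by blast
      ultimately have n: "\<And>s. s \<in> {0..t} \<Longrightarrow> \<omega> s \<in> ball 0 (real n)" by (force simp: dist_norm)
      note m = measurable_segment[OF _ I w]
      have "?p n \<in> borel_measurable borel" using plus[of n] by (simp add: kato_class_def)
      from m[OF this] have [measurable]: "(\<lambda>s. indicator {0..<t} s *\<^sub>R ?p n (\<omega> s)) \<in> borel_measurable borel" .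
      have "(\<lambda>y. max (- V y) 0) \<in> borel_measurable borel" by measurable
      from m[OF this] have [measurable]: "(\<lambda>s. indicator {0..<t} s *\<^sub>R max (- V (\<omega> s)) 0) \<in> borel_measurable borel" .
      have "abs_action V 0 t \<omega> \<le> (\<integral>\<^sup>+s. ennreal (indicator {0..<t} s *\<^sub>R ?p n (\<omega> s))
                + ennreal (indicator {0..<t} s *\<^sub>R max (- V (\<omega> s)) 0) \<partial>lborel)"
        unfolding abs_action_def
        by (intro nn_integral_mono) (use n in \<open>auto simp: indicator_def ennreal_plus[symmetric] max_def simp del: ennreal_plus\<close>)
      also have "\<dots> = (\<integral>\<^sup>+s. ennreal (indicator {0..<t} s *\<^sub>R ?p n (\<omega> s)) \<partial>lborel)
              + (\<integral>\<^sup>+s. ennreal (indicator {0..<t} s *\<^sub>R max (- V (\<omega> s)) 0) \<partial>lborel)"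
        by (rule nn_integral_add) measurable
      also have "\<dots> = abs_action (?p n) 0 t \<omega> + abs_action (\<lambda>y. max (- V y) 0) 0 t \<omega>"
        unfolding abs_action_def by (intro arg_cong2[where f = "(+)"] nn_integral_cong) (auto simp: indicator_def)
      also have "\<dots> < \<infinity>" using elim by simp
      finally show ?thesis .
    qed
  qed
qed

end

section \<open>Finite-dimensional distributions of Markov processes\<close>

text \<open>The Markov property speaks of indicators of the terminal position. Read as an identity of measures in the
  terminal set, it extends to arbitrary terminal functions.\<close>

lemma markov_process_step:
  fixes k :: "real \<Rightarrow> 'a::euclidean_space \<Rightarrow> 'a \<Rightarrow> real" and Y :: "real \<Rightarrow> 'w \<Rightarrow> 'a"
  assumes M: "prob_space M" and Y: "\<And>t. 0 \<le> t \<Longrightarrow> Y t \<in> borel_measurable M"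
    and markov: "markov_process M Y (\<lambda>t y. density lborel (\<lambda>z. ennreal (k t y z)))"
    and km: "(\<lambda>(y, z). k d y z) \<in> borel_measurable (borel \<Otimes>\<^sub>M borel)"
    and mass: "\<And>y. (\<integral>\<^sup>+z. ennreal (k d y z) \<partial>lborel) = 1"
    and sd: "0 \<le> s" "0 < d"
    and E: "E \<in> sets (gen_algebra M Y {0..s})" and h: "h \<in> borel_measurable borel"
  shows "(\<integral>\<^sup>+\<omega>. indicator E \<omega> * h (Y (s + d) \<omega>) \<partial>M)
       = (\<integral>\<^sup>+\<omega>. indicator E \<omega> * (\<integral>\<^sup>+z. ennreal (k d (Y s \<omega>) z) * h z \<partial>lborel) \<partial>M)"
proof -
  interpret M: prob_space M by fact
  let ?G = "gen_algebra M Y {0..s}"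
  have sub: "subalgebra M ?G"
    unfolding subalgebra_def by (intro conjI space_gen_algebra gen_algebra_subset Y) auto
  interpret G: finite_measure_subalgebra M ?G by standard (rule sub)
  have [measurable]: "Y s \<in> borel_measurable M" "Y (s + d) \<in> borel_measurable M"
    using Y sd by auto
  have E' [measurable]: "E \<in> sets M" using E sub by (auto simp: subalgebra_def)
  note km [measurable]
  interpret pair_sigma_finite M lborel
    by (intro pair_sigma_finite.intro M.sigma_finite_measure_axioms lborel.sigma_finite_measure_axioms)
  define g where "g z = (\<integral>\<^sup>+\<omega>. indicator E \<omega> * ennreal (k d (Y s \<omega>) z) \<partial>M)" for z
  have gm [measurable]: "g \<in> borel_measurable borel" unfolding g_def by measurable
  have eq: "(\<integral>\<^sup>+\<omega>. indicator E \<omega> * (\<integral>\<^sup>+z. ennreal (k d (Y s \<omega>) z) * f z \<partial>lborel) \<partial>M) = (\<integral>\<^sup>+z. g z * f z \<partial>lborel)"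
    if [measurable]: "f \<in> borel_measurable borel" for f
  proof -
    have "(\<integral>\<^sup>+\<omega>. indicator E \<omega> * (\<integral>\<^sup>+z. ennreal (k d (Y s \<omega>) z) * f z \<partial>lborel) \<partial>M)
        = (\<integral>\<^sup>+\<omega>. (\<integral>\<^sup>+z. indicator E \<omega> * (ennreal (k d (Y s \<omega>) z) * f z) \<partial>lborel) \<partial>M)"
      by (intro nn_integral_cong nn_integral_cmult[symmetric]) measurable
    also have "\<dots> = (\<integral>\<^sup>+z. (\<integral>\<^sup>+\<omega>. indicator E \<omega> * (ennreal (k d (Y s \<omega>) z) * f z) \<partial>M) \<partial>lborel)"
      by (rule Fubini'[symmetric]) measurable
    also have "\<dots> = (\<integral>\<^sup>+z. g z * f z \<partial>lborel)"
      unfolding g_def mult.assoc[symmetric] by (intro nn_integral_cong nn_integral_multc) measurable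
    finally show ?thesis .
  qed
  have "distr (density M (indicator E)) borel (Y (s + d)) = density lborel g"
  proof (rule measure_eqI)
    show "sets (distr (density M (indicator E)) borel (Y (s + d))) = sets (density lborel g)" by simp
    fix B assume "B \<in> sets (distr (density M (indicator E)) borel (Y (s + d)))"
    then have B [measurable]: "B \<in> sets borel" by simp
    let ?K = "\<lambda>\<omega>. measure (density lborel (\<lambda>z. ennreal (k d (Y s \<omega>) z))) B"
    have Km: "emeasure (density lborel (\<lambda>z. ennreal (k d y z))) B = ennreal (measure (density lborel (\<lambda>z. ennreal (k d y z))) B)"
      "measure (density lborel (\<lambda>z. ennreal (k d y z))) B \<le> 1" for y
    proof -
      have "emeasure (density lborel (\<lambda>z. ennreal (k d y z))) (space (density lborel (\<lambda>z. ennreal (k d y z)))) = 1"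
        using mass[of y] by (simp add: emeasure_density)
      then interpret K: prob_space "density lborel (\<lambda>z. ennreal (k d y z))" by (rule prob_spaceI)
      show "emeasure (density lborel (\<lambda>z. ennreal (k d y z))) B = ennreal (measure (density lborel (\<lambda>z. ennreal (k d y z))) B)"
        by (rule K.emeasure_eq_measure)
      show "measure (density lborel (\<lambda>z. ennreal (k d y z))) B \<le> 1" by (rule K.prob_le_1)
    qed
    have Kmeas: "?K \<in> borel_measurable M"
      unfolding measure_def by (subst emeasure_density) measurable
    have Kint: "integrable M (\<lambda>\<omega>. indicator E \<omega> * ?K \<omega>)"
      by (rule M.integrable_const_bound[where B = 1])
        (use Km(2) Kmeas in \<open>auto simp: indicator_def\<close>)
    let ?D = "{\<omega> \<in> space M. Y (s + d) \<omega> \<in> B}"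
    have D [measurable]: "?D \<in> sets M" by measurable
    have ae: "AE \<omega> in M. real_cond_exp M ?G (indicator ?D) \<omega> = ?K \<omega>"
      using markov sd B unfolding markov_process_def by blast
    have "emeasure M (E \<inter> ?D) = ennreal (\<integral>\<omega>. indicator E \<omega> * indicator ?D \<omega> \<partial>M)"
    proof -
      have "(\<integral>\<omega>. indicator E \<omega> * indicator ?D \<omega> \<partial>M) = (\<integral>\<omega>. (indicator (E \<inter> ?D) \<omega> :: real) \<partial>M)"
        by (intro Bochner_Integration.integral_cong) (auto simp: indicator_def)
      then show ?thesis by (simp add: M.emeasure_eq_measure)
    qed
    also have "(\<integral>\<omega>. indicator E \<omega> * indicator ?D \<omega> \<partial>M) = (\<integral>\<omega>. indicator E \<omega> * real_cond_exp M ?G (indicator ?D) \<omega> \<partial>M)"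
    proof -
      have "integrable M (indicator ?D :: _ \<Rightarrow> real)"
        by (rule integrable_real_indicator[OF D]) (simp add: M.emeasure_eq_measure)
      from G.real_cond_exp_intA[OF this E] show ?thesis by (simp add: set_lebesgue_integral_def)
    qed
    also have "\<dots> = (\<integral>\<omega>. indicator E \<omega> * ?K \<omega> \<partial>M)"
      by (rule integral_cong_AE) (use ae Kmeas in \<open>auto elim: eventually_mono\<close>)
    also have "ennreal \<dots> = (\<integral>\<^sup>+\<omega>. ennreal (indicator E \<omega> * ?K \<omega>) \<partial>M)"
      by (rule nn_integral_eq_integral[symmetric, OF Kint]) (auto simp: indicator_def)
    also have "\<dots> = (\<integral>\<^sup>+\<omega>. indicator E \<omega> * (\<integral>\<^sup>+z. ennreal (k d (Y s \<omega>) z) * indicator B z \<partial>lborel) \<partial>M)"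
    proof (intro nn_integral_cong)
      fix \<omega>
      have "ennreal (?K \<omega>) = (\<integral>\<^sup>+z. ennreal (k d (Y s \<omega>) z) * indicator B z \<partial>lborel)"
        unfolding Km(1)[symmetric] by (rule emeasure_density) measurable
      then show "ennreal (indicator E \<omega> * ?K \<omega>) = indicator E \<omega> * (\<integral>\<^sup>+z. ennreal (k d (Y s \<omega>) z) * indicator B z \<partial>lborel)"
        by (simp add: indicator_def)
    qed
    also have "\<dots> = (\<integral>\<^sup>+z. g z * indicator B z \<partial>lborel)" by (rule eq) measurable
    also have "\<dots> = emeasure (density lborel g) B" by (rule emeasure_density[symmetric]) measurable
    finally have 1: "emeasure M (E \<inter> ?D) = emeasure (density lborel g) B" .
    have "emeasure (distr (density M (indicator E)) borel (Y (s + d))) B = emeasure (density M (indicator E)) ?D"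
      by (subst emeasure_distr) (auto intro!: arg_cong[where f = "emeasure _"])
    also have "\<dots> = (\<integral>\<^sup>+\<omega>. indicator E \<omega> * indicator ?D \<omega> \<partial>M)"
      by (rule emeasure_density) measurable
    also have "\<dots> = (\<integral>\<^sup>+\<omega>. indicator (E \<inter> ?D) \<omega> \<partial>M)"
      by (intro nn_integral_cong) (auto simp: indicator_def)
    also have "\<dots> = emeasure M (E \<inter> ?D)" by (rule nn_integral_indicator) measurable
    finally show "emeasure (distr (density M (indicator E)) borel (Y (s + d))) B = emeasure (density lborel g) B"
      using 1 by simp
  qed
  then have "(\<integral>\<^sup>+z. h z \<partial>distr (density M (indicator E)) borel (Y (s + d))) = (\<integral>\<^sup>+z. h z \<partial>density lborel g)" by simp
  moreover have "(\<integral>\<^sup>+z. h z \<partial>density lborel g) = (\<integral>\<^sup>+z. g z * h z \<partial>lborel)"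
    using h by (intro nn_integral_density) auto
  moreover have "(\<integral>\<^sup>+z. h z \<partial>distr (density M (indicator E)) borel (Y (s + d))) = (\<integral>\<^sup>+\<omega>. indicator E \<omega> * h (Y (s + d) \<omega>) \<partial>M)"
    using h by (subst nn_integral_distr) (auto simp: nn_integral_density)
  ultimately show ?thesis using eq[OF h] by simp
qed

lemma markov_process_visits:
  fixes k :: "real \<Rightarrow> 'a::euclidean_space \<Rightarrow> 'a \<Rightarrow> real" and Y :: "real \<Rightarrow> 'w \<Rightarrow> 'a"
  assumes M: "prob_space M" and Y: "\<And>t. 0 \<le> t \<Longrightarrow> Y t \<in> borel_measurable M"
    and markov: "markov_process M Y (\<lambda>t y. density lborel (\<lambda>z. ennreal (k t y z)))"
    and km: "\<And>d. 0 < d \<Longrightarrow> (\<lambda>(y, z). k d y z) \<in> borel_measurable (borel \<Otimes>\<^sub>M borel)"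
    and mass: "\<And>d y. 0 < d \<Longrightarrow> (\<integral>\<^sup>+z. ennreal (k d y z) \<partial>lborel) = 1"
    and start: "AE \<omega> in M. Y 0 \<omega> = x"
    and L: "itinerary L" and h: "h \<in> borel_measurable borel"
  shows "(\<integral>\<^sup>+\<omega>. indicator {\<omega>. visits 0 L (\<lambda>t. Y t \<omega>)} \<omega> * h (Y (duration L) \<omega>) \<partial>M) = chain k L h x"
  using L h
proof (induction L arbitrary: h rule: rev_induct)
  case Nil
  have "(\<integral>\<^sup>+\<omega>. h (Y 0 \<omega>) \<partial>M) = (\<integral>\<^sup>+\<omega>. h x \<partial>M)"
    by (rule nn_integral_cong_AE) (use start in \<open>auto elim: eventually_mono\<close>)
  then show ?case using prob_space.emeasure_space_1[OF M] by simp
next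
  case (snoc a L)
  obtain d A where a: "a = (d, A)" by force
  have [measurable]: "A \<in> sets borel" "h \<in> borel_measurable borel" and d: "0 < d" and L: "itinerary L"
    using snoc.prems by (auto simp: a)
  let ?s = "duration L"
  have s: "0 \<le> ?s" by (rule duration_nonneg[OF L])
  have k: "chain k [a] h \<in> borel_measurable borel"
    using snoc.prems by (intro measurable_chain km) (auto simp: a)
  let ?E = "{\<omega> \<in> space M. visits 0 L (\<lambda>t. Y t \<omega>)}"
  have E: "?E \<in> sets (gen_algebra M Y {0..?s})"
  proof -
    have "Y t \<in> borel_measurable (gen_algebra M Y {0..?s})" if "t \<in> visit_times 0 L" for t
      using times_bounds[OF L that] by (intro measurable_gen_algebra) auto
    then have "{\<omega> \<in> space (gen_algebra M Y {0..?s}). visits 0 L (\<lambda>t. Y t \<omega>)} \<in> sets (gen_algebra M Y {0..?s})"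
      by (intro sets_visits[OF L]) auto
    then show ?thesis by simp
  qed
  have "(\<integral>\<^sup>+\<omega>. indicator {\<omega>. visits 0 (L @ [a]) (\<lambda>t. Y t \<omega>)} \<omega> * h (Y (duration (L @ [a])) \<omega>) \<partial>M)
      = (\<integral>\<^sup>+\<omega>. indicator ?E \<omega> * (indicator A (Y (?s + d) \<omega>) * h (Y (?s + d) \<omega>)) \<partial>M)"
    by (intro nn_integral_cong) (auto simp: a visits_append indicator_def)
  also have "\<dots> = (\<integral>\<^sup>+\<omega>. indicator ?E \<omega> * (\<integral>\<^sup>+z. ennreal (k d (Y ?s \<omega>) z) * (indicator A z * h z) \<partial>lborel) \<partial>M)"
    by (rule markov_process_step[OF M Y markov km[OF d] mass[OF d] s d E]) (auto simp: d)
  also have "\<dots> = (\<integral>\<^sup>+\<omega>. indicator {\<omega>. visits 0 L (\<lambda>t. Y t \<omega>)} \<omega> * chain k [a] h (Y ?s \<omega>) \<partial>M)"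
    by (intro nn_integral_cong) (auto simp: a indicator_def)
  also have "\<dots> = chain k L (chain k [a] h) x"
    by (rule snoc.IH[OF L k])
  also have "\<dots> = chain k (L @ [a]) h x" by (simp add: chain_append)
  finally show ?case .
qed

section \<open>The ground state process\<close>

text \<open>A two-sided itinerary with pivot at time \<open>s\<close>: \<open>L\<close> is read forwards and \<open>R\<close> backwards from there.\<close>
definition zigzag :: "real \<Rightarrow> (real \<times> 'a set) list \<Rightarrow> 'a set \<Rightarrow> (real \<times> 'a set) list \<Rightarrow> (real \<Rightarrow> 'a) \<Rightarrow> bool" where
  "zigzag s R C L \<omega> \<longleftrightarrow> \<omega> s \<in> C \<and> visits s L \<omega> \<and> visits (- s) R (\<lambda>t. \<omega> (- t))"

lemma zigzag_move: "zigzag s R C ((d, D) # L) \<omega> \<longleftrightarrow> zigzag (s + d) ((d, C) # R) D L \<omega>"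
  by (auto simp: zigzag_def)

lemma cylinder_zigzag:
  fixes A :: "real \<Rightarrow> 'a::euclidean_space set"
  assumes "finite J" "s \<in> J" "\<And>j. A j \<in> sets borel"
  obtains R L where "itinerary R" "itinerary L" "visit_times s L = J \<inter> {s..}"
    "visit_times (- s) R = uminus ` (J \<inter> {..s})"
    "\<And>\<omega>. (\<forall>j\<in>J. \<omega> j \<in> A j) \<longleftrightarrow> zigzag s R (A s) L \<omega>"
proof -
  obtain L where L: "itinerary L" "visit_times s L = insert s (J \<inter> {s<..})"
      "\<And>\<omega>. visits s L \<omega> \<longleftrightarrow> (\<forall>j\<in>J \<inter> {s<..}. \<omega> j \<in> A j)"
    by (rule finite_times_itinerary[of "J \<inter> {s<..}" s A]) (use assms in auto)
  obtain R where R: "itinerary R" "visit_times (- s) R = insert (- s) (uminus ` (J \<inter> {..<s}))"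
      "\<And>\<omega>. visits (- s) R \<omega> \<longleftrightarrow> (\<forall>j\<in>uminus ` (J \<inter> {..<s}). \<omega> j \<in> A (- j))"
    by (rule finite_times_itinerary[of "uminus ` (J \<inter> {..<s})" "- s" "\<lambda>j. A (- j)"]) (use assms in auto)
  have split: "J = {s} \<union> (J \<inter> {s<..}) \<union> (J \<inter> {..<s})" using assms(2) by auto
  have "(\<forall>j\<in>J. \<omega> j \<in> A j) \<longleftrightarrow> zigzag s R (A s) L \<omega>" for \<omega>
    unfolding zigzag_def L(3) R(3) by (subst split) auto
  moreover have "insert s (J \<inter> {s<..}) = J \<inter> {s..}" "insert (- s) (uminus ` (J \<inter> {..<s})) = uminus ` (J \<inter> {..s})"
    using assms(2) by (auto simp: less_le)
  ultimately show ?thesis using L(1,2) R(1,2) by (intro that) auto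
qed

locale ground_state_process =
  fixes l :: real and u :: "real \<Rightarrow> 'a::euclidean_space \<Rightarrow> 'a \<Rightarrow> real" and \<phi> :: "'a \<Rightarrow> real"
    and \<mu>x :: "'a \<Rightarrow> (real \<Rightarrow> 'a) measure"
  assumes u_measurable: "\<And>d. 0 < d \<Longrightarrow> (\<lambda>(x, y). u d x y) \<in> borel_measurable (borel \<Otimes>\<^sub>M borel)"
    and u_pos: "\<And>d x y. 0 < d \<Longrightarrow> 0 < u d x y"
    and u_sym: "\<And>d x y. 0 < d \<Longrightarrow> u d x y = u d y x"
    and \<phi>_measurable [measurable]: "\<phi> \<in> borel_measurable borel"
    and \<phi>_pos: "\<And>x. 0 < \<phi> x"
    and \<phi>_norm: "(\<integral>\<^sup>+x. ennreal ((\<phi> x)\<^sup>2) \<partial>lborel) = 1"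
    and \<mu>x: "\<And>x. pphi1_path_measure l u \<phi> x (\<mu>x x)"
begin

text \<open>Absorbing the exponential factor into the kernel avoids bookkeeping of time spans.\<close>
definition v :: "real \<Rightarrow> 'a \<Rightarrow> 'a \<Rightarrow> real" where "v d x y = exp (l * d) * u d x y"

text \<open>The transition density of the ground state process, which is the Doob transform of \<open>v\<close> by \<open>\<phi>\<close>; see
  \<open>k_eq\<close>.\<close>
definition k :: "real \<Rightarrow> 'a \<Rightarrow> 'a \<Rightarrow> real" where "k d y z = u_tilde l u \<phi> d y z * (\<phi> z)\<^sup>2"

lemma v_measurable: "0 < d \<Longrightarrow> (\<lambda>(x, y). v d x y) \<in> borel_measurable (borel \<Otimes>\<^sub>M borel)"
  unfolding v_def using u_measurable[of d] by (simp add: case_prod_beta')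

lemma v_pos: "0 < d \<Longrightarrow> 0 < v d x y" by (simp add: v_def u_pos)

lemma v_sym: "0 < d \<Longrightarrow> v d x y = v d y x" by (simp add: v_def u_sym)

lemma k_eq: "\<phi> y * k d y z = v d y z * \<phi> z"
  using \<phi>_pos[of y] \<phi>_pos[of z] by (simp add: k_def v_def u_tilde_def power2_eq_square)

lemma k_measurable: "0 < d \<Longrightarrow> (\<lambda>(x, y). k d x y) \<in> borel_measurable (borel \<Otimes>\<^sub>M borel)"
proof -
  assume "0 < d"
  from u_measurable[OF this] have [measurable]: "(\<lambda>z. u d (fst z) (snd z)) \<in> borel_measurable (borel \<Otimes>\<^sub>M borel)"
    by (simp add: case_prod_beta')
  show ?thesis unfolding k_def u_tilde_def case_prod_beta' by measurable
qed

lemma \<mu>x_prob: "prob_space (\<mu>x x)" and sets_\<mu>x: "sets (\<mu>x x) = sets (paths UNIV)"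
  and \<mu>x_start: "AE \<omega> in \<mu>x x. \<omega> 0 = x"
  and \<mu>x_indep: "prob_space.indep_set (\<mu>x x) (sets (gen_algebra (\<mu>x x) (\<lambda>t \<omega>. \<omega> t) {0..}))
                             (sets (gen_algebra (\<mu>x x) (\<lambda>t \<omega>. \<omega> (- t)) {0..}))"
  and \<mu>x_fwd: "markov_process (\<mu>x x) (\<lambda>t \<omega>. \<omega> t) (\<lambda>t y. density lborel (\<lambda>z. ennreal (k t y z)))"
  and \<mu>x_bwd: "markov_process (\<mu>x x) (\<lambda>t \<omega>. \<omega> (- t)) (\<lambda>t y. density lborel (\<lambda>z. ennreal (k t y z)))"
  using \<mu>x[of x] unfolding pphi1_path_measure_def Let_def k_def by blast+

lemma space_\<mu>x: "space (\<mu>x x) = space (paths UNIV)"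
  using sets_eq_imp_space_eq[OF sets_\<mu>x] .

lemma \<mu>x_coordinate: "(\<lambda>\<omega>. \<omega> t) \<in> borel_measurable (\<mu>x x)"
  by (rule measurable_coordinate'[OF sets_\<mu>x]) simp

text \<open>The Markov property at time \<open>0\<close>, applied to the whole space under the measure started at \<open>y\<close>, gives the
  transition kernel at \<open>y\<close> mass one. In terms of \<open>u\<close> this is the eigenvalue equation for \<open>\<phi>\<close>.\<close>

lemma k_mass: assumes d: "0 < d" shows "(\<integral>\<^sup>+z. ennreal (k d y z) \<partial>lborel) = 1"
proof -
  interpret M: prob_space "\<mu>x y" by (rule \<mu>x_prob)
  let ?G = "gen_algebra (\<mu>x y) (\<lambda>t \<omega>. \<omega> t) {0..0}"
  have sub: "subalgebra (\<mu>x y) ?G"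
    unfolding subalgebra_def by (intro conjI space_gen_algebra gen_algebra_subset \<mu>x_coordinate)
  interpret G: finite_measure_subalgebra "\<mu>x y" ?G by standard (rule sub)
  let ?m = "\<lambda>y. measure (density lborel (\<lambda>z. ennreal (k d y z))) UNIV"
  have eq: "{\<omega> \<in> space (\<mu>x y). \<omega> (0 + d) \<in> UNIV} = space ?G" by simp
  have "AE \<omega> in \<mu>x y. real_cond_exp (\<mu>x y) ?G (indicator {\<omega> \<in> space (\<mu>x y). \<omega> (0 + d) \<in> UNIV}) \<omega> = ?m (\<omega> 0)"
    by (rule \<mu>x_fwd[of y, unfolded markov_process_def, rule_format]) (use d in auto)
  then have "AE \<omega> in \<mu>x y. real_cond_exp (\<mu>x y) ?G (indicator (space ?G)) \<omega> = ?m (\<omega> 0)"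
    unfolding eq .
  moreover have "AE \<omega> in \<mu>x y. real_cond_exp (\<mu>x y) ?G (indicator (space ?G)) \<omega> = indicator (space ?G) \<omega>"
  proof (rule G.real_cond_exp_F_meas)
    show "integrable (\<mu>x y) (indicator (space ?G) :: _ \<Rightarrow> real)"
      by (rule integrable_real_indicator) (auto simp: M.emeasure_eq_measure)
    show "(indicator (space ?G) :: _ \<Rightarrow> real) \<in> borel_measurable ?G"
      by (rule borel_measurable_indicator[OF sets.top])
  qed
  ultimately have "AE \<omega> in \<mu>x y. ?m y = 1"
    using \<mu>x_start[of y] AE_space by eventually_elim simp
  then have "?m y = 1" by simp
  then have "emeasure (density lborel (\<lambda>z. ennreal (k d y z))) UNIV = 1"
    by (cases "emeasure (density lborel (\<lambda>z. ennreal (k d y z))) UNIV = \<infinity>")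
      (auto simp: measure_def emeasure_eq_ennreal_measure)
  moreover have [measurable]: "k d y \<in> borel_measurable borel"
    using measurable_compose[OF measurable_Pair1' k_measurable[OF d], of y] by simp
  ultimately show ?thesis by (simp add: emeasure_density)
qed

lemma \<mu>x_visits:
  assumes "itinerary L"
  shows "emeasure (\<mu>x x) {\<omega> \<in> space (\<mu>x x). visits 0 L \<omega>} = chain k L (\<lambda>_. 1) x"
    and "emeasure (\<mu>x x) {\<omega> \<in> space (\<mu>x x). visits 0 L (\<lambda>t. \<omega> (- t))} = chain k L (\<lambda>_. 1) x"
proof -
  have 1: "{\<omega> \<in> space (\<mu>x x). visits 0 L \<omega>} \<in> sets (\<mu>x x)"
    by (rule sets_visits[where Y = "\<lambda>\<omega>. \<omega>", OF assms]) (rule \<mu>x_coordinate)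
  have 2: "{\<omega> \<in> space (\<mu>x x). visits 0 L (\<lambda>t. \<omega> (- t))} \<in> sets (\<mu>x x)"
    by (rule sets_visits[OF assms]) (rule \<mu>x_coordinate)
  have "(\<integral>\<^sup>+\<omega>. indicator {\<omega>. visits 0 L (\<lambda>t. \<omega> t)} \<omega> * 1 \<partial>\<mu>x x) = chain k L (\<lambda>_. 1) x"
    by (rule markov_process_visits[OF \<mu>x_prob _ \<mu>x_fwd k_measurable k_mass]) (auto intro: \<mu>x_coordinate \<mu>x_start assms)
  moreover have "(\<integral>\<^sup>+\<omega>. indicator {\<omega>. visits 0 L \<omega>} \<omega> * 1 \<partial>\<mu>x x) = (\<integral>\<^sup>+\<omega>. indicator {\<omega> \<in> space (\<mu>x x). visits 0 L \<omega>} \<omega> \<partial>\<mu>x x)"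
    by (intro nn_integral_cong) (auto simp: indicator_def)
  ultimately show "emeasure (\<mu>x x) {\<omega> \<in> space (\<mu>x x). visits 0 L \<omega>} = chain k L (\<lambda>_. 1) x"
    using nn_integral_indicator[OF 1] by simp
  have "(\<integral>\<^sup>+\<omega>. indicator {\<omega>. visits 0 L (\<lambda>t. \<omega> (- t))} \<omega> * 1 \<partial>\<mu>x x) = chain k L (\<lambda>_. 1) x"
    by (rule markov_process_visits[OF \<mu>x_prob _ \<mu>x_bwd k_measurable k_mass]) (use \<mu>x_start[of x] in \<open>auto intro: \<mu>x_coordinate assms\<close>)
  moreover have "(\<integral>\<^sup>+\<omega>. indicator {\<omega>. visits 0 L (\<lambda>t. \<omega> (- t))} \<omega> * 1 \<partial>\<mu>x x)
      = (\<integral>\<^sup>+\<omega>. indicator {\<omega> \<in> space (\<mu>x x). visits 0 L (\<lambda>t. \<omega> (- t))} \<omega> \<partial>\<mu>x x)"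
    by (intro nn_integral_cong) (auto simp: indicator_def)
  ultimately show "emeasure (\<mu>x x) {\<omega> \<in> space (\<mu>x x). visits 0 L (\<lambda>t. \<omega> (- t))} = chain k L (\<lambda>_. 1) x"
    using nn_integral_indicator[OF 2] by simp
qed

lemma sets_zigzag:
  assumes "itinerary R" "itinerary L" "C \<in> sets borel" "sets M = sets (paths UNIV)"
  shows "{\<omega> \<in> space M. zigzag s R C L \<omega>} \<in> sets M"
proof -
  note c = measurable_coordinate'[OF assms(4) UNIV_I]
  have "{\<omega> \<in> space M. \<omega> s \<in> C} \<in> sets M"
    using measurable_sets[OF c assms(3)] by (simp add: vimage_def Int_def conj_commute)
  moreover have "{\<omega> \<in> space M. visits s L \<omega>} \<in> sets M"
    by (rule sets_visits[where Y = "\<lambda>\<omega>. \<omega>", OF assms(2)]) (rule c)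
  moreover have "{\<omega> \<in> space M. visits (- s) R (\<lambda>t. \<omega> (- t))} \<in> sets M"
    by (rule sets_visits[OF assms(1)]) (rule c)
  moreover have "{\<omega> \<in> space M. zigzag s R C L \<omega>} = {\<omega> \<in> space M. \<omega> s \<in> C} \<inter> {\<omega> \<in> space M. visits s L \<omega>}
      \<inter> {\<omega> \<in> space M. visits (- s) R (\<lambda>t. \<omega> (- t))}" by (auto simp: zigzag_def)
  ultimately show ?thesis by simp
qed

lemma \<mu>x_zigzag:
  assumes R: "itinerary R" and L: "itinerary L" and C: "C \<in> sets borel"
  shows "emeasure (\<mu>x x) {\<omega> \<in> space (\<mu>x x). zigzag 0 R C L \<omega>}
       = indicator C x * (chain k R (\<lambda>_. 1) x * chain k L (\<lambda>_. 1) x)"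
proof -
  interpret M: prob_space "\<mu>x x" by (rule \<mu>x_prob)
  let ?F = "{\<omega> \<in> space (\<mu>x x). visits 0 L \<omega>}" and ?B = "{\<omega> \<in> space (\<mu>x x). visits 0 R (\<lambda>t. \<omega> (- t))}"
  have "?F \<in> sets (gen_algebra (\<mu>x x) (\<lambda>t \<omega>. \<omega> t) {0..})"
  proof -
    have "{\<omega> \<in> space (gen_algebra (\<mu>x x) (\<lambda>t \<omega>. \<omega> t :: 'a) {0..}). visits 0 L \<omega>} \<in> sets (gen_algebra (\<mu>x x) (\<lambda>t \<omega>. \<omega> t) {0..})"
      by (rule sets_visits[where Y = "\<lambda>\<omega>. \<omega>", OF L]) (auto intro: measurable_gen_algebra[of _ "{0..}" "\<lambda>t \<omega>. \<omega> t"])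
    then show ?thesis by simp
  qed
  moreover have "?B \<in> sets (gen_algebra (\<mu>x x) (\<lambda>t \<omega>. \<omega> (- t)) {0..})"
  proof -
    have "{\<omega> \<in> space (gen_algebra (\<mu>x x) (\<lambda>t \<omega>. \<omega> (- t) :: 'a) {0..}). visits 0 R (\<lambda>t. \<omega> (- t))} \<in> sets (gen_algebra (\<mu>x x) (\<lambda>t \<omega>. \<omega> (- t)) {0..})"
      by (rule sets_visits[OF R]) (auto intro: measurable_gen_algebra[of _ "{0..}" "\<lambda>t \<omega>. \<omega> (- t)"])
    then show ?thesis by simp
  qed
  ultimately have "M.prob (?F \<inter> ?B) = M.prob ?F * M.prob ?B"
    by (rule M.indep_setD[OF \<mu>x_indep])
  then have e: "emeasure (\<mu>x x) (?F \<inter> ?B) = chain k R (\<lambda>_. 1) x * chain k L (\<lambda>_. 1) x"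
    using \<mu>x_visits[OF L, of x] \<mu>x_visits[OF R, of x]
    by (simp add: M.emeasure_eq_measure ennreal_mult' mult.commute)
  show ?thesis
  proof (cases "x \<in> C")
    case True
    have "emeasure (\<mu>x x) {\<omega> \<in> space (\<mu>x x). zigzag 0 R C L \<omega>} = emeasure (\<mu>x x) (?F \<inter> ?B)"
    proof (rule emeasure_eq_AE)
      show "AE \<omega> in \<mu>x x. (\<omega> \<in> {\<omega> \<in> space (\<mu>x x). zigzag 0 R C L \<omega>}) = (\<omega> \<in> ?F \<inter> ?B)"
        using \<mu>x_start[of x] by eventually_elim (use True in \<open>auto simp: zigzag_def\<close>)
      show "{\<omega> \<in> space (\<mu>x x). zigzag 0 R C L \<omega>} \<in> sets (\<mu>x x)" by (rule sets_zigzag[OF R L C sets_\<mu>x])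
      show "?F \<inter> ?B \<in> sets (\<mu>x x)"
        using sets_zigzag[OF R L _ sets_\<mu>x, of UNIV x 0] by (simp add: zigzag_def Int_def conj_ac)
    qed
    then show ?thesis using True e by simp
  next
    case False
    have "emeasure (\<mu>x x) {\<omega> \<in> space (\<mu>x x). zigzag 0 R C L \<omega>} = emeasure (\<mu>x x) {}"
    proof (rule emeasure_eq_AE)
      show "AE \<omega> in \<mu>x x. (\<omega> \<in> {\<omega> \<in> space (\<mu>x x). zigzag 0 R C L \<omega>}) = (\<omega> \<in> {})"
        using \<mu>x_start[of x] by eventually_elim (use False in \<open>auto simp: zigzag_def\<close>)
      show "{\<omega> \<in> space (\<mu>x x). zigzag 0 R C L \<omega>} \<in> sets (\<mu>x x)" by (rule sets_zigzag[OF R L C sets_\<mu>x])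
    qed simp
    then show ?thesis using False by simp
  qed
qed

lemma \<mu>x_kernel: "\<mu>x \<in> measurable borel (subprob_algebra (paths UNIV))"
proof (rule paths_kernel_measurable[where J\<^sub>0 = "{0}"])
  fix J :: "real set" and A :: "real \<Rightarrow> 'a set"
  assume J: "finite J" "{0} \<subseteq> J" "J \<subseteq> UNIV" and A: "\<And>j. A j \<in> sets borel"
  obtain R L where R: "itinerary R" and L: "itinerary L" and eq: "\<And>\<omega>. (\<forall>j\<in>J. \<omega> j \<in> A j) \<longleftrightarrow> zigzag 0 R (A 0) L \<omega>"
    using cylinder_zigzag[of J 0 A] J A by (metis insert_subset)
  have "cylinder UNIV J A = {\<omega> \<in> space (\<mu>x x). zigzag 0 R (A 0) L \<omega>}" for x
    unfolding cylinder_def eq space_\<mu>x by simp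
  then have "emeasure (\<mu>x x) (cylinder UNIV J A) = indicator (A 0) x * (chain k R (\<lambda>_. 1) x * chain k L (\<lambda>_. 1) x)" for x
    using \<mu>x_zigzag[OF R L A, of x 0] by metis
  moreover have [measurable]: "chain k R (\<lambda>_. 1) \<in> borel_measurable borel" "chain k L (\<lambda>_. 1) \<in> borel_measurable borel"
    using R L by (auto intro!: measurable_chain k_measurable)
  moreover note A[measurable]
  ultimately show "(\<lambda>x. emeasure (\<mu>x x) (cylinder UNIV J A)) \<in> borel_measurable borel"
    by (simp only:) measurable
qed (auto simp: sets_\<mu>x \<mu>x_prob prob_space_imp_subprob_space)

abbreviation \<mu> :: "(real \<Rightarrow> 'a) measure" where "\<mu> \<equiv> pphi1_measure \<phi> \<mu>x"

abbreviation \<phi>2 :: "'a measure" where "\<phi>2 \<equiv> density lborel (\<lambda>x. ennreal ((\<phi> x)\<^sup>2))"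

lemma \<mu>x_kernel': "\<mu>x \<in> measurable \<phi>2 (subprob_algebra (paths UNIV))"
  using \<mu>x_kernel by (simp cong: measurable_cong_sets)

text \<open>The set function that defines the measure is a mixture of the measurable kernel \<open>\<mu>x\<close>, and therefore countably
  additive.\<close>

lemma \<mu>_eq_bind: "\<mu> = \<phi>2 \<bind> \<mu>x"
proof -
  let ?B = "\<phi>2 \<bind> \<mu>x"
  have sets: "sets ?B = sets (paths UNIV)"
    by (rule sets_bind[OF sets_kernel[OF \<mu>x_kernel']]) auto
  have "emeasure ?B A = (\<integral>\<^sup>+x. emeasure (\<mu>x x) A * ennreal ((\<phi> x)\<^sup>2) \<partial>lborel)" if "A \<in> sets (paths UNIV)" for A
  proof -
    have [measurable]: "(\<lambda>x. emeasure (\<mu>x x) A) \<in> borel_measurable borel"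
      by (rule measurable_emeasure_kernel[OF \<mu>x_kernel that])
    have "emeasure ?B A = (\<integral>\<^sup>+x. emeasure (\<mu>x x) A \<partial>\<phi>2)"
      by (rule emeasure_bind[OF _ \<mu>x_kernel' that]) simp
    also have "\<dots> = (\<integral>\<^sup>+x. emeasure (\<mu>x x) A * ennreal ((\<phi> x)\<^sup>2) \<partial>lborel)"
      by (subst nn_integral_density) (auto simp: mult.commute)
    finally show ?thesis .
  qed
  then have "measure_of (space (paths UNIV)) (sets (paths UNIV)) (emeasure ?B) = \<mu>"
    unfolding pphi1_measure_def by (intro measure_of_eq sets.space_closed) (simp add: sets.sigma_sets_eq)
  then show ?thesis
    using measure_of_of_measure[of ?B] by (simp add: sets sets_eq_imp_space_eq[OF sets])
qed

lemma sets_\<mu>: "sets \<mu> = sets (paths UNIV)"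
  unfolding \<mu>_eq_bind by (rule sets_bind[OF sets_kernel[OF \<mu>x_kernel']]) auto

lemma space_\<mu>: "space \<mu> = space (paths UNIV)"
  using sets_eq_imp_space_eq[OF sets_\<mu>] .

text \<open>The ground state factors of the Doob transform telescope along a chain.\<close>

lemma chain_k: "itinerary L \<Longrightarrow> ennreal (\<phi> x) * chain k L (\<lambda>_. 1) x = chain v L (\<lambda>y. ennreal (\<phi> y)) x"
proof (induction L arbitrary: x)
  case (Cons a L)
  obtain d A where a: "a = (d, A)" by force
  have d: "0 < d" and L: "itinerary L" and [measurable]: "A \<in> sets borel" using Cons.prems by (auto simp: a)
  have [measurable]: "chain k L (\<lambda>_. 1) \<in> borel_measurable borel"
    using L by (auto intro!: measurable_chain k_measurable)
  have [measurable]: "k d x \<in> borel_measurable borel"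
    using measurable_compose[OF measurable_Pair1' k_measurable[OF d], of x] by simp
  have "ennreal (\<phi> x) * chain k (a # L) (\<lambda>_. 1) x
      = (\<integral>\<^sup>+y. ennreal (\<phi> x) * (ennreal (k d x y) * (indicator A y * chain k L (\<lambda>_. 1) y)) \<partial>lborel)"
    by (simp add: a nn_integral_cmult)
  also have "\<dots> = (\<integral>\<^sup>+y. ennreal (v d x y) * (indicator A y * (ennreal (\<phi> y) * chain k L (\<lambda>_. 1) y)) \<partial>lborel)"
  proof (rule nn_integral_cong)
    fix y
    have "ennreal (\<phi> x) * ennreal (k d x y) = ennreal (v d x y) * ennreal (\<phi> y)"
      using \<phi>_pos[of x] \<phi>_pos[of y] v_pos[OF d, of x y] by (simp add: ennreal_mult'[symmetric] k_eq less_imp_le)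
    then have "(ennreal (\<phi> x) * ennreal (k d x y)) * (indicator A y * chain k L (\<lambda>_. 1) y)
        = (ennreal (v d x y) * ennreal (\<phi> y)) * (indicator A y * chain k L (\<lambda>_. 1) y)" by simp
    then show "ennreal (\<phi> x) * (ennreal (k d x y) * (indicator A y * chain k L (\<lambda>_. 1) y))
        = ennreal (v d x y) * (indicator A y * (ennreal (\<phi> y) * chain k L (\<lambda>_. 1) y))"
      by (simp only: ac_simps)
  qed
  also have "\<dots> = chain v (a # L) (\<lambda>y. ennreal (\<phi> y)) x"
    using Cons.IH[OF L] by (simp add: a)
  finally show ?case .
qed simp

abbreviation \<phi>_chain :: "(real \<times> 'a set) list \<Rightarrow> 'a \<Rightarrow> ennreal" where
  "\<phi>_chain L \<equiv> chain v L (\<lambda>y. ennreal (\<phi> y))"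

lemma \<phi>_chain_measurable: "itinerary L \<Longrightarrow> \<phi>_chain L \<in> borel_measurable borel"
  by (intro measurable_chain v_measurable) auto

definition zigzag_integral :: "(real \<times> 'a set) list \<Rightarrow> 'a set \<Rightarrow> (real \<times> 'a set) list \<Rightarrow> ennreal" where
  "zigzag_integral R C L = (\<integral>\<^sup>+x. indicator C x * (\<phi>_chain R x * \<phi>_chain L x) \<partial>lborel)"

text \<open>By symmetry of \<open>v\<close>, the step from the pivot \<open>x\<close> to the next position \<open>y\<close> can be read as a step from \<open>y\<close> back
  to \<open>x\<close>; exchanging the two integrals makes \<open>y\<close> the pivot.\<close>

lemma zigzag_integral_move:
  assumes "itinerary R" "C \<in> sets borel" "itinerary ((d, D) # L)"
  shows "zigzag_integral R C ((d, D) # L) = zigzag_integral ((d, C) # R) D L"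
proof -
  have d: "0 < d" and [measurable]: "D \<in> sets borel" "C \<in> sets borel" and L: "itinerary L" using assms by auto
  note [measurable] = \<phi>_chain_measurable[OF L] \<phi>_chain_measurable[OF assms(1)] v_measurable[OF d]
  have "zigzag_integral R C ((d, D) # L)
      = (\<integral>\<^sup>+x. \<integral>\<^sup>+y. indicator C x * \<phi>_chain R x * (ennreal (v d x y) * (indicator D y * \<phi>_chain L y)) \<partial>lborel \<partial>lborel)"
    unfolding zigzag_integral_def by (simp add: nn_integral_cmult mult.assoc)
  also have "\<dots> = (\<integral>\<^sup>+y. \<integral>\<^sup>+x. indicator C x * \<phi>_chain R x * (ennreal (v d x y) * (indicator D y * \<phi>_chain L y)) \<partial>lborel \<partial>lborel)"
    by (rule lborel_pair.Fubini'[symmetric]) measurable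
  also have "\<dots> = (\<integral>\<^sup>+y. \<integral>\<^sup>+x. (indicator D y * \<phi>_chain L y) * (ennreal (v d y x) * (indicator C x * \<phi>_chain R x)) \<partial>lborel \<partial>lborel)"
    by (intro nn_integral_cong) (simp add: v_sym[OF d] ac_simps)
  also have "\<dots> = (\<integral>\<^sup>+y. (indicator D y * \<phi>_chain L y) * (\<integral>\<^sup>+x. ennreal (v d y x) * (indicator C x * \<phi>_chain R x) \<partial>lborel) \<partial>lborel)"
    by (intro nn_integral_cong nn_integral_cmult) measurable
  also have "\<dots> = zigzag_integral ((d, C) # R) D L"
    unfolding zigzag_integral_def by (intro nn_integral_cong) (simp add: ac_simps)
  finally show ?thesis .
qed

lemma \<mu>_zigzag_0:
  assumes R: "itinerary R" and L: "itinerary L" and C [measurable]: "C \<in> sets borel"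
  shows "emeasure \<mu> {\<omega> \<in> space \<mu>. zigzag 0 R C L \<omega>} = zigzag_integral R C L"
proof -
  have [measurable]: "chain k R (\<lambda>_. 1) \<in> borel_measurable borel" "chain k L (\<lambda>_. 1) \<in> borel_measurable borel"
    using R L by (auto intro!: measurable_chain k_measurable)
  have s: "{\<omega> \<in> space \<mu>. zigzag 0 R C L \<omega>} \<in> sets (paths UNIV)"
    using sets_zigzag[OF R L C sets_\<mu>, of 0] by (simp add: sets_\<mu>)
  have "emeasure \<mu> {\<omega> \<in> space \<mu>. zigzag 0 R C L \<omega>} = (\<integral>\<^sup>+x. emeasure (\<mu>x x) {\<omega> \<in> space \<mu>. zigzag 0 R C L \<omega>} \<partial>\<phi>2)"
    unfolding \<mu>_eq_bind using s by (intro emeasure_bind[OF _ \<mu>x_kernel']) (auto simp: \<mu>_eq_bind)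
  also have "\<dots> = (\<integral>\<^sup>+x. indicator C x * (chain k R (\<lambda>_. 1) x * chain k L (\<lambda>_. 1) x) \<partial>\<phi>2)"
    using \<mu>x_zigzag[OF R L C] by (intro nn_integral_cong) (simp add: space_\<mu> space_\<mu>x)
  also have "\<dots> = (\<integral>\<^sup>+x. ennreal ((\<phi> x)\<^sup>2) * (indicator C x * (chain k R (\<lambda>_. 1) x * chain k L (\<lambda>_. 1) x)) \<partial>lborel)"
    by (rule nn_integral_density) measurable
  also have "\<dots> = zigzag_integral R C L"
    unfolding zigzag_integral_def chain_k[OF R, symmetric] chain_k[OF L, symmetric]
    by (intro nn_integral_cong) (simp add: power2_eq_square ennreal_mult' \<phi>_pos less_imp_le ac_simps)
  finally show ?thesis .
qed

text \<open>The measure is built from a pivot at time \<open>0\<close>. Provided that \<open>0\<close> occurs among the times, the pivot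
  can be moved there, both in the event and in the integral.\<close>

lemma \<mu>_zigzag:
  assumes "itinerary R" "itinerary L" "C \<in> sets borel" "0 \<in> visit_times s L"
  shows "emeasure \<mu> {\<omega> \<in> space \<mu>. zigzag s R C L \<omega>} = zigzag_integral R C L"
  using assms
proof (induction L arbitrary: s R C)
  case Nil
  then show ?case using \<mu>_zigzag_0[of R "[]" C] by simp
next
  case (Cons a L)
  obtain d D where a: "a = (d, D)" by force
  show ?case
  proof (cases "s = 0")
    case True
    then show ?thesis using \<mu>_zigzag_0 Cons.prems by simp
  next
    case False
    then have "0 \<in> visit_times (s + d) L" using Cons.prems by (simp add: a)
    then have "emeasure \<mu> {\<omega> \<in> space \<mu>. zigzag (s + d) ((d, C) # R) D L \<omega>} = zigzag_integral ((d, C) # R) D L"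
      using Cons.prems by (intro Cons.IH) (auto simp: a)
    then show ?thesis
      using Cons.prems zigzag_integral_move[of R C d D L] by (simp add: a zigzag_move)
  qed
qed

lemma prob_space_\<mu>: "prob_space \<mu>"
proof (rule prob_spaceI)
  have "emeasure \<mu> (space \<mu>) = zigzag_integral [] UNIV []"
    using \<mu>_zigzag_0[of "[]" "[]" UNIV] by (simp add: zigzag_def)
  also have "\<dots> = 1"
    using \<phi>_norm by (simp add: zigzag_integral_def power2_eq_square ennreal_mult' \<phi>_pos less_imp_le)
  finally show "emeasure \<mu> (space \<mu>) = 1" .
qed

end

section \<open>The Feynman-Kac formula at several times\<close>

locale feynman_kac_process = stable \<alpha> P p + ground_state_process l u \<phi> \<mu>x
  for \<alpha> and P :: "'a::euclidean_space \<Rightarrow> (real \<Rightarrow> 'a) measure" and p l and u :: "real \<Rightarrow> 'a \<Rightarrow> 'a \<Rightarrow> real" and \<phi> \<mu>x +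
  fixes V :: "'a \<Rightarrow> real"
  assumes kato: "kato_decomposable P V"
    and fk: "\<And>d f. 0 < d \<Longrightarrow> f \<in> l2 \<Longrightarrow> AE x in lborel. feynman_kac P V d f x = (\<integral>y. u d x y *\<^sub>R f y \<partial>lborel)"
    and \<phi>_l2: "(\<lambda>x. complex_of_real (\<phi> x)) \<in> l2"
begin

lemma V_measurable [measurable]: "V \<in> borel_measurable borel"
  using kato by (simp add: kato_decomposable_def)

lemma abs_action_AE: "AE \<omega> in P x. abs_action V 0 t \<omega> < \<infinity>"
  by (rule kato_decomposable_AE[OF kato])

lemma ground_state_eigen:
  assumes d: "0 < d"
  shows "(\<integral>\<^sup>+y. ennreal (u d x y * \<phi> y) \<partial>lborel) = ennreal (exp (- l * d) * \<phi> x)"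
proof -
  have [measurable]: "k d x \<in> borel_measurable borel"
    using measurable_compose[OF measurable_Pair1' k_measurable[OF d], of x] by simp
  have "u d x y * \<phi> y = (exp (- l * d) * \<phi> x) * k d x y" for y
    using \<phi>_pos[of x] \<phi>_pos[of y] by (simp add: k_def u_tilde_def power2_eq_square exp_minus)
  then have "(\<integral>\<^sup>+y. ennreal (u d x y * \<phi> y) \<partial>lborel) = (\<integral>\<^sup>+y. ennreal (exp (- l * d) * \<phi> x) * ennreal (k d x y) \<partial>lborel)"
    using \<phi>_pos[of x] by (intro nn_integral_cong) (simp add: ennreal_mult'[symmetric] less_imp_le)
  also have "\<dots> = ennreal (exp (- l * d) * \<phi> x)"
    by (simp add: nn_integral_cmult k_mass[OF d])
  finally show ?thesis .
qed

lemma action_measurable: "0 \<le> d \<Longrightarrow> action V 0 d \<in> borel_measurable (paths {0..})"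
  by (rule measurable_action) auto

lemma action_measurable_P: "0 \<le> d \<Longrightarrow> action V 0 d \<in> borel_measurable (P x)"
  using action_measurable[of d] by (simp add: measurable_cong_sets[OF sets_P refl])

lemma coordinate_P: "0 \<le> d \<Longrightarrow> (\<lambda>\<omega>. \<omega> d) \<in> borel_measurable (P x)"
  by (rule measurable_coordinate'[OF sets_P]) auto

text \<open>By the eigenvalue equation the Feynman-Kac integral of \<open>\<phi>\<close> is nonzero, hence a genuine integral: a Bochner
  integral of a function that is not integrable would be zero. So \<open>\<phi>\<close> serves as an integrable weight, and the
  Bochner integrals of its restrictions are integrals of nonnegative functions.\<close>

lemma feynman_kac_set:
  assumes d: "0 < d" and B [measurable]: "B \<in> sets borel"
  shows "AE x in lborel. (\<integral>\<^sup>+\<omega>. ennreal (exp (- action V 0 d \<omega>)) * (ennreal (\<phi> (\<omega> d)) * indicator B (\<omega> d)) \<partial>P x)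
           = (\<integral>\<^sup>+y. ennreal (u d x y) * (ennreal (\<phi> y) * indicator B y) \<partial>lborel)"
proof -
  let ?f = "\<lambda>B y. complex_of_real (\<phi> y * indicator B y)"
  have sq: "integrable lborel (\<lambda>x. (\<phi> x)\<^sup>2)"
    using \<phi>_l2 by (simp add: l2_def)
  have l2: "?f B \<in> l2" if [measurable]: "B \<in> sets borel" for B
  proof -
    have "integrable lborel (\<lambda>x. (\<phi> x * indicator B x)\<^sup>2)"
      by (rule Bochner_Integration.integrable_bound[OF sq]) (auto simp: indicator_def)
    then show ?thesis by (simp add: l2_def norm_mult power_mult_distrib)
  qed
  let ?g = "\<lambda>B x \<omega>. exp (- action V 0 d \<omega>) * (\<phi> (\<omega> d) * indicator B (\<omega> d))"
  have um [measurable]: "u d x \<in> borel_measurable borel" for x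
    using measurable_compose[OF measurable_Pair1' u_measurable[OF d], of x] by simp
  have fkB: "feynman_kac P V d (?f B) x = complex_of_real (\<integral>\<omega>. ?g B x \<omega> \<partial>P x)" for B x
    unfolding feynman_kac_def by (subst integral_complex_of_real[symmetric]) (simp add: scaleR_conv_of_real)
  have uB: "(\<integral>y. u d x y *\<^sub>R ?f B y \<partial>lborel) = complex_of_real (\<integral>y. u d x y * (\<phi> y * indicator B y) \<partial>lborel)" for B x
    by (subst integral_complex_of_real[symmetric]) (simp add: scaleR_conv_of_real)
  have pos: "0 \<le> u d x y" "0 \<le> \<phi> y" for x y using u_pos[OF d, of x y] \<phi>_pos[of y] by simp_all
  have int: "integrable lborel (\<lambda>y. u d x y * \<phi> y)" for x
    using ground_state_eigen[OF d, of x] pos by (intro integrableI_nonneg) auto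
  have intB: "integrable lborel (\<lambda>y. u d x y * (\<phi> y * indicator B y))" for x
    by (rule Bochner_Integration.integrable_bound[OF int[of x]]) (use pos in \<open>auto simp: indicator_def\<close>)
  have ne: "(\<integral>y. u d x y * (\<phi> y * indicator UNIV y) \<partial>lborel) \<noteq> 0" for x
  proof -
    have "ennreal (\<integral>y. u d x y * \<phi> y \<partial>lborel) = ennreal (exp (- l * d) * \<phi> x)"
      using nn_integral_eq_integral[OF int[of x]] pos ground_state_eigen[OF d, of x] by simp
    moreover have "0 < exp (- l * d) * \<phi> x" using \<phi>_pos[of x] by simp
    ultimately show ?thesis by auto
  qed
  have gm: "?g B x \<in> borel_measurable (P x)" if [measurable]: "B \<in> sets borel" for B x
  proof -
    have [measurable]: "action V 0 d \<in> borel_measurable (P x)" "(\<lambda>\<omega>. \<omega> d) \<in> borel_measurable (P x)"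
      using action_measurable_P coordinate_P d by auto
    show ?thesis by measurable
  qed
  have l2_UNIV: "?f UNIV \<in> l2" by (rule l2) simp
  show ?thesis
    using fk[OF d l2[OF B]] fk[OF d l2_UNIV]
  proof eventually_elim
    case (elim x)
    have "integrable (P x) (?g UNIV x)"
    proof (rule ccontr)
      assume "\<not> ?thesis"
      then have "feynman_kac P V d (?f UNIV) x = 0" unfolding fkB by (simp add: not_integrable_integral_eq)
      with elim(2) ne[of x] show False unfolding uB by simp
    qed
    then have i: "integrable (P x) (?g B x)"
      by (rule Bochner_Integration.integrable_bound) (use pos gm[OF B] in \<open>auto simp: indicator_def\<close>)
    have "(\<integral>\<omega>. ?g B x \<omega> \<partial>P x) = (\<integral>y. u d x y * (\<phi> y * indicator B y) \<partial>lborel)"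
      using elim(1) unfolding fkB uB by (simp only: of_real_eq_iff)
    then have "(\<integral>\<^sup>+\<omega>. ennreal (?g B x \<omega>) \<partial>P x) = (\<integral>\<^sup>+y. ennreal (u d x y * (\<phi> y * indicator B y)) \<partial>lborel)"
      using pos by (simp add: nn_integral_eq_integral[OF i] nn_integral_eq_integral[OF intB])
    moreover have "ennreal (?g B x \<omega>) = ennreal (exp (- action V 0 d \<omega>)) * (ennreal (\<phi> (\<omega> d)) * indicator B (\<omega> d))" for \<omega>
      using pos by (simp add: ennreal_mult' indicator_def)
    moreover have "ennreal (u d x y * (\<phi> y * indicator B y)) = ennreal (u d x y) * (ennreal (\<phi> y) * indicator B y)" for y
      using pos by (simp add: ennreal_mult' indicator_def)
    ultimately show ?case by simp
  qed
qed

text \<open>Monotone approximation of \<open>h / \<phi>\<close>. The null set of starting points depends on the function, so only countably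
  many exceptional sets may be collected; monotone sequences respect this.\<close>

lemma feynman_kac_nn_integral:
  assumes d: "0 < d" and h: "h \<in> borel_measurable borel"
  shows "AE x in lborel. (\<integral>\<^sup>+\<omega>. ennreal (exp (- action V 0 d \<omega>)) * h (\<omega> d) \<partial>P x)
           = (\<integral>\<^sup>+y. ennreal (u d x y) * h y \<partial>lborel)"
proof -
  have um [measurable]: "u d x \<in> borel_measurable borel" for x
    using measurable_compose[OF measurable_Pair1' u_measurable[OF d], of x] by simp
  have [measurable]: "action V 0 d \<in> borel_measurable (P x)" "(\<lambda>\<omega>. \<omega> d) \<in> borel_measurable (P x)" for x
    using action_measurable_P coordinate_P d by auto
  let ?e = "\<lambda>\<omega>. ennreal (exp (- action V 0 d \<omega>))"
  have *: "AE x in lborel. (\<integral>\<^sup>+\<omega>. ?e \<omega> * (ennreal (\<phi> (\<omega> d)) * g (\<omega> d)) \<partial>P x)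
           = (\<integral>\<^sup>+y. ennreal (u d x y) * (ennreal (\<phi> y) * g y) \<partial>lborel)"
    if "g \<in> borel_measurable borel" for g
    using that
  proof (induction g rule: borel_measurable_induct)
    case (cong f g)
    then have "f = g" by auto
    with cong show ?case by simp
  next
    case (set B)
    then show ?case by (rule feynman_kac_set[OF d])
  next
    case (mult g c)
    note [measurable] = mult.hyps(2)
    have eq: "a * (b * (c * x)) = c * (a * (b * x))" for a b x :: ennreal by (simp add: ac_simps)
    show ?case using mult.IH
      by eventually_elim (simp add: eq nn_integral_cmult)
  next
    case (add f g)
    note [measurable] = add.hyps(1,3)
    show ?case using add.IH
      by eventually_elim (simp add: distrib_left nn_integral_add)
  next
    case (seq U)
    note [measurable] = seq.hyps(1)
    have "AE x in lborel. \<forall>i. (\<integral>\<^sup>+\<omega>. ?e \<omega> * (ennreal (\<phi> (\<omega> d)) * U i (\<omega> d)) \<partial>P x)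
           = (\<integral>\<^sup>+y. ennreal (u d x y) * (ennreal (\<phi> y) * U i y) \<partial>lborel)"
      unfolding AE_all_countable using seq.IH by blast
    then show ?case
    proof eventually_elim
      case (elim x)
      have inc: "incseq (\<lambda>i z. a z * (b z * U i (c z)))" for a b :: "'z \<Rightarrow> ennreal" and c
        using seq.hyps(3) by (auto simp: incseq_def le_fun_def intro!: mult_left_mono)
      have S: "a * (b * (SUP i. U i) z) = (SUP i. a * (b * U i z))" for a b :: ennreal and z
        by (simp add: SUP_mult_left_ennreal image_comp)
      have "(\<integral>\<^sup>+\<omega>. ?e \<omega> * (ennreal (\<phi> (\<omega> d)) * (SUP i. U i) (\<omega> d)) \<partial>P x)
          = (SUP i. \<integral>\<^sup>+\<omega>. ?e \<omega> * (ennreal (\<phi> (\<omega> d)) * U i (\<omega> d)) \<partial>P x)"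
        unfolding S by (rule nn_integral_monotone_convergence_SUP[OF inc]) measurable
      also have "\<dots> = (SUP i. \<integral>\<^sup>+y. ennreal (u d x y) * (ennreal (\<phi> y) * U i y) \<partial>lborel)"
        using elim by simp
      also have "\<dots> = (\<integral>\<^sup>+y. ennreal (u d x y) * (ennreal (\<phi> y) * (SUP i. U i) y) \<partial>lborel)"
        unfolding S using um seq.hyps(1)
        by (intro nn_integral_monotone_convergence_SUP[OF inc, symmetric] borel_measurable_times measurable_compose[OF _ measurable_ennreal]) auto
      finally show ?case .
    qed
  qed
  have "ennreal (\<phi> y) * (h y * ennreal (1 / \<phi> y)) = h y" for y
  proof -
    have "ennreal (\<phi> y) * ennreal (1 / \<phi> y) = 1"
      using \<phi>_pos[of y] by (simp add: ennreal_mult'[symmetric] less_imp_le)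
    then show ?thesis by (metis mult.left_commute mult.right_neutral)
  qed
  with *[of "\<lambda>y. h y * ennreal (1 / \<phi> y)"] h show ?thesis by simp
qed

definition weight :: "real \<Rightarrow> (real \<Rightarrow> 'a) \<Rightarrow> ennreal" where
  "weight t \<omega> = ennreal (exp (l * t - action V 0 t \<omega>))"

lemma weight_measurable: "0 \<le> t \<Longrightarrow> weight t \<in> borel_measurable (paths {0..})"
proof -
  assume "0 \<le> t"
  note [measurable] = action_measurable[OF this]
  show ?thesis unfolding weight_def[abs_def] by measurable
qed

text \<open>Induction from the left end of the itinerary. The Markov property at the first time and additivity of the
  action reduce the claim to the single-time formula for the function \<open>g\<close> of the remaining itinerary. That \<open>g\<close> is
  known only almost everywhere does no harm, as the position at a positive time has a density.\<close>

lemma feynman_kac_visits: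
  assumes "itinerary L" and h [measurable]: "h \<in> borel_measurable borel"
  shows "AE x in lborel. (\<integral>\<^sup>+\<omega>. weight (duration L) \<omega> * (indicator {\<omega>. visits 0 L \<omega>} \<omega> * h (\<omega> (duration L))) \<partial>P x)
           = chain v L h x"
  using assms(1)
proof (induction L)
  case Nil
  have "(\<integral>\<^sup>+\<omega>. weight 0 \<omega> * h (\<omega> 0) \<partial>P x) = h x" for x
  proof -
    have "(\<integral>\<^sup>+\<omega>. weight 0 \<omega> * h (\<omega> 0) \<partial>P x) = (\<integral>\<^sup>+\<omega>. h x \<partial>P x)"
    proof (rule nn_integral_cong_AE)
      have "weight 0 \<omega> = 1" for \<omega> by (simp add: weight_def action_half_open)
      then show "AE \<omega> in P x. weight 0 \<omega> * h (\<omega> 0) = h x"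
        using P_start[of x] by (auto elim: eventually_mono)
    qed
    then show ?thesis using prob_space.emeasure_space_1[OF prob_space_P] by simp
  qed
  then show ?case by simp
next
  case (Cons a L)
  obtain d A where a: "a = (d, A)" by force
  have d: "0 < d" and L: "itinerary L" and A [measurable]: "A \<in> sets borel" using Cons.prems by (auto simp: a)
  let ?r = "duration L"
  have r: "0 \<le> ?r" by (rule duration_nonneg[OF L])
  define f where "f L \<omega> = weight (duration L) \<omega> * (indicator {\<omega>. visits 0 L \<omega>} \<omega> * h (\<omega> (duration L)))"
    for L and \<omega> :: "real \<Rightarrow> 'a"
  have fm: "f L \<in> borel_measurable (paths {0..})" if "itinerary L" for L
  proof -
    have [measurable]: "Measurable.pred (paths {0..}) (visits 0 L :: (real \<Rightarrow> 'a) \<Rightarrow> bool)"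
      by (rule pred_visits_paths[OF that])
    have [measurable]: "(\<lambda>\<omega>. \<omega> (duration L)) \<in> borel_measurable (paths {0..} :: (real \<Rightarrow> 'a) measure)"
      using duration_nonneg[OF that] by (intro measurable_coordinate) auto
    note [measurable] = weight_measurable[OF duration_nonneg[OF that]]
    show ?thesis unfolding f_def by measurable
  qed
  define g where "g y = (\<integral>\<^sup>+\<omega>. f L \<omega> \<partial>P y)" for y
  have gm [measurable]: "g \<in> borel_measurable borel"
    unfolding g_def using measurable_compose[OF P_kernel nn_integral_measurable_subprob_algebra[OF fm[OF L]]] .
  have g: "AE y in lborel. g y = chain v L h y" using Cons.IH[OF L] by (simp add: g_def f_def)
  have step: "(\<integral>\<^sup>+\<omega>. f (a # L) \<omega> \<partial>P x) = (\<integral>\<^sup>+\<omega>. weight d \<omega> * (indicator A (\<omega> d) * g (\<omega> d)) \<partial>P x)" for x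
  proof -
    have "(\<integral>\<^sup>+\<omega>. f (a # L) \<omega> \<partial>P x) = (\<integral>\<^sup>+\<omega>. \<integral>\<^sup>+\<omega>'. f (a # L) (markov_glue d \<omega> \<omega>') \<partial>P (\<omega> d) \<partial>P x)"
      by (rule nn_integral_markov[OF d fm[OF Cons.prems]])
    also have "\<dots> = (\<integral>\<^sup>+\<omega>. weight d \<omega> * (indicator A (\<omega> d) * g (\<omega> d)) \<partial>P x)"
    proof (rule nn_integral_cong_AE)
      show "AE \<omega> in P x. (\<integral>\<^sup>+\<omega>'. f (a # L) (markov_glue d \<omega> \<omega>') \<partial>P (\<omega> d)) = weight d \<omega> * (indicator A (\<omega> d) * g (\<omega> d))"
        using abs_action_AE[where x = x and t = d] AE_space
      proof eventually_elim
        case (elim \<omega>)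
        have "(\<integral>\<^sup>+\<omega>'. f (a # L) (markov_glue d \<omega> \<omega>') \<partial>P (\<omega> d)) = (\<integral>\<^sup>+\<omega>'. (weight d \<omega> * indicator A (\<omega> d)) * f L \<omega>' \<partial>P (\<omega> d))"
        proof (rule nn_integral_cong_AE)
          show "AE \<omega>' in P (\<omega> d). f (a # L) (markov_glue d \<omega> \<omega>') = (weight d \<omega> * indicator A (\<omega> d)) * f L \<omega>'"
            using abs_action_AE[where x = "\<omega> d" and t = ?r] AE_space P_start[of "\<omega> d"]
          proof eventually_elim
            case (elim \<omega>')
            have "action V 0 (d + ?r) (markov_glue d \<omega> \<omega>') = action V 0 d \<omega> + action V 0 ?r \<omega>'"
              by (rule action_glue)
                (use \<open>abs_action V 0 d \<omega> < \<infinity>\<close> \<open>\<omega> \<in> space (P x)\<close> elim d r in \<open>auto simp: space_P\<close>)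
            then have w: "weight (d + ?r) (markov_glue d \<omega> \<omega>') = weight d \<omega> * weight ?r \<omega>'"
              by (simp add: weight_def ennreal_mult'[symmetric] exp_add[symmetric] algebra_simps)
            have "visits 0 (a # L) (markov_glue d \<omega> \<omega>') \<longleftrightarrow> \<omega> d \<in> A \<and> visits 0 L \<omega>'"
              using visits_markov_glue(2)[OF d, of "[]" L \<omega> \<omega>'] L d elim(3) by (auto simp: a markov_glue_def)
            moreover have "markov_glue d \<omega> \<omega>' (d + ?r) = \<omega>' ?r" using d r by (simp add: markov_glue_def)
            ultimately show ?case using w by (simp add: f_def a indicator_def mult.assoc)
          qed
        qed
        also have "\<dots> = (weight d \<omega> * indicator A (\<omega> d)) * g (\<omega> d)"
          unfolding g_def using fm[OF L] by (intro nn_integral_cmult) (simp add: measurable_cong_sets[OF sets_P refl])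
        finally show ?case by (simp add: mult.assoc)
      qed
    qed
    finally show ?thesis .
  qed
  have "AE x in lborel. (\<integral>\<^sup>+\<omega>. ennreal (exp (- action V 0 d \<omega>)) * (indicator A (\<omega> d) * g (\<omega> d)) \<partial>P x)
           = (\<integral>\<^sup>+y. ennreal (u d x y) * (indicator A y * g y) \<partial>lborel)"
    by (rule feynman_kac_nn_integral[OF d]) measurable
  then show ?case unfolding f_def[symmetric]
  proof eventually_elim
    case (elim x)
    have iAg [measurable]: "(\<lambda>y. indicator A y * g y) \<in> borel_measurable borel" by measurable
    have [measurable]: "action V 0 d \<in> borel_measurable (P x)" "(\<lambda>\<omega>. \<omega> d) \<in> borel_measurable (P x)"
      using action_measurable_P coordinate_P d by auto
    have um [measurable]: "u d x \<in> borel_measurable borel"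
      using measurable_compose[OF measurable_Pair1' u_measurable[OF d], of x] by simp
    have w: "weight d \<omega> = ennreal (exp (l * d)) * ennreal (exp (- action V 0 d \<omega>))" for \<omega>
      by (simp add: weight_def ennreal_mult'[symmetric] exp_add[symmetric])
    have vu: "ennreal (v d x y) = ennreal (exp (l * d)) * ennreal (u d x y)" for y
      by (simp add: v_def ennreal_mult')
    have "(\<integral>\<^sup>+\<omega>. f (a # L) \<omega> \<partial>P x) = ennreal (exp (l * d)) * (\<integral>\<^sup>+\<omega>. ennreal (exp (- action V 0 d \<omega>)) * (indicator A (\<omega> d) * g (\<omega> d)) \<partial>P x)"
      unfolding step w mult.assoc using measurable_compose[OF coordinate_P iAg, of d x] d
      by (intro nn_integral_cmult borel_measurable_times) auto
    also have "\<dots> = (\<integral>\<^sup>+y. ennreal (v d x y) * (indicator A y * g y) \<partial>lborel)"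
      unfolding elim vu mult.assoc using iAg um
      by (intro nn_integral_cmult[symmetric] borel_measurable_times) auto
    also have "\<dots> = (\<integral>\<^sup>+y. ennreal (v d x y) * (indicator A y * chain v L h y) \<partial>lborel)"
      by (rule nn_integral_cong_AE) (use g in \<open>auto elim: eventually_mono\<close>)
    finally show ?case by (simp add: a)
  qed
qed

text \<open>A visit to the whole space is no constraint, so both sides are the same Feynman-Kac expectation.\<close>

lemma chapman_kolmogorov_AE:
  assumes "0 < s" "0 < t" "h \<in> borel_measurable borel"
  shows "AE x in lborel. chain v [(s, UNIV), (t, UNIV)] h x = chain v [(s + t, UNIV)] h x"
proof -
  have "AE x in lborel. (\<integral>\<^sup>+\<omega>. weight (s + t) \<omega> * h (\<omega> (s + t)) \<partial>P x) = chain v [(s, UNIV), (t, UNIV)] h x"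
    using feynman_kac_visits[of "[(s, UNIV), (t, UNIV)]" h] assms by simp
  moreover have "AE x in lborel. (\<integral>\<^sup>+\<omega>. weight (s + t) \<omega> * h (\<omega> (s + t)) \<partial>P x) = chain v [(s + t, UNIV)] h x"
    using feynman_kac_visits[of "[(s + t, UNIV)]" h] assms by simp
  ultimately show ?thesis by eventually_elim simp
qed

end

section \<open>Bridge measures\<close>

lemma visits_nth:
  "visits s L \<omega> \<longleftrightarrow> (\<forall>i<length L. \<omega> (s + duration (take (Suc i) L)) \<in> snd (L ! i))"
proof (induction L arbitrary: s)
  case (Cons a L)
  obtain d A where a: "a = (d, A)" by force
  show ?case unfolding a visits.simps Cons.IH[of "s + d"]
    by (simp add: All_less_Suc2 add.assoc)
qed simp

lemma measurable_chain_param: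
  fixes q :: "real \<Rightarrow> 'a::euclidean_space \<Rightarrow> 'a \<Rightarrow> real" and g :: "'b \<Rightarrow> 'a \<Rightarrow> ennreal"
  assumes q: "\<And>d. 0 < d \<Longrightarrow> (\<lambda>(x, y). q d x y) \<in> borel_measurable (borel \<Otimes>\<^sub>M borel)"
    and "itinerary L" and g: "(\<lambda>(w, x). g w x) \<in> borel_measurable (M \<Otimes>\<^sub>M borel)"
  shows "(\<lambda>(w, x). chain q L (g w) x) \<in> borel_measurable (M \<Otimes>\<^sub>M borel)"
  using assms(2)
proof (induction L)
  case Nil
  then show ?case using g by simp
next
  case (Cons a L)
  obtain d A where a: "a = (d, A)" by force
  have A [measurable]: "A \<in> sets borel" and L: "itinerary L" and d: "0 < d" using Cons.prems by (auto simp: a)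
  have [measurable]: "(\<lambda>z. q d (fst z) (snd z)) \<in> borel_measurable (borel \<Otimes>\<^sub>M borel)"
    using q[OF d] by (simp add: case_prod_beta')
  have IH [measurable]: "(\<lambda>z. chain q L (g (fst z)) (snd z)) \<in> borel_measurable (M \<Otimes>\<^sub>M borel)"
    using Cons.IH[OF L] by (simp add: case_prod_beta')
  have 1: "(\<lambda>z. q d (snd (fst z)) (snd z)) \<in> borel_measurable ((M \<Otimes>\<^sub>M borel) \<Otimes>\<^sub>M lborel)"
    by (rule measurable_compose[of "\<lambda>z. (snd (fst z), snd z)" _ "borel \<Otimes>\<^sub>M borel" "\<lambda>z. q d (fst z) (snd z)", simplified]) measurable
  have 2: "(\<lambda>z. chain q L (g (fst (fst z))) (snd z)) \<in> borel_measurable ((M \<Otimes>\<^sub>M borel) \<Otimes>\<^sub>M lborel)"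
    by (rule measurable_compose[of "\<lambda>z. (fst (fst z), snd z)" _ "M \<Otimes>\<^sub>M borel" "\<lambda>z. chain q L (g (fst z)) (snd z)", simplified]) measurable
  have "(\<lambda>z. \<integral>\<^sup>+y. ennreal (q d (snd z) y) * (indicator A y * chain q L (g (fst z)) y) \<partial>lborel) \<in> borel_measurable (M \<Otimes>\<^sub>M borel)"
  proof (rule lborel.borel_measurable_nn_integral)
    note [measurable] = 1 2
    show "(\<lambda>(z, y). ennreal (q d (snd z) y) * (indicator A y * chain q L (g (fst z)) y)) \<in> borel_measurable ((M \<Otimes>\<^sub>M borel) \<Otimes>\<^sub>M lborel)"
      unfolding case_prod_beta' by measurable
  qed
  then show ?case by (simp add: a case_prod_beta')
qed

lemma chain_integral:
  fixes q :: "real \<Rightarrow> 'a::euclidean_space \<Rightarrow> 'a \<Rightarrow> real"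
  assumes q: "\<And>d. 0 < d \<Longrightarrow> (\<lambda>(x, y). q d x y) \<in> borel_measurable (borel \<Otimes>\<^sub>M borel)"
    and "itinerary L" and r: "0 < r" and h [measurable]: "h \<in> borel_measurable borel"
  shows "(\<integral>\<^sup>+y. h y * chain q L (\<lambda>z. ennreal (q r z y)) x \<partial>lborel) = chain q L (\<lambda>z. \<integral>\<^sup>+y. ennreal (q r z y) * h y \<partial>lborel) x"
  using assms(2)
proof (induction L arbitrary: x)
  case Nil
  then show ?case by (simp add: mult.commute)
next
  case (Cons a L)
  obtain d A where a: "a = (d, A)" by force
  have A [measurable]: "A \<in> sets borel" and L: "itinerary L" and d: "0 < d" using Cons.prems by (auto simp: a)
  have qr: "(\<lambda>(w, x). ennreal (q r x w)) \<in> borel_measurable (borel \<Otimes>\<^sub>M borel)"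
    using measurable_compose[OF measurable_pair_swap' q[OF r]] by (simp add: case_prod_beta')
  have [measurable]: "(\<lambda>(w, x). chain q L (\<lambda>z. ennreal (q r z w)) x) \<in> borel_measurable (borel \<Otimes>\<^sub>M borel)"
    by (rule measurable_chain_param[OF q L qr])
  have [measurable]: "q d x \<in> borel_measurable borel"
    using measurable_compose[OF measurable_Pair1' q[OF d], of x] by simp
  have m: "(\<lambda>z. h (fst z) * (ennreal (q d x (snd z)) * (indicator A (snd z) * chain q L (\<lambda>z'. ennreal (q r z' (fst z))) (snd z)))) \<in> borel_measurable (lborel \<Otimes>\<^sub>M lborel)"
    by measurable
  have "(\<integral>\<^sup>+y. h y * chain q (a # L) (\<lambda>z. ennreal (q r z y)) x \<partial>lborel)
     = (\<integral>\<^sup>+y. \<integral>\<^sup>+z. h y * (ennreal (q d x z) * (indicator A z * chain q L (\<lambda>z. ennreal (q r z y)) z)) \<partial>lborel \<partial>lborel)"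
    by (simp add: a nn_integral_cmult)
  also have "\<dots> = (\<integral>\<^sup>+z. \<integral>\<^sup>+y. h y * (ennreal (q d x z) * (indicator A z * chain q L (\<lambda>z. ennreal (q r z y)) z)) \<partial>lborel \<partial>lborel)"
    using m by (intro lborel_pair.Fubini'[symmetric]) (simp add: case_prod_beta')
  also have "\<dots> = (\<integral>\<^sup>+z. (ennreal (q d x z) * indicator A z) * (\<integral>\<^sup>+y. h y * chain q L (\<lambda>z. ennreal (q r z y)) z \<partial>lborel) \<partial>lborel)"
  proof (rule nn_integral_cong)
    fix z
    have [measurable]: "(\<lambda>y. chain q L (\<lambda>z. ennreal (q r z y)) z) \<in> borel_measurable borel"
      using measurable_compose[OF measurable_Pair2' measurable_chain_param[OF q L qr], of z] by simp
    have "(\<integral>\<^sup>+y. (ennreal (q d x z) * indicator A z) * (h y * chain q L (\<lambda>z. ennreal (q r z y)) z) \<partial>lborel)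
        = (ennreal (q d x z) * indicator A z) * (\<integral>\<^sup>+y. h y * chain q L (\<lambda>z. ennreal (q r z y)) z \<partial>lborel)"
      by (rule nn_integral_cmult) measurable
    then show "(\<integral>\<^sup>+y. h y * (ennreal (q d x z) * (indicator A z * chain q L (\<lambda>z. ennreal (q r z y)) z)) \<partial>lborel)
        = (ennreal (q d x z) * indicator A z) * (\<integral>\<^sup>+y. h y * chain q L (\<lambda>z. ennreal (q r z y)) z \<partial>lborel)"
      by (simp only: ac_simps)
  qed
  also have "\<dots> = chain q (a # L) (\<lambda>z. \<integral>\<^sup>+y. ennreal (q r z y) * h y \<partial>lborel) x"
    unfolding Cons.IH[OF L] by (simp add: a mult.assoc)
  finally show ?case .
qed

context stable
begin

text \<open>The last coordinate of the product integral is peeled off and absorbed into the terminal function.\<close>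

lemma product_integral_chain:
  assumes "itinerary L" and g: "g \<in> borel_measurable borel"
  shows "(\<integral>\<^sup>+z. (\<Prod>i\<in>{1..length L}. indicator (snd (L ! (i - 1))) (z i) *
             ennreal (p (fst (L ! (i - 1))) (z i - (z(0 := x)) (i - 1)))) * g ((z(0 := x)) (length L))
           \<partial>PiM {1..length L} (\<lambda>_. lborel)) = chain pk L g x"
  using assms
proof (induction L arbitrary: g rule: rev_induct)
  case Nil
  interpret finite_product_sigma_finite "\<lambda>_. lborel :: 'a measure" "{} :: nat set" by standard simp
  show ?case by (simp add: PiM_empty nn_integral_count_space_finite)
next
  case (snoc a L)
  obtain d A where a: "a = (d, A)" by force
  have A [measurable]: "A \<in> sets borel" and L: "itinerary L" and d: "0 < d" and [measurable]: "g \<in> borel_measurable borel"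
    using snoc.prems by (auto simp: a)
  interpret product_sigma_finite "\<lambda>_. lborel :: 'a measure" by standard
  let ?n = "length L"
  let ?f = "\<lambda>L i z. indicator (snd (L ! (i - 1))) (z i) * ennreal (p (fst (L ! (i - 1))) (z i - (z(0 := x)) (i - 1)))"
  have len: "length (L @ [a]) = Suc ?n" by simp
  have PiM_eq: "PiM {1..Suc ?n} (\<lambda>_. lborel :: 'a measure) = PiM (insert (Suc ?n) {1..?n}) (\<lambda>_. lborel)"
    by (rule arg_cong[where f = "\<lambda>I. PiM I (\<lambda>_. lborel)"]) auto
  have item: "0 < fst ((L @ [a]) ! (i - 1))" "snd ((L @ [a]) ! (i - 1)) \<in> sets borel" if "i \<in> {1..Suc ?n}" for i
    using snoc.prems(1) nth_mem[of "i - 1" "L @ [a]"] that unfolding itinerary_def by (auto simp: case_prod_beta)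
  have coord: "(\<lambda>z. (z(0 := x)) i) \<in> borel_measurable (PiM {1..Suc ?n} (\<lambda>_. lborel))" if "i \<le> Suc ?n" for i
    using that measurable_component_singleton[of i "{1..Suc ?n}" "\<lambda>_. lborel :: 'a measure"] by (cases "i = 0") auto
  have gk: "chain pk [a] g \<in> borel_measurable borel"
    using snoc.prems by (intro measurable_chain pk_measurable) (auto simp: a)
  have fm: "(\<lambda>z. (\<Prod>i\<in>{1..Suc ?n}. ?f (L @ [a]) i z) * g ((z(0 := x)) (Suc ?n)))
      \<in> borel_measurable (PiM (insert (Suc ?n) {1..?n}) (\<lambda>_. lborel))"
  proof -
    have ins: "insert (Suc ?n) {1..?n} = {1..Suc ?n}" by auto
    have m1: "(\<lambda>z. ?f (L @ [a]) i z) \<in> borel_measurable (PiM {1..Suc ?n} (\<lambda>_. lborel))" if i: "i \<in> {1..Suc ?n}" for i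
    proof -
      have [measurable]: "snd ((L @ [a]) ! (i - 1)) \<in> sets borel" "p (fst ((L @ [a]) ! (i - 1))) \<in> borel_measurable borel"
        using item[OF i] p_measurable by auto
      have [measurable]: "(\<lambda>z. (z(0 := x)) (i - 1)) \<in> borel_measurable (PiM {1..Suc ?n} (\<lambda>_. lborel))"
        "(\<lambda>z. z i) \<in> borel_measurable (PiM {1..Suc ?n} (\<lambda>_. lborel :: 'a measure))"
        using coord[of "i - 1"] coord[of i] i by auto
      show ?thesis by measurable
    qed
    have m2: "(\<lambda>z. g ((z(0 := x)) (Suc ?n))) \<in> borel_measurable (PiM {1..Suc ?n} (\<lambda>_. lborel))"
      by (rule measurable_compose[OF coord]) auto
    show ?thesis unfolding ins by (intro borel_measurable_times_ennreal borel_measurable_prod_ennreal m1 m2)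
  qed
  have "(\<integral>\<^sup>+z. (\<Prod>i\<in>{1..length (L @ [a])}. ?f (L @ [a]) i z) * g ((z(0 := x)) (length (L @ [a])))
           \<partial>PiM {1..length (L @ [a])} (\<lambda>_. lborel))
      = (\<integral>\<^sup>+z. \<integral>\<^sup>+y. (\<Prod>i\<in>{1..Suc ?n}. ?f (L @ [a]) i (z(Suc ?n := y))) * g (((z(Suc ?n := y))(0 := x)) (Suc ?n)) \<partial>lborel
           \<partial>PiM {1..?n} (\<lambda>_. lborel))"
    unfolding len PiM_eq by (rule product_nn_integral_insert[OF _ _ fm]) simp_all
  also have "\<dots> = (\<integral>\<^sup>+z. (\<Prod>i\<in>{1..?n}. ?f L i z) * chain pk [a] g ((z(0 := x)) ?n) \<partial>PiM {1..?n} (\<lambda>_. lborel))"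
  proof (rule nn_integral_cong)
    fix z :: "nat \<Rightarrow> 'a"
    have *: "(\<Prod>i\<in>{1..Suc ?n}. ?f (L @ [a]) i (z(Suc ?n := y))) = (\<Prod>i\<in>{1..?n}. ?f L i z) * (indicator A y * ennreal (pk d ((z(0 := x)) ?n) y))" for y
    proof -
      have "(\<Prod>i\<in>{1..Suc ?n}. ?f (L @ [a]) i (z(Suc ?n := y))) = (\<Prod>i\<in>{1..?n}. ?f (L @ [a]) i (z(Suc ?n := y))) * ?f (L @ [a]) (Suc ?n) (z(Suc ?n := y))"
        by (simp add: atLeastAtMostSuc_conv mult.commute)
      also have "(\<Prod>i\<in>{1..?n}. ?f (L @ [a]) i (z(Suc ?n := y))) = (\<Prod>i\<in>{1..?n}. ?f L i z)"
        by (rule prod.cong) (auto simp: nth_append)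
      also have "?f (L @ [a]) (Suc ?n) (z(Suc ?n := y)) = indicator A y * ennreal (pk d ((z(0 := x)) ?n) y)"
        by (simp add: a pk_def)
      finally show ?thesis .
    qed
    have [measurable]: "pk d w \<in> borel_measurable borel" for w
      using measurable_compose[OF measurable_Pair1' pk_measurable[OF d], of w] by simp
    have "(\<integral>\<^sup>+y. (\<Prod>i\<in>{1..Suc ?n}. ?f (L @ [a]) i (z(Suc ?n := y))) * g (((z(Suc ?n := y))(0 := x)) (Suc ?n)) \<partial>lborel)
        = (\<integral>\<^sup>+y. (\<Prod>i\<in>{1..?n}. ?f L i z) * (ennreal (pk d ((z(0 := x)) ?n) y) * (indicator A y * g y)) \<partial>lborel)"
      unfolding * by (intro nn_integral_cong) (simp add: ac_simps)
    also have "\<dots> = (\<Prod>i\<in>{1..?n}. ?f L i z) * chain pk [a] g ((z(0 := x)) ?n)"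
      by (subst nn_integral_cmult) (auto simp: a)
    finally show "(\<integral>\<^sup>+y. (\<Prod>i\<in>{1..Suc ?n}. ?f (L @ [a]) i (z(Suc ?n := y))) * g (((z(Suc ?n := y))(0 := x)) (Suc ?n)) \<partial>lborel)
        = (\<Prod>i\<in>{1..?n}. ?f L i z) * chain pk [a] g ((z(0 := x)) ?n)" .
  qed
  also have "\<dots> = chain pk L (chain pk [a] g) x" by (rule snoc.IH[OF L gk])
  also have "\<dots> = chain pk (L @ [a]) g x" by (simp only: chain_append)
  finally show ?case .
qed

text \<open>A bridge is a chain whose terminal function is the density of the final step to the prescribed end point.\<close>

lemma bridge_visits:
  assumes N: "bridge_measure p s t x y N" and L: "itinerary L" and t: "s + duration L < t"
  shows "emeasure N {\<omega> \<in> space N. visits s L \<omega>} = chain pk L (\<lambda>z. ennreal (pk (t - s - duration L) z y)) x"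
proof -
  let ?n = "length L"
  define \<tau> where "\<tau> i = (if i \<le> ?n then s + duration (take i L) else t)" for i
  define A where "A i = snd (L ! (i - 1))" for i
  have gap: "\<tau> i - \<tau> (i - 1) = fst (L ! (i - 1))" if "i \<in> {1..?n}" for i
  proof -
    obtain j where j: "i = Suc j" "j < ?n" using \<open>i \<in> _\<close> by (cases i) auto
    then show ?thesis by (simp add: \<tau>_def take_Suc_conv_app_nth)
  qed
  have item: "0 < fst (L ! i)" "snd (L ! i) \<in> sets borel" if "i < ?n" for i
    using L nth_mem[OF that] unfolding itinerary_def by (auto simp: case_prod_beta)
  have last: "\<tau> (Suc ?n) - \<tau> ?n = t - s - duration L" by (simp add: \<tau>_def)
  have r: "0 < t - s - duration L" using t by simp
  have mono: "\<tau> i < \<tau> (Suc i)" if "i \<le> ?n" for i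
  proof (cases "i = ?n")
    case True then show ?thesis using last r by simp
  next
    case False
    then show ?thesis using gap[of "Suc i"] item[of i] that by simp
  qed
  have A: "\<forall>i\<in>{1..?n}. A i \<in> sets borel" using item by (auto simp: A_def)
  have "visits s L \<omega> \<longleftrightarrow> (\<forall>i\<in>{1..?n}. \<omega> (\<tau> i) \<in> A i)" for \<omega>
  proof -
    have "(\<forall>i\<in>{1..?n}. \<omega> (\<tau> i) \<in> A i) \<longleftrightarrow> (\<forall>i<?n. \<omega> (\<tau> (Suc i)) \<in> A (Suc i))"
      by (metis One_nat_def Suc_leI Suc_le_D Suc_le_eq atLeastAtMost_iff le_numeral_extra(4) less_Suc_eq_le not_less_eq zero_less_Suc)
    then show ?thesis unfolding visits_nth[of s L] by (simp add: \<tau>_def A_def)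
  qed
  then have "emeasure N {\<omega> \<in> space N. visits s L \<omega>} = emeasure N {\<omega> \<in> space N. \<forall>i\<in>{1..?n}. \<omega> (\<tau> i) \<in> A i}" by simp
  also have "\<dots> = (\<integral>\<^sup>+z. (\<Prod>i\<in>{1..?n}. indicator (A i) (z i)) *
                ennreal (let z' = z(0 := x, Suc ?n := y) in \<Prod>i\<in>{1..Suc ?n}. p (\<tau> i - \<tau> (i - 1)) (z' i - z' (i - 1)))
             \<partial>PiM {1..?n} (\<lambda>_. lborel))"
  proof -
    have "\<tau> 0 = s \<and> \<tau> (Suc ?n) = t \<and> (\<forall>i\<le>?n. \<tau> i < \<tau> (Suc i)) \<and> (\<forall>i\<in>{1..?n}. A i \<in> sets borel)"
      using mono A by (auto simp: \<tau>_def)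
    then show ?thesis using N unfolding bridge_measure_def by blast
  qed
  also have "\<dots> = (\<integral>\<^sup>+z. (\<Prod>i\<in>{1..?n}. indicator (snd (L ! (i - 1))) (z i) *
             ennreal (p (fst (L ! (i - 1))) (z i - (z(0 := x)) (i - 1)))) * ennreal (pk (t - s - duration L) ((z(0 := x)) ?n) y)
           \<partial>PiM {1..?n} (\<lambda>_. lborel))"
  proof (rule nn_integral_cong)
    fix z :: "nat \<Rightarrow> 'a"
    let ?z = "z(0 := x, Suc ?n := y)"
    have nn: "0 \<le> p (fst (L ! (i - 1))) w" if "i \<in> {1..?n}" for i w
      using item(1)[of "i - 1"] that by (intro p_nonneg) auto
    have "(\<Prod>i\<in>{1..Suc ?n}. p (\<tau> i - \<tau> (i - 1)) (?z i - ?z (i - 1)))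
        = (\<Prod>i\<in>{1..?n}. p (\<tau> i - \<tau> (i - 1)) (?z i - ?z (i - 1))) * p (t - s - duration L) (y - (z(0 := x)) ?n)"
      using last by (simp add: atLeastAtMostSuc_conv mult.commute)
    also have "(\<Prod>i\<in>{1..?n}. p (\<tau> i - \<tau> (i - 1)) (?z i - ?z (i - 1)))
        = (\<Prod>i\<in>{1..?n}. p (fst (L ! (i - 1))) (z i - (z(0 := x)) (i - 1)))"
    proof (rule prod.cong)
      fix i assume i: "i \<in> {1..?n}"
      then have "?z i = z i" "?z (i - 1) = (z(0 := x)) (i - 1)" by auto
      then show "p (\<tau> i - \<tau> (i - 1)) (?z i - ?z (i - 1)) = p (fst (L ! (i - 1))) (z i - (z(0 := x)) (i - 1))"
        using gap[OF i] by simp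
    qed simp
    finally have E: "(\<Prod>i\<in>{1..Suc ?n}. p (\<tau> i - \<tau> (i - 1)) (?z i - ?z (i - 1)))
        = (\<Prod>i\<in>{1..?n}. p (fst (L ! (i - 1))) (z i - (z(0 := x)) (i - 1))) * p (t - s - duration L) (y - (z(0 := x)) ?n)" .
    have "ennreal (\<Prod>i\<in>{1..Suc ?n}. p (\<tau> i - \<tau> (i - 1)) (?z i - ?z (i - 1)))
        = (\<Prod>i\<in>{1..?n}. ennreal (p (fst (L ! (i - 1))) (z i - (z(0 := x)) (i - 1)))) * ennreal (pk (t - s - duration L) ((z(0 := x)) ?n) y)"
      unfolding E pk_def by (subst ennreal_mult) (intro prod_nonneg nn p_nonneg[OF r] prod_ennreal[symmetric] arg_cong2[where f = "(*)"] refl; assumption)+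
    then show "(\<Prod>i\<in>{1..?n}. indicator (A i) (z i)) *
                ennreal (let z' = ?z in \<Prod>i\<in>{1..Suc ?n}. p (\<tau> i - \<tau> (i - 1)) (z' i - z' (i - 1)))
        = (\<Prod>i\<in>{1..?n}. indicator (snd (L ! (i - 1))) (z i) *
             ennreal (p (fst (L ! (i - 1))) (z i - (z(0 := x)) (i - 1)))) * ennreal (pk (t - s - duration L) ((z(0 := x)) ?n) y)"
      by (simp add: Let_def A_def prod.distrib mult.assoc)
  qed
  also have "\<dots> = chain pk L (\<lambda>z. ennreal (pk (t - s - duration L) z y)) x"
  proof (rule product_integral_chain[OF L])
    show "(\<lambda>z. ennreal (pk (t - s - duration L) z y)) \<in> borel_measurable borel"
      using p_measurable[OF r] unfolding pk_def by measurable
  qed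
  finally show ?thesis .
qed

end

locale gibbs_window = feynman_kac_process \<alpha> P p l u \<phi> \<mu>x V
  for \<alpha> and P :: "'a::euclidean_space \<Rightarrow> (real \<Rightarrow> 'a) measure" and p l and u :: "real \<Rightarrow> 'a \<Rightarrow> 'a \<Rightarrow> real"
    and \<phi> \<mu>x V +
  fixes \<nu> :: "real \<Rightarrow> real \<Rightarrow> 'a \<Rightarrow> 'a \<Rightarrow> (real \<Rightarrow> 'a) measure" and T :: real
  assumes bridge: "\<And>s t x y. s < t \<Longrightarrow> bridge_measure p s t x y (\<nu> s t x y)"
    and T: "0 < T"
begin

abbreviation B :: "'a \<Rightarrow> 'a \<Rightarrow> (real \<Rightarrow> 'a) measure" where "B \<equiv> \<nu> (- T) T"

lemma bridge_B: "bridge_measure p (- T) T x y (B x y)"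
  by (rule bridge) (use T in simp)

lemma sets_B: "sets (B x y) = sets (paths {- T..T})"
  using bridge_B by (simp add: bridge_measure_def)

lemma space_B: "space (B x y) = space (paths {- T..T})"
  using sets_eq_imp_space_eq[OF sets_B] .

lemma B_ends: "AE \<omega> in B x y. \<omega> (- T) = x \<and> \<omega> T = y"
  using bridge_B[of x y] unfolding bridge_measure_def by (elim conjE)

lemma measurable_B: "f \<in> borel_measurable (paths {- T..T}) \<Longrightarrow> f \<in> borel_measurable (B x y)"
  by (simp add: measurable_cong_sets[OF sets_B refl])

lemma B_visits:
  assumes "itinerary L" "duration L < 2 * T"
  shows "emeasure (B x y) {\<omega> \<in> space (B x y). visits (- T) L \<omega>}
       = chain pk L (\<lambda>z. ennreal (pk (2 * T - duration L) z y)) x"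
  using bridge_visits[OF bridge_B assms(1), of x y] assms(2) by simp

lemma B_mass: "emeasure (B x y) (space (B x y)) = ennreal (pk (2 * T) x y)"
  using B_visits[of "[]" x y] T by simp

lemma window_cylinder:
  fixes A :: "real \<Rightarrow> 'a set"
  assumes "finite J" "{- T, T} \<subseteq> J" "J \<subseteq> {- T..T}" "\<And>j. A j \<in> sets borel"
  obtains L where "itinerary L" "duration L < 2 * T" "visit_times (- T) L \<subseteq> {- T..<T}"
    "\<And>\<omega>. (\<forall>j\<in>J. \<omega> j \<in> A j) \<longleftrightarrow> \<omega> (- T) \<in> A (- T) \<and> visits (- T) L \<omega> \<and> \<omega> T \<in> A T"
proof -
  obtain L where L: "itinerary L" "visit_times (- T) L = insert (- T) (J \<inter> {- T<..<T})"
      "\<And>\<omega>. visits (- T) L \<omega> \<longleftrightarrow> (\<forall>j\<in>J \<inter> {- T<..<T}. \<omega> j \<in> A j)"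
    by (rule finite_times_itinerary[of "J \<inter> {- T<..<T}" "- T" A]) (use assms in auto)
  have sub: "visit_times (- T) L \<subseteq> {- T..<T}" using L(2) T by auto
  then have "duration L < 2 * T" using times_ends(2)[of "- T" L] by auto
  moreover have "J = {- T, T} \<union> (J \<inter> {- T<..<T})"
  proof
    show "J \<subseteq> {- T, T} \<union> (J \<inter> {- T<..<T})" using assms(3) by (auto simp: less_le)
  qed (use assms(2) in auto)
  then have "(\<forall>j\<in>J. \<omega> j \<in> A j) \<longleftrightarrow> \<omega> (- T) \<in> A (- T) \<and> visits (- T) L \<omega> \<and> \<omega> T \<in> A T" for \<omega>
    unfolding L(3) by (metis (no_types, lifting) Un_iff insert_iff singletonD)
  ultimately show ?thesis using L(1) sub that by blast
qed

lemma B_cylinder: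
  assumes "itinerary L" "duration L < 2 * T" "visit_times (- T) L \<subseteq> {- T..<T}" and C [measurable]: "C \<in> sets borel" "D \<in> sets borel"
  shows "emeasure (B x y) {\<omega> \<in> space (B x y). \<omega> (- T) \<in> C \<and> visits (- T) L \<omega> \<and> \<omega> T \<in> D}
       = indicator C x * (indicator D y * chain pk L (\<lambda>z. ennreal (pk (2 * T - duration L) z y)) x)"
proof -
  have c: "(\<lambda>\<omega>. \<omega> t) \<in> borel_measurable (B x y)" if "t \<in> {- T..T}" for t
    by (rule measurable_coordinate'[OF sets_B that])
  have [measurable]: "(\<lambda>\<omega>. \<omega> (- T)) \<in> borel_measurable (B x y)" "(\<lambda>\<omega>. \<omega> T) \<in> borel_measurable (B x y)"
    using c T by auto
  have [measurable]: "Measurable.pred (B x y) (visits (- T) L)"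
    by (rule pred_visits[where Y = "\<lambda>\<omega>. \<omega>", OF assms(1)]) (use c assms(3) in force)
  have "emeasure (B x y) {\<omega> \<in> space (B x y). \<omega> (- T) \<in> C \<and> visits (- T) L \<omega> \<and> \<omega> T \<in> D}
      = emeasure (B x y) {\<omega> \<in> space (B x y). x \<in> C \<and> y \<in> D \<and> visits (- T) L \<omega>}"
  proof (rule emeasure_eq_AE)
    show "AE \<omega> in B x y. \<omega> \<in> {\<omega> \<in> space (B x y). \<omega> (- T) \<in> C \<and> visits (- T) L \<omega> \<and> \<omega> T \<in> D}
        \<longleftrightarrow> \<omega> \<in> {\<omega> \<in> space (B x y). x \<in> C \<and> y \<in> D \<and> visits (- T) L \<omega>}"
      using B_ends[of x y] by eventually_elim auto
  qed measurable
  also have "\<dots> = indicator C x * (indicator D y * emeasure (B x y) {\<omega> \<in> space (B x y). visits (- T) L \<omega>})"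
    by (auto simp: indicator_def)
  finally show ?thesis unfolding B_visits[OF assms(1,2)] .
qed

text \<open>Bridge measures are normalised to fit into the Giry monad. Where the density vanishes, division by
  zero makes the factor zero, and the bridge measure itself is zero as well.\<close>
definition normalized_bridge :: "'a \<times> 'a \<Rightarrow> (real \<Rightarrow> 'a) measure" where
  "normalized_bridge z = scale_measure (ennreal (1 / pk (2 * T) (fst z) (snd z))) (B (fst z) (snd z))"

lemma pk_2T_nonneg: "0 \<le> pk (2 * T) x y"
  using p_nonneg T by (simp add: pk_def)

lemma pk_2T_measurable [measurable]: "(\<lambda>z. pk (2 * T) (fst z) (snd z)) \<in> borel_measurable (borel \<Otimes>\<^sub>M borel)"
  using pk_measurable[of "2 * T"] T by (simp add: case_prod_beta')

lemma sets_normalized_bridge: "sets (normalized_bridge z) = sets (paths {- T..T})"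
  by (simp add: normalized_bridge_def sets_B)

lemma space_paths_nonempty: "space (paths I :: (real \<Rightarrow> 'a) measure) \<noteq> {}"
proof -
  have "(\<lambda>_\<in>I. 0 :: 'a) \<in> cadlag_on I"
  proof -
    have "((\<lambda>_\<in>I. 0 :: 'a) \<longlongrightarrow> 0) (at t within I \<inter> S)" for t S
      by (rule tendsto_relocate[where c = 0 and e = 1 and t = t and t' = t and J = "I \<inter> S" and J' = "I \<inter> S", OF tendsto_const]) auto
    then show ?thesis by (auto simp: cadlag_on_def)
  qed
  then have "(\<lambda>_\<in>I. 0 :: 'a) \<in> space (paths I)" by (simp add: space_paths)
  then show ?thesis by blast
qed

lemma normalized_bridge_subprob: "subprob_space (normalized_bridge z)"
proof (rule subprob_spaceI)
  have sp: "space (normalized_bridge z) = space (B (fst z) (snd z))"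
    by (rule sets_eq_imp_space_eq) (simp add: normalized_bridge_def)
  have "emeasure (normalized_bridge z) (space (normalized_bridge z)) = ennreal (1 / pk (2 * T) (fst z) (snd z)) * ennreal (pk (2 * T) (fst z) (snd z))"
    unfolding sp by (simp add: normalized_bridge_def B_mass)
  also have "\<dots> \<le> 1" using pk_2T_nonneg[of "fst z" "snd z"] by (simp add: ennreal_mult'[symmetric])
  finally show "emeasure (normalized_bridge z) (space (normalized_bridge z)) \<le> 1" .
  show "space (normalized_bridge z) \<noteq> {}" unfolding sp space_B by (rule space_paths_nonempty)
qed

lemma normalized_bridge_kernel: "normalized_bridge \<in> measurable (borel \<Otimes>\<^sub>M borel) (subprob_algebra (paths {- T..T}))"
proof (rule paths_kernel_measurable[where J\<^sub>0 = "{- T, T}"])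
  fix J :: "real set" and A :: "real \<Rightarrow> 'a set"
  assume J: "finite J" "{- T, T} \<subseteq> J" "J \<subseteq> {- T..T}" and A: "\<And>j. A j \<in> sets borel"
  obtain L where L: "itinerary L" "duration L < 2 * T" "visit_times (- T) L \<subseteq> {- T..<T}"
    and eq: "\<And>\<omega>. (\<forall>j\<in>J. \<omega> j \<in> A j) \<longleftrightarrow> \<omega> (- T) \<in> A (- T) \<and> visits (- T) L \<omega> \<and> \<omega> T \<in> A T"
    by (rule window_cylinder[OF J, of A, OF A]) blast
  have r: "0 < 2 * T - duration L" using L by simp
  have "(\<lambda>(w, z). ennreal (pk (2 * T - duration L) z w)) \<in> borel_measurable (borel \<Otimes>\<^sub>M borel)"
    using measurable_compose[OF measurable_pair_swap' pk_measurable[OF r]] by (simp add: case_prod_beta')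
  from measurable_chain_param[OF pk_measurable L(1) this]
  have "(\<lambda>(w, x). chain pk L (\<lambda>z. ennreal (pk (2 * T - duration L) z w)) x) \<in> borel_measurable (borel \<Otimes>\<^sub>M borel)"
    by simp
  from measurable_compose[OF measurable_pair_swap' this]
  have [measurable]: "(\<lambda>z. chain pk L (\<lambda>z'. ennreal (pk (2 * T - duration L) z' (snd z))) (fst z)) \<in> borel_measurable (borel \<Otimes>\<^sub>M borel)"
    by (simp add: case_prod_beta')
  have cyl: "cylinder {- T..T} J A = {\<omega> \<in> space (B x y). \<omega> (- T) \<in> A (- T) \<and> visits (- T) L \<omega> \<and> \<omega> T \<in> A T}" for x y
    by (simp add: cylinder_def eq space_B)
  have "emeasure (normalized_bridge z) (cylinder {- T..T} J A) = ennreal (1 / pk (2 * T) (fst z) (snd z)) *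
     (indicator (A (- T)) (fst z) * (indicator (A T) (snd z) * chain pk L (\<lambda>z'. ennreal (pk (2 * T - duration L) z' (snd z))) (fst z)))" for z
    using B_cylinder[OF L A[of "- T"] A[of T], of "fst z" "snd z"] unfolding cyl[of "fst z" "snd z", symmetric] by (simp add: normalized_bridge_def)
  moreover note A[measurable]
  ultimately show "(\<lambda>z. emeasure (normalized_bridge z) (cylinder {- T..T} J A)) \<in> borel_measurable (borel \<Otimes>\<^sub>M borel)"
    by (simp only:) measurable
qed (use T in \<open>auto simp: sets_normalized_bridge normalized_bridge_subprob\<close>)

lemma nn_integral_B:
  assumes f: "f \<in> borel_measurable (paths {- T..T})"
  shows "(\<integral>\<^sup>+\<omega>. f \<omega> \<partial>B x y) = ennreal (pk (2 * T) x y) * (\<integral>\<^sup>+\<omega>. f \<omega> \<partial>normalized_bridge (x, y))"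
proof -
  have *: "(\<integral>\<^sup>+\<omega>. f \<omega> \<partial>normalized_bridge (x, y)) = ennreal (1 / pk (2 * T) x y) * (\<integral>\<^sup>+\<omega>. f \<omega> \<partial>B x y)"
    using measurable_B[OF f] by (simp add: normalized_bridge_def nn_integral_scale_measure)
  show ?thesis
  proof (cases "pk (2 * T) x y = 0")
    case True
    then have "emeasure (B x y) (space (B x y)) = 0" by (simp add: B_mass)
    then have "AE \<omega> in B x y. f \<omega> = 0" by (auto simp: emeasure_0_AE)
    then have "(\<integral>\<^sup>+\<omega>. f \<omega> \<partial>B x y) = 0" by (simp add: nn_integral_0_iff_AE measurable_B[OF f])
    with True show ?thesis by simp
  next
    case False
    then have "ennreal (pk (2 * T) x y) * ennreal (1 / pk (2 * T) x y) = 1"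
      using pk_2T_nonneg[of x y] by (simp add: ennreal_mult'[symmetric])
    then show ?thesis unfolding * by (simp add: mult.assoc[symmetric])
  qed
qed

lemma B_integral_measurable:
  assumes f: "(\<lambda>(w, \<omega>). f w \<omega>) \<in> borel_measurable (M \<Otimes>\<^sub>M paths {- T..T})"
    and [measurable]: "a \<in> borel_measurable M" "b \<in> borel_measurable M"
  shows "(\<lambda>w. \<integral>\<^sup>+\<omega>. f w \<omega> \<partial>B (a w) (b w)) \<in> borel_measurable M"
proof -
  have ab: "(\<lambda>w. (a w, b w)) \<in> measurable M (borel \<Otimes>\<^sub>M borel)" by measurable
  have [measurable]: "(\<lambda>w. \<integral>\<^sup>+\<omega>. f w \<omega> \<partial>normalized_bridge (a w, b w)) \<in> borel_measurable M"
    by (rule nn_integral_measurable_subprob_algebra2[OF f measurable_compose[OF ab normalized_bridge_kernel]])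
  have [measurable]: "(\<lambda>w. pk (2 * T) (a w) (b w)) \<in> borel_measurable M"
    using measurable_compose[OF ab pk_2T_measurable] by simp
  have "(\<lambda>w. ennreal (pk (2 * T) (a w) (b w)) * (\<integral>\<^sup>+\<omega>. f w \<omega> \<partial>normalized_bridge (a w, b w))) \<in> borel_measurable M" by measurable
  moreover have "(\<integral>\<^sup>+\<omega>. f w \<omega> \<partial>B (a w) (b w)) = ennreal (pk (2 * T) (a w) (b w)) * (\<integral>\<^sup>+\<omega>. f w \<omega> \<partial>normalized_bridge (a w, b w))"
    if "w \<in> space M" for w
    using measurable_compose[OF measurable_Pair1'[OF that] f] by (intro nn_integral_B) simp
  ultimately show ?thesis by (subst measurable_cong) auto
qed

section \<open>Disintegration of the stable process into bridges\<close>

definition shift :: "(real \<Rightarrow> 'a) \<Rightarrow> real \<Rightarrow> 'a" where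
  "shift \<omega> = (\<lambda>t\<in>{- T..T}. \<omega> (t + T))"

lemma shift_space:
  assumes "\<omega> \<in> space (paths {0..})" shows "shift \<omega> \<in> space (paths {- T..T})"
proof -
  have w: "\<omega> \<in> cadlag_on {0..}" using assms by (simp add: space_paths)
  have "shift \<omega> \<in> cadlag_on {- T..T}"
    unfolding cadlag_on_def
  proof (intro CollectI ballI conjI)
    fix t assume t: "t \<in> {- T..T}"
    then have t': "t + T \<in> {0..}" by simp
    have "(shift \<omega> \<longlongrightarrow> \<omega> (t + T)) (at t within {- T..T} \<inter> {t<..})"
      by (rule tendsto_relocate[where c = T and e = 1, OF cadlag_onD(1)[OF w t']]) (auto simp: shift_def)
    then show "(shift \<omega> \<longlongrightarrow> shift \<omega> t) (at t within {- T..T} \<inter> {t<..})" using t by (simp add: shift_def)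
    obtain m where m: "(\<omega> \<longlongrightarrow> m) (at (t + T) within {0..} \<inter> {..<t + T})" using cadlag_onD(2)[OF w t'] by blast
    have "(shift \<omega> \<longlongrightarrow> m) (at t within {- T..T} \<inter> {..<t})"
      by (rule tendsto_relocate[where c = T and e = 1, OF m]) (auto simp: shift_def)
    then show "\<exists>m. (shift \<omega> \<longlongrightarrow> m) (at t within {- T..T} \<inter> {..<t})" by blast
  qed
  then show ?thesis by (simp add: space_paths shift_def)
qed

lemma shift_measurable: "shift \<in> measurable (P x) (paths {- T..T})"
proof (rule measurable_pathsI)
  fix t assume t: "t \<in> {- T..T}"
  then have "(\<lambda>\<omega>. \<omega> (t + T)) \<in> borel_measurable (P x)"
    by (intro measurable_coordinate'[OF sets_P]) auto
  then show "(\<lambda>\<omega>. shift \<omega> t) \<in> borel_measurable (P x)" using t by (simp add: shift_def)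
qed (simp add: shift_space space_P)

lemma normalized_bridge_kernel1: "(\<lambda>y. normalized_bridge (x, y)) \<in> measurable borel (subprob_algebra (paths {- T..T}))"
  using measurable_compose[OF measurable_Pair1' normalized_bridge_kernel, of x] by simp

text \<open>Choosing the end point from the transition density and then a normalised bridge reproduces the stable law: on a
  cylinder, the normalisation cancels and integrating the terminal step of the bridge over the end point gives the
  last step of the free chain.\<close>

lemma distr_shift:
  "distr (P x) (paths {- T..T}) shift = density lborel (\<lambda>y. ennreal (pk (2 * T) x y)) \<bind> (\<lambda>y. normalized_bridge (x, y))"
proof (rule paths_measure_eqI[where I = "{- T..T}" and J\<^sub>0 = "{- T, T}"])
  let ?M = "distr (P x) (paths {- T..T}) shift" and ?D = "density lborel (\<lambda>y. ennreal (pk (2 * T) x y))"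
  have K: "(\<lambda>y. normalized_bridge (x, y)) \<in> measurable ?D (subprob_algebra (paths {- T..T}))"
    using normalized_bridge_kernel1 by (simp cong: measurable_cong_sets)
  have ne: "space ?D \<noteq> {}" by simp
  have [measurable]: "pk (2 * T) x \<in> borel_measurable borel"
    using measurable_compose[OF measurable_Pair1' pk_measurable[of "2 * T"], of x] T by simp
  interpret prob_space "P x" by (rule prob_space_P)
  interpret M: prob_space ?M by (rule prob_space_distr[OF shift_measurable])
  show "sets ?M = sets (paths {- T..T})" by simp
  show "sets (?D \<bind> (\<lambda>y. normalized_bridge (x, y))) = sets (paths {- T..T})" by (rule sets_bind[OF _ ne]) (simp add: sets_normalized_bridge)
  show "finite {- T, T}" "{- T, T} \<subseteq> {- T..T}" using T by auto
  show "emeasure ?M (space (paths {- T..T})) \<noteq> \<infinity>" by (simp add: M.emeasure_eq_measure)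
  fix J :: "real set" and A :: "real \<Rightarrow> 'a set"
  assume J: "finite J" "{- T, T} \<subseteq> J" "J \<subseteq> {- T..T}" and A: "\<And>j. A j \<in> sets borel"
  obtain L where L: "itinerary L" "duration L < 2 * T" "visit_times (- T) L \<subseteq> {- T..<T}"
    and eq: "\<And>\<omega>. (\<forall>j\<in>J. \<omega> j \<in> A j) \<longleftrightarrow> \<omega> (- T) \<in> A (- T) \<and> visits (- T) L \<omega> \<and> \<omega> T \<in> A T"
    by (rule window_cylinder[OF J, of A, OF A]) blast
  let ?r = "2 * T - duration L"
  let ?L = "L @ [(?r, A T)]"
  have r: "0 < ?r" using L by simp
  have it: "itinerary ?L" using L r A by simp
  note A [measurable]
  have cyl: "cylinder {- T..T} J A \<in> sets (paths {- T..T})" by (rule sets_cylinder[OF J(1,3) A])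
  have shv: "visits (- T) L (shift \<omega>) \<longleftrightarrow> visits 0 L \<omega>" for \<omega>
  proof -
    have "visits (- T) L (shift \<omega>) \<longleftrightarrow> visits (- T) L (\<lambda>t. \<omega> (t + T))"
      by (rule visits_cong[OF _ L(1)]) (use L(3) in \<open>force simp: shift_def\<close>)
    then show ?thesis by (simp add: visits_shift)
  qed
  have sh: "shift \<omega> \<in> cylinder {- T..T} J A \<longleftrightarrow> \<omega> 0 \<in> A (- T) \<and> visits 0 ?L \<omega>" if "\<omega> \<in> space (P x)" for \<omega>
    using shift_space[of \<omega>] that T unfolding cylinder_def eq shv mem_Collect_eq visits_append
    by (simp add: space_P) (simp add: shift_def)
  have "emeasure ?M (cylinder {- T..T} J A) = (\<integral>\<^sup>+\<omega>. indicator (cylinder {- T..T} J A) \<omega> \<partial>?M)"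
    using cyl by (intro nn_integral_indicator[symmetric]) simp
  also have "\<dots> = (\<integral>\<^sup>+\<omega>. indicator (cylinder {- T..T} J A) (shift \<omega>) \<partial>P x)"
    using cyl by (intro nn_integral_distr[OF shift_measurable]) simp
  also have "\<dots> = (\<integral>\<^sup>+\<omega>. indicator (A (- T)) (\<omega> 0) * indicator {\<omega>. visits 0 ?L \<omega>} \<omega> \<partial>P x)"
    by (intro nn_integral_cong) (simp add: sh indicator_def)
  also have "\<dots> = indicator (A (- T)) x * (\<integral>\<^sup>+\<omega>. indicator {\<omega>. visits 0 ?L \<omega>} \<omega> \<partial>P x)"
  proof (rule nn_integral_P_start[OF _ A])
    note [measurable] = pred_visits_paths[OF it]
    show "(\<lambda>\<omega>. indicator {\<omega>. visits 0 ?L \<omega>} \<omega>) \<in> borel_measurable (paths {0..})" by measurable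
  qed
  also have "(\<integral>\<^sup>+\<omega>. indicator {\<omega>. visits 0 ?L \<omega>} \<omega> \<partial>P x) = chain pk ?L (\<lambda>_. 1) x"
    using P_visits[OF it, of "\<lambda>_. 1" x] by simp
  also have "\<dots> = chain pk L (\<lambda>z. \<integral>\<^sup>+y. ennreal (pk ?r z y) * indicator (A T) y \<partial>lborel) x"
  proof -
    have "chain pk [(?r, A T)] (\<lambda>_. 1) = (\<lambda>z. \<integral>\<^sup>+y. ennreal (pk ?r z y) * indicator (A T) y \<partial>lborel)"
      by (rule ext) simp
    then show ?thesis by (simp only: chain_append)
  qed
  also have "\<dots> = (\<integral>\<^sup>+y. indicator (A T) y * chain pk L (\<lambda>z. ennreal (pk ?r z y)) x \<partial>lborel)"
    by (rule chain_integral[OF pk_measurable L(1) r, symmetric]) auto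
  finally have 1: "emeasure ?M (cylinder {- T..T} J A)
      = indicator (A (- T)) x * (\<integral>\<^sup>+y. indicator (A T) y * chain pk L (\<lambda>z. ennreal (pk ?r z y)) x \<partial>lborel)" .
  have "(\<lambda>(w, z). ennreal (pk ?r z w)) \<in> borel_measurable (borel \<Otimes>\<^sub>M borel)"
    using measurable_compose[OF measurable_pair_swap' pk_measurable[OF r]] by (simp add: case_prod_beta')
  from measurable_compose[OF measurable_Pair2' measurable_chain_param[OF pk_measurable L(1) this], of x]
  have [measurable]: "(\<lambda>y. chain pk L (\<lambda>z. ennreal (pk ?r z y)) x) \<in> borel_measurable borel" by simp
  have "emeasure (?D \<bind> (\<lambda>y. normalized_bridge (x, y))) (cylinder {- T..T} J A) = (\<integral>\<^sup>+y. emeasure (normalized_bridge (x, y)) (cylinder {- T..T} J A) \<partial>?D)"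
    by (rule emeasure_bind[OF ne K cyl])
  also have "\<dots> = (\<integral>\<^sup>+y. ennreal (pk (2 * T) x y) * emeasure (normalized_bridge (x, y)) (cylinder {- T..T} J A) \<partial>lborel)"
  proof (rule nn_integral_density)
    show "(\<lambda>y. emeasure (normalized_bridge (x, y)) (cylinder {- T..T} J A)) \<in> borel_measurable lborel"
      using measurable_emeasure_kernel[OF normalized_bridge_kernel1 cyl, of x] by simp
  qed measurable
  also have "\<dots> = (\<integral>\<^sup>+y. indicator (A (- T)) x * (indicator (A T) y * chain pk L (\<lambda>z. ennreal (pk ?r z y)) x) \<partial>lborel)"
  proof (rule nn_integral_cong)
    fix y
    have "ennreal (pk (2 * T) x y) * emeasure (normalized_bridge (x, y)) (cylinder {- T..T} J A) = emeasure (B x y) (cylinder {- T..T} J A)"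
      using nn_integral_B[of "indicator (cylinder {- T..T} J A)" x y] cyl by (simp add: sets_B sets_normalized_bridge)
    also have "\<dots> = indicator (A (- T)) x * (indicator (A T) y * chain pk L (\<lambda>z. ennreal (pk ?r z y)) x)"
    proof -
      have c: "cylinder {- T..T} J A = {\<omega> \<in> space (B x y). \<omega> (- T) \<in> A (- T) \<and> visits (- T) L \<omega> \<and> \<omega> T \<in> A T}"
        by (simp add: cylinder_def eq space_B)
      show ?thesis unfolding c by (rule B_cylinder[OF L A A])
    qed
    finally show "ennreal (pk (2 * T) x y) * emeasure (normalized_bridge (x, y)) (cylinder {- T..T} J A)
        = indicator (A (- T)) x * (indicator (A T) y * chain pk L (\<lambda>z. ennreal (pk ?r z y)) x)" .
  qed
  also have "\<dots> = indicator (A (- T)) x * (\<integral>\<^sup>+y. indicator (A T) y * chain pk L (\<lambda>z. ennreal (pk ?r z y)) x \<partial>lborel)"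
    by (rule nn_integral_cmult) measurable
  finally show "emeasure ?M (cylinder {- T..T} J A) = emeasure (?D \<bind> (\<lambda>y. normalized_bridge (x, y))) (cylinder {- T..T} J A)"
    using 1 by simp
qed

text \<open>A factor \<open>h\<close> of the end point can be pulled out of the bridge integral because the bridge ends at \<open>y\<close> almost
  surely.\<close>

lemma bridge_disintegration:
  assumes f [measurable]: "f \<in> borel_measurable (paths {- T..T})" and h [measurable]: "h \<in> borel_measurable borel"
  shows "(\<integral>\<^sup>+y. h y * (\<integral>\<^sup>+\<omega>. f \<omega> \<partial>B x y) \<partial>lborel) = (\<integral>\<^sup>+\<omega>. f (shift \<omega>) * h (\<omega> (2 * T)) \<partial>P x)"
proof -
  let ?D = "density lborel (\<lambda>y. ennreal (pk (2 * T) x y))"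
  have K: "(\<lambda>y. normalized_bridge (x, y)) \<in> measurable ?D (subprob_algebra (paths {- T..T}))"
    using normalized_bridge_kernel1 by (simp cong: measurable_cong_sets)
  have [measurable]: "pk (2 * T) x \<in> borel_measurable borel"
    using measurable_compose[OF measurable_Pair1' pk_measurable[of "2 * T"], of x] T by simp
  have [measurable]: "(\<lambda>\<omega>. \<omega> T) \<in> borel_measurable (paths {- T..T} :: (real \<Rightarrow> 'a) measure)"
    using T by (intro measurable_coordinate) auto
  have g: "(\<lambda>\<omega>. f \<omega> * h (\<omega> T)) \<in> borel_measurable (paths {- T..T})" by measurable
  have "(\<integral>\<^sup>+\<omega>. f (shift \<omega>) * h (\<omega> (2 * T)) \<partial>P x) = (\<integral>\<^sup>+\<omega>. f \<omega> * h (\<omega> T) \<partial>distr (P x) (paths {- T..T}) shift)"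
    using T g by (subst nn_integral_distr[OF shift_measurable]) (auto simp: shift_def)
  also have "\<dots> = (\<integral>\<^sup>+y. \<integral>\<^sup>+\<omega>. f \<omega> * h (\<omega> T) \<partial>normalized_bridge (x, y) \<partial>?D)"
    unfolding distr_shift by (rule nn_integral_bind[OF g K])
  also have "\<dots> = (\<integral>\<^sup>+y. ennreal (pk (2 * T) x y) * (\<integral>\<^sup>+\<omega>. f \<omega> * h (\<omega> T) \<partial>normalized_bridge (x, y)) \<partial>lborel)"
    using measurable_compose[OF normalized_bridge_kernel1 nn_integral_measurable_subprob_algebra[OF g], of x]
    by (intro nn_integral_density) simp_all
  also have "\<dots> = (\<integral>\<^sup>+y. h y * (\<integral>\<^sup>+\<omega>. f \<omega> \<partial>B x y) \<partial>lborel)"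
  proof (rule nn_integral_cong)
    fix y
    have "ennreal (pk (2 * T) x y) * (\<integral>\<^sup>+\<omega>. f \<omega> * h (\<omega> T) \<partial>normalized_bridge (x, y)) = (\<integral>\<^sup>+\<omega>. f \<omega> * h (\<omega> T) \<partial>B x y)"
      by (rule nn_integral_B[OF g, symmetric])
    also have "\<dots> = (\<integral>\<^sup>+\<omega>. h y * f \<omega> \<partial>B x y)"
    proof (rule nn_integral_cong_AE)
      show "AE \<omega> in B x y. f \<omega> * h (\<omega> T) = h y * f \<omega>"
        using B_ends[of x y] by eventually_elim (simp add: mult.commute)
    qed
    also have "\<dots> = h y * (\<integral>\<^sup>+\<omega>. f \<omega> \<partial>B x y)"
      by (rule nn_integral_cmult[OF measurable_B[OF f]])
    finally show "ennreal (pk (2 * T) x y) * (\<integral>\<^sup>+\<omega>. f \<omega> * h (\<omega> T) \<partial>normalized_bridge (x, y)) = h y * (\<integral>\<^sup>+\<omega>. f \<omega> \<partial>B x y)" .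
  qed
  finally show ?thesis ..
qed

end

section \<open>Tilted bridges\<close>

lemma finite_measure_pair_eqI:
  assumes "sets M = sets (A \<Otimes>\<^sub>M B)" "sets N = sets (A \<Otimes>\<^sub>M B)"
    and fin: "emeasure M (space A \<times> space B) \<noteq> \<infinity>"
    and eq: "\<And>a b. a \<in> sets A \<Longrightarrow> b \<in> sets B \<Longrightarrow> emeasure M (a \<times> b) = emeasure N (a \<times> b)"
  shows "M = N"
proof (rule measure_eqI_generator_eq[where A = "\<lambda>_. space A \<times> space B"])
  show "Int_stable {a \<times> b | a b. a \<in> sets A \<and> b \<in> sets B}" by (rule Int_stable_pair_measure_generator)
  show "{a \<times> b | a b. a \<in> sets A \<and> b \<in> sets B} \<subseteq> Pow (space A \<times> space B)"
    by (rule pair_measure_closed)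
qed (use assms in \<open>auto simp: sets_pair_measure\<close>)

context gibbs_window
begin

text \<open>The exponential factor of \<open>v\<close> is included so that the masses of tilted bridges are chains of \<open>v\<close>.\<close>
definition W :: "(real \<Rightarrow> 'a) \<Rightarrow> ennreal" where
  "W \<omega> = ennreal (exp (l * (2 * T) - action V (- T) T \<omega>))"

lemma W_measurable [measurable]: "W \<in> borel_measurable (paths {- T..T})"
proof -
  have [measurable]: "action V (- T) T \<in> borel_measurable (paths {- T..T} :: (real \<Rightarrow> 'a) measure)"
    by (rule measurable_action) auto
  show ?thesis unfolding W_def[abs_def] by measurable
qed

lemma W_shift: "W (shift \<omega>) = weight (2 * T) \<omega>"
proof -
  have "action V (- T) T (shift \<omega>) = action V (- T) T (\<lambda>s. \<omega> (s + T))"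
    by (rule action_cong) (auto simp: shift_def)
  also have "\<dots> = action V (- T + T) (T + T) \<omega>" by (rule action_shift[symmetric])
  finally show ?thesis by (simp add: W_def weight_def)
qed

definition Z :: "'a \<Rightarrow> 'a \<Rightarrow> ennreal" where "Z x y = (\<integral>\<^sup>+\<omega>. W \<omega> \<partial>B x y)"

definition G :: "(real \<times> 'a set) list \<Rightarrow> 'a \<Rightarrow> 'a \<Rightarrow> ennreal" where
  "G L x y = (\<integral>\<^sup>+\<omega>. W \<omega> * indicator {\<omega>. visits (- T) L \<omega>} \<omega> \<partial>B x y)"

lemma G_Nil: "G [] x y = Z x y" by (simp add: G_def Z_def)

lemma visits_window_measurable:
  assumes "itinerary L" "visit_times (- T) L \<subseteq> {- T..<T}"
  shows "(\<lambda>\<omega>. W \<omega> * indicator {\<omega>. visits (- T) L \<omega>} \<omega>) \<in> borel_measurable (paths {- T..T})"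
proof -
  have [measurable]: "Measurable.pred (paths {- T..T}) (visits (- T) L :: (real \<Rightarrow> 'a) \<Rightarrow> bool)"
    by (rule pred_visits[where Y = "\<lambda>\<omega>. \<omega>", OF assms(1)]) (use assms(2) in \<open>force intro: measurable_coordinate\<close>)
  show ?thesis by measurable
qed

lemma G_measurable:
  assumes "itinerary L" "visit_times (- T) L \<subseteq> {- T..<T}"
  shows "(\<lambda>z. G L (fst z) (snd z)) \<in> borel_measurable (borel \<Otimes>\<^sub>M borel)"
  unfolding G_def
proof (rule B_integral_measurable)
  show "(\<lambda>(w, \<omega>). W \<omega> * indicator {\<omega>. visits (- T) L \<omega>} \<omega>) \<in> borel_measurable ((borel \<Otimes>\<^sub>M borel) \<Otimes>\<^sub>M paths {- T..T})"
    using measurable_compose[OF measurable_snd visits_window_measurable[OF assms]] by (simp add: case_prod_beta')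
qed measurable

lemma Z_measurable [measurable]: "(\<lambda>z. Z (fst z) (snd z)) \<in> borel_measurable (borel \<Otimes>\<^sub>M borel)"
  using G_measurable[of "[]"] T by (simp add: G_Nil)

text \<open>The Feynman-Kac formula for the free process, disintegrated into bridges.\<close>

lemma G_integral_AE:
  assumes L: "itinerary L" "duration L < 2 * T" "visit_times (- T) L \<subseteq> {- T..<T}"
    and h [measurable]: "h \<in> borel_measurable borel"
  shows "AE x in lborel. (\<integral>\<^sup>+y. h y * G L x y \<partial>lborel) = chain v (L @ [(2 * T - duration L, UNIV)]) h x"
proof -
  let ?L = "L @ [(2 * T - duration L, UNIV)]"
  have it: "itinerary ?L" and d: "duration ?L = 2 * T" using L by auto
  have shv: "visits (- T) L (shift \<omega>) \<longleftrightarrow> visits 0 ?L \<omega>" for \<omega>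
  proof -
    have "visits (- T) L (shift \<omega>) \<longleftrightarrow> visits (- T) L (\<lambda>t. \<omega> (t + T))"
      by (rule visits_cong[OF _ L(1)]) (use L(3) in \<open>force simp: shift_def\<close>)
    then show ?thesis by (simp add: visits_shift visits_append)
  qed
  have "(\<integral>\<^sup>+y. h y * G L x y \<partial>lborel)
      = (\<integral>\<^sup>+\<omega>. weight (duration ?L) \<omega> * (indicator {\<omega>. visits 0 ?L \<omega>} \<omega> * h (\<omega> (duration ?L))) \<partial>P x)" for x
    unfolding G_def bridge_disintegration[OF visits_window_measurable[OF L(1,3)] h] d
    by (intro nn_integral_cong) (simp add: W_shift shv indicator_def)
  then show ?thesis using feynman_kac_visits[OF it h] by simp
qed

lemma v_2T_measurable [measurable]: "(\<lambda>z. v (2 * T) (fst z) (snd z)) \<in> borel_measurable (borel \<Otimes>\<^sub>M borel)"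
  using v_measurable[of "2 * T"] T by (simp add: case_prod_beta')

lemma v_2T_pos: "0 < v (2 * T) x y" using v_pos T by simp

lemma measurable_lborel_pair:
  "f \<in> borel_measurable (borel \<Otimes>\<^sub>M borel) \<Longrightarrow> f \<in> borel_measurable ((lborel :: 'a measure) \<Otimes>\<^sub>M (lborel :: 'a measure))"
  using measurable_cong_sets[OF sets_pair_measure_cong[OF sets_lborel sets_lborel] refl] by blast

lemma nn_integral_lborel_pair:
  assumes "f \<in> borel_measurable (borel \<Otimes>\<^sub>M borel)"
  shows "(\<integral>\<^sup>+z. f z \<partial>((lborel :: 'a measure) \<Otimes>\<^sub>M (lborel :: 'a measure))) = (\<integral>\<^sup>+x. \<integral>\<^sup>+y. f (x, y) \<partial>lborel \<partial>lborel)"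
  by (rule lborel.nn_integral_fst[symmetric, OF measurable_lborel_pair[OF assms]])

text \<open>Both sides have the same integral against all products of functions of \<open>x\<close> and of \<open>y\<close>. Weighting with the
  ground state turns them into densities of finite measures, for which agreement on rectangles implies equality: the
  total mass is the integral of the squared ground state.\<close>

lemma Z_eq_v: "AE z in lborel \<Otimes>\<^sub>M lborel. Z (fst z) (snd z) = ennreal (v (2 * T) (fst z) (snd z))"
proof -
  let ?w = "\<lambda>z. ennreal (\<phi> (fst z)) * ennreal (\<phi> (snd z))"
  let ?LL = "(lborel :: 'a measure) \<Otimes>\<^sub>M (lborel :: 'a measure)"
  have w [measurable]: "?w \<in> borel_measurable (borel \<Otimes>\<^sub>M borel)" by measurable
  have emb: "emeasure (density ?LL (\<lambda>z. ?w z * f z)) (C \<times> D)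
      = (\<integral>\<^sup>+x. ennreal (\<phi> x) * indicator C x * (\<integral>\<^sup>+y. (ennreal (\<phi> y) * indicator D y) * f (x, y) \<partial>lborel) \<partial>lborel)"
    if f [measurable]: "f \<in> borel_measurable (borel \<Otimes>\<^sub>M borel)" and [measurable]: "C \<in> sets borel" "D \<in> sets borel" for f C D
  proof -
    have wf: "(\<lambda>z. ?w z * f z) \<in> borel_measurable (borel \<Otimes>\<^sub>M borel)" by measurable
    have "emeasure (density ?LL (\<lambda>z. ?w z * f z)) (C \<times> D) = (\<integral>\<^sup>+z. ?w z * f z * indicator (C \<times> D) z \<partial>?LL)"
      by (rule emeasure_density[OF measurable_lborel_pair[OF wf]]) auto
    also have "\<dots> = (\<integral>\<^sup>+x. \<integral>\<^sup>+y. ?w (x, y) * f (x, y) * indicator (C \<times> D) (x, y) \<partial>lborel \<partial>lborel)"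
      by (rule nn_integral_lborel_pair) measurable
    also have "\<dots> = (\<integral>\<^sup>+x. ennreal (\<phi> x) * indicator C x * (\<integral>\<^sup>+y. (ennreal (\<phi> y) * indicator D y) * f (x, y) \<partial>lborel) \<partial>lborel)"
    proof (rule nn_integral_cong)
      fix x
      have [measurable]: "(\<lambda>y. f (x, y)) \<in> borel_measurable borel" by measurable
      have "(\<integral>\<^sup>+y. (ennreal (\<phi> x) * indicator C x) * ((ennreal (\<phi> y) * indicator D y) * f (x, y)) \<partial>lborel)
          = (ennreal (\<phi> x) * indicator C x) * (\<integral>\<^sup>+y. (ennreal (\<phi> y) * indicator D y) * f (x, y) \<partial>lborel)"
        by (rule nn_integral_cmult) measurable
      moreover have "?w (x, y) * f (x, y) * indicator (C \<times> D) (x, y) = (ennreal (\<phi> x) * indicator C x) * ((ennreal (\<phi> y) * indicator D y) * f (x, y))" for y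
        by (auto simp: indicator_def mult.assoc)
      ultimately show "(\<integral>\<^sup>+y. ?w (x, y) * f (x, y) * indicator (C \<times> D) (x, y) \<partial>lborel)
          = ennreal (\<phi> x) * indicator C x * (\<integral>\<^sup>+y. (ennreal (\<phi> y) * indicator D y) * f (x, y) \<partial>lborel)" by simp
    qed
    finally show ?thesis .
  qed
  let ?Z = "\<lambda>z. Z (fst z) (snd z)" and ?v = "\<lambda>z. ennreal (v (2 * T) (fst z) (snd z))"
  have vm: "?v \<in> borel_measurable (borel \<Otimes>\<^sub>M borel)" by measurable
  have rect: "emeasure (density ?LL (\<lambda>z. ?w z * ?Z z)) (C \<times> D) = emeasure (density ?LL (\<lambda>z. ?w z * ?v z)) (C \<times> D)"
    if [measurable]: "C \<in> sets borel" "D \<in> sets borel" for C D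
  proof -
    have "AE x in lborel. (\<integral>\<^sup>+y. (ennreal (\<phi> y) * indicator D y) * Z x y \<partial>lborel) = (\<integral>\<^sup>+y. (ennreal (\<phi> y) * indicator D y) * ennreal (v (2 * T) x y) \<partial>lborel)"
      using G_integral_AE[of "[]" "\<lambda>y. ennreal (\<phi> y) * indicator D y"] T by (simp add: G_Nil mult.commute)
    then have "(\<integral>\<^sup>+x. ennreal (\<phi> x) * indicator C x * (\<integral>\<^sup>+y. (ennreal (\<phi> y) * indicator D y) * Z x y \<partial>lborel) \<partial>lborel)
        = (\<integral>\<^sup>+x. ennreal (\<phi> x) * indicator C x * (\<integral>\<^sup>+y. (ennreal (\<phi> y) * indicator D y) * ennreal (v (2 * T) x y) \<partial>lborel) \<partial>lborel)"
      by (intro nn_integral_cong_AE) (auto elim: eventually_mono)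
    then show ?thesis unfolding emb[OF Z_measurable that] emb[OF vm that] by simp
  qed
  have fin: "emeasure (density ?LL (\<lambda>z. ?w z * ?Z z)) (UNIV \<times> UNIV) = 1"
  proof -
    have "(\<integral>\<^sup>+y. (ennreal (\<phi> y) * indicator UNIV y) * ennreal (v (2 * T) x y) \<partial>lborel) = ennreal (\<phi> x)" for x
    proof -
      have "chain v [(2 * T, UNIV)] (\<lambda>y. ennreal (\<phi> y)) x = ennreal (\<phi> x) * chain k [(2 * T, UNIV)] (\<lambda>_. 1) x"
        by (rule chain_k[symmetric]) (use T in auto)
      then show ?thesis using k_mass[of "2 * T" x] T by (simp add: mult.commute)
    qed
    then have "emeasure (density ?LL (\<lambda>z. ?w z * ?v z)) (UNIV \<times> UNIV) = (\<integral>\<^sup>+x. ennreal (\<phi> x) * indicator UNIV x * ennreal (\<phi> x) \<partial>lborel)"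
      by (subst emb[OF vm]) simp_all
    also have "\<dots> = 1" using \<phi>_norm by (simp add: power2_eq_square ennreal_mult' \<phi>_pos less_imp_le)
    finally show ?thesis using rect[of UNIV UNIV] by simp
  qed
  have "density ?LL (\<lambda>z. ?w z * ?Z z) = density ?LL (\<lambda>z. ?w z * ?v z)"
  proof (rule finite_measure_pair_eqI[where A = borel and B = borel])
    show "sets (density ?LL (\<lambda>z. ?w z * ?Z z)) = sets (borel \<Otimes>\<^sub>M borel)" "sets (density ?LL (\<lambda>z. ?w z * ?v z)) = sets (borel \<Otimes>\<^sub>M borel)"
      unfolding sets_density by (rule sets_pair_measure_cong[OF sets_lborel sets_lborel])+
  qed (use rect fin in auto)
  then have "AE z in ?LL. ?w z * ?Z z = ?w z * ?v z"
  proof (rule sigma_finite_measure.density_unique[OF lborel_pair.P.sigma_finite_measure_axioms, rotated 2])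
    show "(\<lambda>z. ?w z * ?Z z) \<in> borel_measurable ?LL" "(\<lambda>z. ?w z * ?v z) \<in> borel_measurable ?LL"
      by (rule measurable_lborel_pair, measurable)+
  qed
  then show ?thesis
  proof eventually_elim
    case (elim z)
    have "?w z = ennreal (\<phi> (fst z) * \<phi> (snd z))" by (simp add: ennreal_mult' \<phi>_pos less_imp_le)
    then have "?w z \<noteq> 0" "?w z \<noteq> top" using \<phi>_pos[of "fst z"] \<phi>_pos[of "snd z"] by auto
    with elim show ?case by (simp add: ennreal_mult_cancel_left)
  qed
qed

section \<open>Resampling the interior of the window\<close>

lemma coordinate_\<mu>: "(\<lambda>\<omega>. \<omega> t) \<in> borel_measurable \<mu>"
  by (rule measurable_coordinate'[OF sets_\<mu>]) simp

text \<open>On rectangles this is the zigzag integral with pivot \<open>- T\<close>, and rectangles determine a finite measure on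
  pairs. The itineraries \<open>R\<close> and \<open>L\<close> carry constraints on the path before \<open>- T\<close> and after \<open>T\<close>.\<close>

lemma joint_law:
  assumes R: "itinerary R" and L: "itinerary L" and F: "F \<in> borel_measurable (borel \<Otimes>\<^sub>M borel)"
  shows "(\<integral>\<^sup>+\<omega>. indicator {\<omega>. visits T R (\<lambda>t. \<omega> (- t)) \<and> visits T L \<omega>} \<omega> * F (\<omega> (- T), \<omega> T) \<partial>\<mu>)
       = (\<integral>\<^sup>+x. \<integral>\<^sup>+y. \<phi>_chain R x * (ennreal (v (2 * T) x y) * \<phi>_chain L y) * F (x, y) \<partial>lborel \<partial>lborel)"
proof -
  let ?E = "{\<omega>. visits T R (\<lambda>t. \<omega> (- t)) \<and> visits T L \<omega>}"
  let ?LL = "(lborel :: 'a measure) \<Otimes>\<^sub>M (lborel :: 'a measure)"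
  let ?ends = "\<lambda>\<omega>. (\<omega> (- T), \<omega> T)"
  let ?g = "\<lambda>z. \<phi>_chain R (fst z) * (ennreal (v (2 * T) (fst z) (snd z)) * \<phi>_chain L (snd z))"
  interpret prob_space \<mu> by (rule prob_space_\<mu>)
  note [measurable] = \<phi>_chain_measurable[OF R] \<phi>_chain_measurable[OF L] coordinate_\<mu> F
  have [measurable]: "Measurable.pred \<mu> (\<lambda>\<omega>. visits T R (\<lambda>t. \<omega> (- t)))" "Measurable.pred \<mu> (visits T L)"
    by (rule pred_visits[OF R] pred_visits[where Y = "\<lambda>\<omega>. \<omega>", OF L], rule coordinate_\<mu>)+
  have E [measurable]: "(indicator ?E :: _ \<Rightarrow> ennreal) \<in> borel_measurable \<mu>" by measurable
  have ends [measurable]: "?ends \<in> measurable \<mu> (borel \<Otimes>\<^sub>M borel)" by measurable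
  have g: "?g \<in> borel_measurable (borel \<Otimes>\<^sub>M borel)" by measurable
  let ?M = "distr (density \<mu> (indicator ?E)) (borel \<Otimes>\<^sub>M borel) ?ends" and ?N = "density ?LL ?g"
  have em: "emeasure ?M S = (\<integral>\<^sup>+\<omega>. indicator ?E \<omega> * indicator S (?ends \<omega>) \<partial>\<mu>)" if S: "S \<in> sets (borel \<Otimes>\<^sub>M borel)" for S
  proof -
    have "emeasure ?M S = (\<integral>\<^sup>+z. indicator S z \<partial>?M)" using S by simp
    also have "\<dots> = (\<integral>\<^sup>+\<omega>. indicator S (?ends \<omega>) \<partial>density \<mu> (indicator ?E))"
      using S by (intro nn_integral_distr) simp_all
    also have "\<dots> = (\<integral>\<^sup>+\<omega>. indicator ?E \<omega> * indicator S (?ends \<omega>) \<partial>\<mu>)"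
      using S by (intro nn_integral_density E measurable_compose[OF ends borel_measurable_indicator])
    finally show ?thesis .
  qed
  have "?M = ?N"
  proof (rule finite_measure_pair_eqI[where A = borel and B = borel])
    show "sets ?M = sets (borel \<Otimes>\<^sub>M borel)" by simp
    show "sets ?N = sets (borel \<Otimes>\<^sub>M borel)"
      unfolding sets_density by (rule sets_pair_measure_cong[OF sets_lborel sets_lborel])
    have "emeasure ?M (space borel \<times> space borel) \<le> (\<integral>\<^sup>+\<omega>. 1 \<partial>\<mu>)"
    proof -
      have "space borel \<times> space borel \<in> sets (borel \<Otimes>\<^sub>M (borel :: 'a measure))"
        by (rule pair_measureI) auto
      then show ?thesis by (subst em) (auto intro!: nn_integral_mono split: split_indicator simp del: nn_integral_const)
    qed
    then show "emeasure ?M (space borel \<times> space borel) \<noteq> \<infinity>" by (auto simp: emeasure_space_1 top_unique)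
    fix C D :: "'a set" assume C [measurable]: "C \<in> sets borel" and D [measurable]: "D \<in> sets borel"
    \<comment> \<open>The void constraint at time \<open>0\<close> makes \<open>\<mu>_zigzag\<close> applicable; it is removed by the semigroup property.\<close>
    let ?L = "[(T, UNIV), (T, D)] @ L"
    have zz: "zigzag (- T) R C ?L \<omega> \<longleftrightarrow> \<omega> \<in> ?E \<and> ?ends \<omega> \<in> C \<times> D" for \<omega>
      by (auto simp: zigzag_def)
    have "emeasure ?M (C \<times> D) = (\<integral>\<^sup>+\<omega>. indicator {\<omega> \<in> space \<mu>. zigzag (- T) R C ?L \<omega>} \<omega> \<partial>\<mu>)"
    proof -
      have "emeasure ?M (C \<times> D) = (\<integral>\<^sup>+\<omega>. indicator ?E \<omega> * indicator (C \<times> D) (?ends \<omega>) \<partial>\<mu>)"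
        by (rule em) auto
      also have "\<dots> = (\<integral>\<^sup>+\<omega>. indicator {\<omega> \<in> space \<mu>. zigzag (- T) R C ?L \<omega>} \<omega> \<partial>\<mu>)"
        unfolding zz by (intro nn_integral_cong) (auto simp: indicator_def)
      finally show ?thesis .
    qed
    also have "\<dots> = emeasure \<mu> {\<omega> \<in> space \<mu>. zigzag (- T) R C ?L \<omega>}"
      by (rule nn_integral_indicator, rule sets_zigzag[OF R _ C sets_\<mu>]) (use L D T in auto)
    also have "\<dots> = zigzag_integral R C ?L"
      by (rule \<mu>_zigzag[OF R _ C]) (use L D T in auto)
    also have "\<dots> = (\<integral>\<^sup>+x. indicator C x * (\<phi>_chain R x * chain v [(2 * T, UNIV)] (\<lambda>y. indicator D y * \<phi>_chain L y) x) \<partial>lborel)"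
    proof -
      have "\<phi>_chain ?L x = chain v [(T, UNIV), (T, UNIV)] (\<lambda>y. indicator D y * \<phi>_chain L y) x" for x by simp
      moreover have "AE x in lborel. chain v [(T, UNIV), (T, UNIV)] (\<lambda>y. indicator D y * \<phi>_chain L y) x
          = chain v [(2 * T, UNIV)] (\<lambda>y. indicator D y * \<phi>_chain L y) x"
        using chapman_kolmogorov_AE[OF T T, of "\<lambda>y. indicator D y * \<phi>_chain L y"] by simp
      ultimately show ?thesis
        unfolding zigzag_integral_def by (intro nn_integral_cong_AE) (auto elim: eventually_mono)
    qed
    also have "\<dots> = (\<integral>\<^sup>+x. \<integral>\<^sup>+y. ?g (x, y) * indicator (C \<times> D) (x, y) \<partial>lborel \<partial>lborel)"
    proof (rule nn_integral_cong)
      fix x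
      have vx [measurable]: "v (2 * T) x \<in> borel_measurable borel"
        using measurable_compose[OF measurable_Pair1' v_2T_measurable, of x] by simp
      have "(\<integral>\<^sup>+y. (indicator C x * \<phi>_chain R x) * (ennreal (v (2 * T) x y) * (indicator D y * \<phi>_chain L y)) \<partial>lborel)
          = (indicator C x * \<phi>_chain R x) * (\<integral>\<^sup>+y. ennreal (v (2 * T) x y) * (indicator D y * \<phi>_chain L y) \<partial>lborel)"
      proof (rule nn_integral_cmult)
        have "(\<lambda>y. indicator D y * \<phi>_chain L y) \<in> borel_measurable borel"
          by (intro borel_measurable_times_ennreal borel_measurable_indicator D \<phi>_chain_measurable L)
        from borel_measurable_times_ennreal[OF measurable_compose[OF vx measurable_ennreal] this]
        show "(\<lambda>y. ennreal (v (2 * T) x y) * (indicator D y * \<phi>_chain L y)) \<in> borel_measurable lborel" by simp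
      qed
      moreover have "?g (x, y) * indicator (C \<times> D) (x, y) = (indicator C x * \<phi>_chain R x) * (ennreal (v (2 * T) x y) * (indicator D y * \<phi>_chain L y))" for y
        by (auto simp: indicator_def)
      ultimately show "indicator C x * (\<phi>_chain R x * chain v [(2 * T, UNIV)] (\<lambda>y. indicator D y * \<phi>_chain L y) x)
          = (\<integral>\<^sup>+y. ?g (x, y) * indicator (C \<times> D) (x, y) \<partial>lborel)"
        by (simp add: mult.assoc)
    qed
    also have "\<dots> = (\<integral>\<^sup>+z. ?g z * indicator (C \<times> D) z \<partial>?LL)"
      by (rule nn_integral_lborel_pair[symmetric]) measurable
    also have "\<dots> = emeasure ?N (C \<times> D)"
      by (rule emeasure_density[symmetric, OF measurable_lborel_pair[OF g]]) auto
    finally show "emeasure ?M (C \<times> D) = emeasure ?N (C \<times> D)" .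
  qed
  then have "(\<integral>\<^sup>+z. F z \<partial>?M) = (\<integral>\<^sup>+z. F z \<partial>?N)" by simp
  moreover have "(\<integral>\<^sup>+z. F z \<partial>?M) = (\<integral>\<^sup>+\<omega>. indicator ?E \<omega> * F (?ends \<omega>) \<partial>\<mu>)"
    using F by (subst nn_integral_distr) (auto intro!: nn_integral_density E measurable_compose[OF ends])
  moreover have "(\<integral>\<^sup>+z. F z \<partial>?N) = (\<integral>\<^sup>+z. ?g z * F z \<partial>?LL)"
    by (rule nn_integral_density[OF measurable_lborel_pair[OF g] measurable_lborel_pair[OF F]])
  moreover have "(\<integral>\<^sup>+z. ?g z * F z \<partial>?LL) = (\<integral>\<^sup>+x. \<integral>\<^sup>+y. ?g (x, y) * F (x, y) \<partial>lborel \<partial>lborel)"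
    by (rule nn_integral_lborel_pair) measurable
  ultimately show ?thesis by simp
qed

lemma Z_eq_v_\<mu>: "AE \<omega> in \<mu>. Z (\<omega> (- T)) (\<omega> T) = ennreal (v (2 * T) (\<omega> (- T)) (\<omega> T))"
proof -
  let ?F = "\<lambda>z. if Z (fst z) (snd z) = ennreal (v (2 * T) (fst z) (snd z)) then 0 else (1::ennreal)"
  have F [measurable]: "?F \<in> borel_measurable (borel \<Otimes>\<^sub>M borel)" by measurable
  have "(\<integral>\<^sup>+\<omega>. ?F (\<omega> (- T), \<omega> T) \<partial>\<mu>) = (\<integral>\<^sup>+x. \<integral>\<^sup>+y. \<phi>_chain [] x * (ennreal (v (2 * T) x y) * \<phi>_chain [] y) * ?F (x, y) \<partial>lborel \<partial>lborel)"
    using joint_law[of "[]" "[]" ?F] F by simp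
  also have "\<dots> = (\<integral>\<^sup>+x. 0 \<partial>(lborel :: 'a measure))"
  proof (rule nn_integral_cong_AE)
    have "AE x in (lborel :: 'a measure). AE y in (lborel :: 'a measure). Z x y = ennreal (v (2 * T) x y)"
      using lborel_pair.AE_pair[OF Z_eq_v] by simp
    then show "AE x in lborel. (\<integral>\<^sup>+y. \<phi>_chain [] x * (ennreal (v (2 * T) x y) * \<phi>_chain [] y) * ?F (x, y) \<partial>lborel) = 0"
    proof eventually_elim
      case (elim x)
      have "(\<integral>\<^sup>+y. \<phi>_chain [] x * (ennreal (v (2 * T) x y) * \<phi>_chain [] y) * ?F (x, y) \<partial>lborel) = (\<integral>\<^sup>+y. 0 \<partial>(lborel :: 'a measure))"
      proof (rule nn_integral_cong_AE)
        show "AE y in lborel. \<phi>_chain [] x * (ennreal (v (2 * T) x y) * \<phi>_chain [] y) * ?F (x, y) = 0"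
          using elim by eventually_elim simp
      qed
      then show ?case by simp
    qed
  qed
  finally have "(\<integral>\<^sup>+\<omega>. ?F (\<omega> (- T), \<omega> T) \<partial>\<mu>) = 0" by simp
  moreover have "(\<lambda>\<omega>. ?F (\<omega> (- T), \<omega> T)) \<in> borel_measurable \<mu>"
    by (rule measurable_compose[OF _ F]) (intro measurable_Pair coordinate_\<mu>)
  ultimately have "AE \<omega> in \<mu>. ?F (\<omega> (- T), \<omega> T) = 0" by (simp add: nn_integral_0_iff_AE)
  then show ?thesis by eventually_elim (auto split: if_splits)
qed

end

lemma space_exterior: "space (exterior_algebra T) = space (paths UNIV)"
  by (simp add: exterior_algebra_def)

lemma exterior_coordinate:
  "t \<le> - T \<or> T \<le> t \<Longrightarrow> (\<lambda>\<omega>. \<omega> t) \<in> borel_measurable (exterior_algebra T)"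
  unfolding exterior_algebra_def by (rule measurable_gen_algebra[of _ _ "\<lambda>t \<omega>. \<omega> t"]) auto

lemma sets_exterior: "sets (exterior_algebra T :: (real \<Rightarrow> 'a::euclidean_space) measure) \<subseteq> sets (paths UNIV)"
  unfolding exterior_algebra_def by (rule gen_algebra_subset) (auto intro: measurable_coordinate)

text \<open>The events determined by the path outside the window form a sigma-algebra that contains the generators.\<close>

lemma exterior_event_cong:
  assumes "E \<in> sets (exterior_algebra T)"
    and "\<omega> \<in> space (paths UNIV)" "\<omega>' \<in> space (paths UNIV)" "\<And>t. t \<le> - T \<or> T \<le> t \<Longrightarrow> \<omega> t = \<omega>' t"
  shows "\<omega> \<in> E \<longleftrightarrow> \<omega>' \<in> E"
proof -
  let ?G = "{{\<omega> \<in> space (paths UNIV). \<omega> t \<in> C} | t C. t \<in> {..- T} \<union> {T..} \<and> C \<in> sets (borel :: 'a measure)}"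
  have "E \<in> sigma_sets (space (paths UNIV)) ?G"
    using assms(1) unfolding exterior_algebra_def gen_algebra_def by (subst (asm) sets_measure_of) auto
  then show ?thesis
  proof induction
    case (Basic E)
    then show ?case using assms(2-4) by auto
  next
    case (Compl E)
    then show ?case using assms(2,3) by auto
  qed auto
qed

context gibbs_window
begin

definition glue :: "(real \<Rightarrow> 'a) \<Rightarrow> (real \<Rightarrow> 'a) \<Rightarrow> real \<Rightarrow> 'a" where
  "glue \<omega>' \<omega> = (\<lambda>t. if - T \<le> t \<and> t < T then \<omega> t else \<omega>' t)"

lemma glue_space:
  assumes "\<omega>' \<in> space (paths UNIV)" "\<omega> \<in> space (paths {- T..T})"
  shows "glue \<omega>' \<omega> \<in> space (paths UNIV)"
proof -
  have w: "\<omega>' \<in> cadlag_on UNIV" "\<omega> \<in> cadlag_on {- T..T}" using assms by (auto simp: space_paths)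
  have "glue \<omega>' \<omega> \<in> cadlag_on UNIV"
    unfolding cadlag_on_def
  proof (intro CollectI ballI conjI)
    fix t :: real
    show "(glue \<omega>' \<omega> \<longlongrightarrow> glue \<omega>' \<omega> t) (at t within UNIV \<inter> {t<..})"
    proof (cases "- T \<le> t \<and> t < T")
      case True
      have "(glue \<omega>' \<omega> \<longlongrightarrow> \<omega> t) (at t within UNIV \<inter> {t<..})"
        by (rule tendsto_relocate[where c = 0 and e = "T - t", OF cadlag_onD(1)[OF w(2)]])
          (use True in \<open>auto simp: glue_def\<close>)
      then show ?thesis using True by (simp add: glue_def)
    next
      case False
      have "(glue \<omega>' \<omega> \<longlongrightarrow> \<omega>' t) (at t within UNIV \<inter> {t<..})"
        by (rule tendsto_relocate[where c = 0 and e = "if t < - T then - T - t else 1", OF cadlag_onD(1)[OF w(1)]])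
          (use False in \<open>auto simp: glue_def split: if_splits\<close>)
      then show ?thesis using False by (auto simp: glue_def)
    qed
    show "\<exists>m. (glue \<omega>' \<omega> \<longlongrightarrow> m) (at t within UNIV \<inter> {..<t})"
    proof (cases "- T < t \<and> t \<le> T")
      case True
      then obtain m where m: "(\<omega> \<longlongrightarrow> m) (at t within {- T..T} \<inter> {..<t})" using cadlag_onD(2)[OF w(2), of t] by auto
      have "(glue \<omega>' \<omega> \<longlongrightarrow> m) (at t within UNIV \<inter> {..<t})"
        by (rule tendsto_relocate[where c = 0 and e = "t + T", OF m])
          (use True in \<open>auto simp: glue_def\<close>)
      then show ?thesis by blast
    next
      case False
      obtain m where m: "(\<omega>' \<longlongrightarrow> m) (at t within UNIV \<inter> {..<t})" using cadlag_onD(2)[OF w(1), of t] by auto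
      have "(glue \<omega>' \<omega> \<longlongrightarrow> m) (at t within UNIV \<inter> {..<t})"
        by (rule tendsto_relocate[where c = 0 and e = "if T < t then t - T else 1", OF m])
          (use False in \<open>auto simp: glue_def split: if_splits\<close>)
      then show ?thesis by blast
    qed
  qed
  then show ?thesis by (simp add: space_paths)
qed

lemma glue_measurable:
  "(\<lambda>(\<omega>', \<omega>). glue \<omega>' \<omega>) \<in> measurable (exterior_algebra T \<Otimes>\<^sub>M paths {- T..T}) (paths UNIV)"
proof (rule measurable_pathsI)
  fix z :: "(real \<Rightarrow> 'a) \<times> (real \<Rightarrow> 'a)" assume "z \<in> space (exterior_algebra T \<Otimes>\<^sub>M paths {- T..T})"
  then show "(case z of (\<omega>', \<omega>) \<Rightarrow> glue \<omega>' \<omega>) \<in> space (paths UNIV)"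
    by (cases z) (auto simp: space_pair_measure space_exterior intro!: glue_space)
next
  fix t :: real
  show "(\<lambda>z. (case z of (\<omega>', \<omega>) \<Rightarrow> glue \<omega>' \<omega>) t) \<in> borel_measurable (exterior_algebra T \<Otimes>\<^sub>M (paths {- T..T} :: (real \<Rightarrow> 'a) measure))"
  proof (cases "- T \<le> t \<and> t < T")
    case True
    then have "(\<lambda>z. snd z t) \<in> borel_measurable (exterior_algebra T \<Otimes>\<^sub>M (paths {- T..T} :: (real \<Rightarrow> 'a) measure))"
      by (intro measurable_compose[OF measurable_snd measurable_coordinate]) auto
    then show ?thesis using True by (simp add: case_prod_beta' glue_def)
  next
    case False
    then have "(\<lambda>z. fst z t) \<in> borel_measurable ((exterior_algebra T :: (real \<Rightarrow> 'a) measure) \<Otimes>\<^sub>M (paths {- T..T} :: (real \<Rightarrow> 'a) measure))"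
      by (intro measurable_compose[OF measurable_fst exterior_coordinate]) auto
    then show ?thesis using False by (simp only: case_prod_beta' glue_def if_False)
  qed
qed

lemma glue_measurable1:
  assumes "\<omega>' \<in> space (paths UNIV)"
  shows "glue \<omega>' \<in> measurable (B x y) (paths UNIV)"
proof -
  have "Pair \<omega>' \<in> measurable (paths {- T..T}) (exterior_algebra T \<Otimes>\<^sub>M (paths {- T..T} :: (real \<Rightarrow> 'a) measure))"
    by (rule measurable_Pair1') (simp add: space_exterior assms)
  from measurable_compose[OF this glue_measurable] show ?thesis
    by (simp add: measurable_cong_sets[OF sets_B refl])
qed

definition tilt :: "(real \<Rightarrow> 'a) set \<Rightarrow> (real \<Rightarrow> 'a) \<Rightarrow> ennreal" where
  "tilt A \<omega>' = (\<integral>\<^sup>+\<omega>. W \<omega> * indicator A (glue \<omega>' \<omega>) \<partial>B (\<omega>' (- T)) (\<omega>' T))"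

abbreviation Zp :: "(real \<Rightarrow> 'a) \<Rightarrow> ennreal" where "Zp \<omega>' \<equiv> Z (\<omega>' (- T)) (\<omega>' T)"

lemma tilt_measurable:
  assumes A: "A \<in> sets (paths UNIV)"
  shows "tilt A \<in> borel_measurable (exterior_algebra T)"
  unfolding tilt_def
proof (rule B_integral_measurable)
  have iA: "(\<lambda>z. indicator A (case z of (\<omega>', \<omega>) \<Rightarrow> glue \<omega>' \<omega>) :: ennreal)
      \<in> borel_measurable (exterior_algebra T \<Otimes>\<^sub>M paths {- T..T})"
    by (rule measurable_compose[OF glue_measurable borel_measurable_indicator[OF A]])
  show "(\<lambda>(\<omega>', \<omega>). W \<omega> * indicator A (glue \<omega>' \<omega>)) \<in> borel_measurable (exterior_algebra T \<Otimes>\<^sub>M paths {- T..T})"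
    using borel_measurable_times_ennreal[OF measurable_compose[OF measurable_snd W_measurable] iA]
    by (simp add: case_prod_beta')
qed (auto intro: exterior_coordinate)

lemma Zp_measurable: "Zp \<in> borel_measurable (exterior_algebra T)"
proof -
  have "(\<lambda>\<omega>'. (\<omega>' (- T), \<omega>' T)) \<in> measurable (exterior_algebra T) (borel \<Otimes>\<^sub>M (borel :: 'a measure))"
    by (intro measurable_Pair exterior_coordinate) auto
  from measurable_compose[OF this Z_measurable] show ?thesis by simp
qed

lemma subalgebra_exterior: "subalgebra \<mu> (exterior_algebra T)"
  using sets_exterior by (auto simp: subalgebra_def space_exterior space_\<mu> sets_\<mu>)

lemma tilt_le_Z: "tilt A \<omega>' \<le> Zp \<omega>'"
  unfolding tilt_def Z_def by (intro nn_integral_mono) (auto simp: indicator_def)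

text \<open>The exponential factor in the weight cancels between numerator and denominator.\<close>

lemma gibbs_kernel_eq:
  assumes A: "A \<in> sets (paths UNIV)" and w: "\<omega>' \<in> space (paths UNIV)"
  shows "gibbs_kernel \<nu> V T A \<omega>' = enn2real (tilt A \<omega>') / enn2real (Zp \<omega>')"
proof -
  let ?B = "B (\<omega>' (- T)) (\<omega>' T)"
  let ?c = "exp (l * (2 * T))"
  let ?e = "\<lambda>\<omega>. exp (- action V (- T) T \<omega>)"
  have actm: "action V (- T) T \<in> borel_measurable (paths {- T..T} :: (real \<Rightarrow> 'a) measure)"
    by (rule measurable_action) auto
  have em [measurable]: "?e \<in> borel_measurable ?B"
    using measurable_B[OF measurable_compose[OF actm, of "\<lambda>a. exp (- a)"]] by simp
  have actU: "action V (- T) T \<in> borel_measurable (paths UNIV :: (real \<Rightarrow> 'a) measure)"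
    by (rule measurable_action) auto
  have [measurable]: "A \<in> sets (paths UNIV)" by fact
  note g [measurable] = glue_measurable1[OF w, of "\<omega>' (- T)" "\<omega>' T"]
  have W: "W \<omega> = ennreal ?c * ennreal (?e \<omega>)" for \<omega>
    by (simp add: W_def ennreal_mult'[symmetric] exp_add[symmetric])
  have "partition_function \<nu> V T (\<omega>' (- T)) (\<omega>' T) = enn2real (\<integral>\<^sup>+\<omega>. ennreal (?e \<omega>) \<partial>?B)"
    unfolding partition_function_def by (rule integral_eq_nn_integral) auto
  moreover have "Zp \<omega>' = ennreal ?c * (\<integral>\<^sup>+\<omega>. ennreal (?e \<omega>) \<partial>?B)"
    unfolding Z_def W by (rule nn_integral_cmult) measurable
  ultimately have 1: "enn2real (Zp \<omega>') = ?c * partition_function \<nu> V T (\<omega>' (- T)) (\<omega>' T)"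
    by (simp add: enn2real_mult)
  have act: "action V (- T) T (glue \<omega>' \<omega>) = action V (- T) T \<omega>" for \<omega>
    by (rule action_cong) (auto simp: glue_def)
  have "(\<integral>\<omega>. indicator A \<omega> * ?e \<omega> \<partial>glued_bridge \<nu> T \<omega>') = (\<integral>\<omega>. indicator A \<omega> * ?e \<omega> \<partial>distr ?B (paths UNIV) (glue \<omega>'))"
    by (simp add: glued_bridge_def glue_def[abs_def])
  also have "\<dots> = (\<integral>\<omega>. indicator A (glue \<omega>' \<omega>) * ?e (glue \<omega>' \<omega>) \<partial>?B)"
  proof (rule integral_distr[OF g])
    note [measurable] = actU
    show "(\<lambda>\<omega>. indicator A \<omega> * ?e \<omega>) \<in> borel_measurable (paths UNIV)" by measurable
  qed
  also have "\<dots> = (\<integral>\<omega>. indicator A (glue \<omega>' \<omega>) * ?e \<omega> \<partial>?B)" by (simp only: act)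
  also have "\<dots> = enn2real (\<integral>\<^sup>+\<omega>. ennreal (indicator A (glue \<omega>' \<omega>) * ?e \<omega>) \<partial>?B)"
    by (rule integral_eq_nn_integral) auto
  finally have num: "(\<integral>\<omega>. indicator A \<omega> * ?e \<omega> \<partial>glued_bridge \<nu> T \<omega>')
      = enn2real (\<integral>\<^sup>+\<omega>. ennreal (indicator A (glue \<omega>' \<omega>) * ?e \<omega>) \<partial>?B)" .
  have "tilt A \<omega>' = (\<integral>\<^sup>+\<omega>. ennreal ?c * ennreal (indicator A (glue \<omega>' \<omega>) * ?e \<omega>) \<partial>?B)"
    unfolding tilt_def W by (intro nn_integral_cong) (auto simp: indicator_def)
  also have "\<dots> = ennreal ?c * (\<integral>\<^sup>+\<omega>. ennreal (indicator A (glue \<omega>' \<omega>) * ?e \<omega>) \<partial>?B)"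
    by (rule nn_integral_cmult) measurable
  finally have "enn2real (tilt A \<omega>') = ?c * (\<integral>\<omega>. indicator A \<omega> * ?e \<omega> \<partial>glued_bridge \<nu> T \<omega>')"
    unfolding num by (simp add: enn2real_mult)
  then show ?thesis unfolding gibbs_kernel_def 1 by simp
qed

lemma gibbs_kernel_measurable:
  assumes "A \<in> sets (paths UNIV)"
  shows "gibbs_kernel \<nu> V T A \<in> borel_measurable (exterior_algebra T)"
proof -
  note [measurable] = tilt_measurable[OF assms] Zp_measurable
  have "(\<lambda>\<omega>'. enn2real (tilt A \<omega>') / enn2real (Zp \<omega>')) \<in> borel_measurable (exterior_algebra T)" by measurable
  then show ?thesis
    by (rule measurable_cong[THEN iffD1, rotated]) (simp add: space_exterior gibbs_kernel_eq[OF assms])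
qed

text \<open>In the extended nonnegative reals \<open>x * inverse x \<le> 1\<close> for all \<open>x\<close>, including \<open>0\<close> and infinity. So this is a
  sub-probability kernel for every boundary condition.\<close>
definition resample :: "(real \<Rightarrow> 'a) \<Rightarrow> (real \<Rightarrow> 'a) measure" where
  "resample \<omega>' = scale_measure (inverse (Zp \<omega>'))
     (distr (density (B (\<omega>' (- T)) (\<omega>' T)) W) (paths UNIV) (glue \<omega>'))"

lemma emeasure_resample:
  assumes A: "A \<in> sets (paths UNIV)" and w: "\<omega>' \<in> space (paths UNIV)"
  shows "emeasure (resample \<omega>') A = inverse (Zp \<omega>') * tilt A \<omega>'"
proof -
  let ?B = "B (\<omega>' (- T)) (\<omega>' T)"
  note g = glue_measurable1[OF w, of "\<omega>' (- T)" "\<omega>' T"]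
  have "emeasure (distr (density ?B W) (paths UNIV) (glue \<omega>')) A = (\<integral>\<^sup>+\<omega>. indicator A \<omega> \<partial>distr (density ?B W) (paths UNIV) (glue \<omega>'))"
    using A by simp
  also have "\<dots> = (\<integral>\<^sup>+\<omega>. indicator A (glue \<omega>' \<omega>) \<partial>density ?B W)"
    using A g by (intro nn_integral_distr) simp_all
  also have "\<dots> = tilt A \<omega>'"
    unfolding tilt_def using measurable_B[OF W_measurable]
    by (intro nn_integral_density measurable_compose[OF g borel_measurable_indicator[OF A]])
  finally show ?thesis by (simp add: resample_def)
qed

lemma sets_resample: "sets (resample \<omega>') = sets (paths UNIV)"
  by (simp add: resample_def)

lemma resample_kernel: "resample \<in> measurable \<mu> (subprob_algebra (paths UNIV))"
proof (rule measurable_subprob_algebra)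
  fix \<omega>' assume "\<omega>' \<in> space \<mu>"
  then have w: "\<omega>' \<in> space (paths UNIV)" by (simp add: space_\<mu>)
  have sp: "space (resample \<omega>') = space (paths UNIV)" by (rule sets_eq_imp_space_eq[OF sets_resample])
  show "subprob_space (resample \<omega>')"
  proof (rule subprob_spaceI)
    have "emeasure (resample \<omega>') (space (resample \<omega>')) \<le> inverse (Zp \<omega>') * Zp \<omega>'"
      unfolding sp emeasure_resample[OF sets.top w] by (intro mult_left_mono tilt_le_Z) simp
    also have "\<dots> \<le> 1"
    proof (cases "Zp \<omega>' = 0 \<or> Zp \<omega>' = top")
      case False
      then obtain r where "0 < r" "Zp \<omega>' = ennreal r"
        by (cases "Zp \<omega>'") (auto simp: less_le)
      then show ?thesis by (simp add: inverse_ennreal ennreal_mult'[symmetric])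
    qed auto
    finally show "emeasure (resample \<omega>') (space (resample \<omega>')) \<le> 1" .
    show "space (resample \<omega>') \<noteq> {}" unfolding sp by (rule space_paths_nonempty)
  qed
next
  fix A :: "(real \<Rightarrow> 'a) set" assume A: "A \<in> sets (paths UNIV)"
  have [measurable]: "tilt A \<in> borel_measurable \<mu>" "Zp \<in> borel_measurable \<mu>"
    by (rule measurable_from_subalg[OF subalgebra_exterior], rule tilt_measurable[OF A] Zp_measurable)+
  have "(\<lambda>\<omega>'. inverse (Zp \<omega>') * tilt A \<omega>') \<in> borel_measurable \<mu>" by measurable
  then show "(\<lambda>\<omega>'. emeasure (resample \<omega>') A) \<in> borel_measurable \<mu>"
    by (rule measurable_cong[THEN iffD1, rotated]) (simp add: space_\<mu> emeasure_resample[OF A])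
qed (simp add: sets_resample)

text \<open>On a cylinder the exterior and the boundary constraints concern \<open>\<omega>'\<close> alone and factor out of the tilted bridge
  integral.\<close>

lemma tilt_cylinder:
  assumes L: "itinerary L\<^sub>2" "visit_times (- T) L\<^sub>2 \<subseteq> {- T..<T}" and R: "itinerary R" and L3: "itinerary L\<^sub>3"
    and CD: "C \<in> sets borel" "D \<in> sets borel"
    and eq: "\<And>\<omega>. \<omega> \<in> S \<longleftrightarrow> \<omega> \<in> space (paths UNIV) \<and> (\<omega> (- T) \<in> C \<and> visits (- T) L\<^sub>2 \<omega> \<and> \<omega> T \<in> D) \<and>
              (visits T R (\<lambda>t. \<omega> (- t)) \<and> visits T L\<^sub>3 \<omega>)"
    and w: "\<omega>' \<in> space (paths UNIV)"
  shows "tilt S \<omega>' = indicator {\<omega>. visits T R (\<lambda>t. \<omega> (- t)) \<and> visits T L\<^sub>3 \<omega>} \<omega>' *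
           (indicator C (\<omega>' (- T)) * indicator D (\<omega>' T) * G L\<^sub>2 (\<omega>' (- T)) (\<omega>' T))"
proof -
  let ?x = "\<omega>' (- T)" and ?y = "\<omega>' T"
  let ?E = "{\<omega>. visits T R (\<lambda>t. \<omega> (- t)) \<and> visits T L\<^sub>3 \<omega>}"
  have gR: "visits T R (\<lambda>t. glue \<omega>' \<omega> (- t)) \<longleftrightarrow> visits T R (\<lambda>t. \<omega>' (- t))" for \<omega>
    by (rule visits_cong[OF _ R]) (auto simp: glue_def)
  have gL3: "visits T L\<^sub>3 (glue \<omega>' \<omega>) \<longleftrightarrow> visits T L\<^sub>3 \<omega>'" for \<omega>
    by (rule visits_cong[OF _ L3]) (auto simp: glue_def)
  have gL2: "visits (- T) L\<^sub>2 (glue \<omega>' \<omega>) \<longleftrightarrow> visits (- T) L\<^sub>2 \<omega>" for \<omega>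
    by (rule visits_cong[OF _ L(1)]) (use L(2) in \<open>force simp: glue_def\<close>)
  have "tilt S \<omega>' = (\<integral>\<^sup>+\<omega>. (indicator ?E \<omega>' * (indicator C ?x * indicator D ?y)) * (W \<omega> * indicator {\<omega>. visits (- T) L\<^sub>2 \<omega>} \<omega>) \<partial>B ?x ?y)"
    unfolding tilt_def
  proof (rule nn_integral_cong_AE)
    show "AE \<omega> in B ?x ?y. W \<omega> * indicator S (glue \<omega>' \<omega>)
        = (indicator ?E \<omega>' * (indicator C ?x * indicator D ?y)) * (W \<omega> * indicator {\<omega>. visits (- T) L\<^sub>2 \<omega>} \<omega>)"
      using B_ends[of ?x ?y] AE_space
    proof eventually_elim
      case (elim \<omega>)
      have "glue \<omega>' \<omega> \<in> space (paths UNIV)" using w elim by (intro glue_space) (auto simp: space_B)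
      moreover have "glue \<omega>' \<omega> (- T) = ?x" "glue \<omega>' \<omega> T = ?y" using elim T by (auto simp: glue_def)
      ultimately have "glue \<omega>' \<omega> \<in> S \<longleftrightarrow> \<omega>' \<in> ?E \<and> ?x \<in> C \<and> ?y \<in> D \<and> visits (- T) L\<^sub>2 \<omega>"
        unfolding eq gR gL3 gL2 by auto
      then show ?case by (auto simp: indicator_def)
    qed
  qed
  also have "\<dots> = (indicator ?E \<omega>' * (indicator C ?x * indicator D ?y)) * G L\<^sub>2 ?x ?y"
    unfolding G_def by (rule nn_integral_cmult[OF measurable_B[OF visits_window_measurable[OF L]]])
  finally show ?thesis by (simp add: mult.assoc)
qed

text \<open>Under the joint law of the boundary values, the normalising factor cancels the density \<open>v (2 * T)\<close>, and the
  integral of the tilted bridge mass over the right end point restores the chain across the window.\<close>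

lemma resampled_zigzag:
  assumes L: "itinerary L\<^sub>2" "duration L\<^sub>2 < 2 * T" "visit_times (- T) L\<^sub>2 \<subseteq> {- T..<T}"
    and R: "itinerary R" and L3: "itinerary L\<^sub>3" and C: "C \<in> sets borel" and D: "D \<in> sets borel"
  shows "(\<integral>\<^sup>+\<omega>'. inverse (Zp \<omega>') * (indicator {\<omega>. visits T R (\<lambda>t. \<omega> (- t)) \<and> visits T L\<^sub>3 \<omega>} \<omega>' *
           (indicator C (\<omega>' (- T)) * indicator D (\<omega>' T) * G L\<^sub>2 (\<omega>' (- T)) (\<omega>' T))) \<partial>\<mu>)
       = zigzag_integral R C (L\<^sub>2 @ [(2 * T - duration L\<^sub>2, D)] @ L\<^sub>3)"
proof -
  let ?E = "{\<omega>. visits T R (\<lambda>t. \<omega> (- t)) \<and> visits T L\<^sub>3 \<omega>}"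
  define F where "F z = inverse (Z (fst z) (snd z)) * (indicator C (fst z) * indicator D (snd z) * G L\<^sub>2 (fst z) (snd z))" for z :: "'a \<times> 'a"
  note [measurable] = C D G_measurable[OF L(1,3)]
  have F: "F \<in> borel_measurable (borel \<Otimes>\<^sub>M borel)" unfolding F_def by measurable
  have "(\<integral>\<^sup>+\<omega>'. inverse (Zp \<omega>') * (indicator ?E \<omega>' * (indicator C (\<omega>' (- T)) * indicator D (\<omega>' T) * G L\<^sub>2 (\<omega>' (- T)) (\<omega>' T))) \<partial>\<mu>)
      = (\<integral>\<^sup>+\<omega>. indicator ?E \<omega> * F (\<omega> (- T), \<omega> T) \<partial>\<mu>)"
    by (intro nn_integral_cong) (simp add: F_def ac_simps)
  also have "\<dots> = (\<integral>\<^sup>+x. \<integral>\<^sup>+y. \<phi>_chain R x * (ennreal (v (2 * T) x y) * \<phi>_chain L\<^sub>3 y) * F (x, y) \<partial>lborel \<partial>lborel)"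
    by (rule joint_law[OF R L3 F])
  also have "\<dots> = (\<integral>\<^sup>+x. indicator C x * (\<phi>_chain R x * \<phi>_chain (L\<^sub>2 @ [(2 * T - duration L\<^sub>2, D)] @ L\<^sub>3) x) \<partial>lborel)"
  proof (rule nn_integral_cong_AE)
    have DL: "(\<lambda>y. indicator D y * \<phi>_chain L\<^sub>3 y) \<in> borel_measurable borel"
      by (intro borel_measurable_times_ennreal borel_measurable_indicator D \<phi>_chain_measurable L3)
    have "AE x in (lborel :: 'a measure). AE y in (lborel :: 'a measure). Z x y = ennreal (v (2 * T) x y)"
      using lborel_pair.AE_pair[OF Z_eq_v] by simp
    then show "AE x in lborel. (\<integral>\<^sup>+y. \<phi>_chain R x * (ennreal (v (2 * T) x y) * \<phi>_chain L\<^sub>3 y) * F (x, y) \<partial>lborel)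
        = indicator C x * (\<phi>_chain R x * \<phi>_chain (L\<^sub>2 @ [(2 * T - duration L\<^sub>2, D)] @ L\<^sub>3) x)"
      using G_integral_AE[OF L DL]
    proof eventually_elim
      case (elim x)
      have "(\<integral>\<^sup>+y. \<phi>_chain R x * (ennreal (v (2 * T) x y) * \<phi>_chain L\<^sub>3 y) * F (x, y) \<partial>lborel)
          = (\<integral>\<^sup>+y. (indicator C x * \<phi>_chain R x) * ((indicator D y * \<phi>_chain L\<^sub>3 y) * G L\<^sub>2 x y) \<partial>lborel)"
      proof (rule nn_integral_cong_AE)
        show "AE y in lborel. \<phi>_chain R x * (ennreal (v (2 * T) x y) * \<phi>_chain L\<^sub>3 y) * F (x, y)
            = (indicator C x * \<phi>_chain R x) * ((indicator D y * \<phi>_chain L\<^sub>3 y) * G L\<^sub>2 x y)"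
          using elim(1)
        proof eventually_elim
          case (elim y)
          have "ennreal (v (2 * T) x y) * inverse (ennreal (v (2 * T) x y)) = 1"
            using v_2T_pos[of x y] by (simp add: inverse_ennreal ennreal_mult'[symmetric])
          moreover have "\<phi>_chain R x * (ennreal (v (2 * T) x y) * \<phi>_chain L\<^sub>3 y) * F (x, y)
            = (ennreal (v (2 * T) x y) * inverse (ennreal (v (2 * T) x y))) * ((indicator C x * \<phi>_chain R x) * ((indicator D y * \<phi>_chain L\<^sub>3 y) * G L\<^sub>2 x y))"
            unfolding F_def by (simp add: elim ac_simps)
          ultimately show ?case by simp
        qed
      qed
      also have "\<dots> = (indicator C x * \<phi>_chain R x) * (\<integral>\<^sup>+y. (indicator D y * \<phi>_chain L\<^sub>3 y) * G L\<^sub>2 x y \<partial>lborel)"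
        using borel_measurable_times_ennreal[OF DL measurable_compose[OF measurable_Pair1' G_measurable[OF L(1,3)], of x, simplified]]
        by (intro nn_integral_cmult) simp
      also have "\<dots> = (indicator C x * \<phi>_chain R x) * chain v (L\<^sub>2 @ [(2 * T - duration L\<^sub>2, UNIV)]) (\<lambda>y. indicator D y * \<phi>_chain L\<^sub>3 y) x"
        by (simp only: elim(2))
      also have "chain v (L\<^sub>2 @ [(2 * T - duration L\<^sub>2, UNIV)]) (\<lambda>y. indicator D y * \<phi>_chain L\<^sub>3 y) x
          = \<phi>_chain (L\<^sub>2 @ [(2 * T - duration L\<^sub>2, D)] @ L\<^sub>3) x"
      proof -
        have "chain v [(2 * T - duration L\<^sub>2, UNIV)] (\<lambda>y. indicator D y * \<phi>_chain L\<^sub>3 y) = \<phi>_chain ([(2 * T - duration L\<^sub>2, D)] @ L\<^sub>3)"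
          by (rule ext) simp
        then show ?thesis by (simp only: chain_append)
      qed
      finally show ?case by (simp add: mult.assoc)
    qed
  qed
  finally show ?thesis by (simp add: zigzag_integral_def)
qed

text \<open>Compared on cylinders that contain the ends of the window and the time \<open>0\<close>: both measures give the zigzag integral
  with pivot \<open>- T\<close>.\<close>

theorem resample_invariant: "\<mu> \<bind> resample = \<mu>"
proof (rule sym, rule paths_measure_eqI[where I = UNIV and J\<^sub>0 = "{- T, 0, T}"])
  interpret prob_space \<mu> by (rule prob_space_\<mu>)
  show "sets \<mu> = sets (paths UNIV)" by (rule sets_\<mu>)
  show "sets (\<mu> \<bind> resample) = sets (paths UNIV)"
    by (rule sets_bind[OF _ not_empty]) (simp add: sets_resample)
  show "finite {- T, 0, T}" "{- T, 0, T} \<subseteq> UNIV" by auto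
  show "emeasure \<mu> (space (paths UNIV)) \<noteq> \<infinity>" by (simp add: emeasure_eq_measure)
  fix J :: "real set" and A :: "real \<Rightarrow> 'a set"
  assume J: "finite J" "{- T, 0, T} \<subseteq> J" "J \<subseteq> UNIV" and A: "\<And>j. A j \<in> sets borel"
  obtain R where R: "itinerary R"
      "\<And>\<omega>. visits T R \<omega> \<longleftrightarrow> (\<forall>j\<in>uminus ` (J \<inter> {..<- T}). \<omega> j \<in> A (- j))"
    by (rule finite_times_itinerary[of "uminus ` (J \<inter> {..<- T})" T "\<lambda>j. A (- j)"]) (use J A in auto)
  obtain L2 where L2: "itinerary L2" "visit_times (- T) L2 = insert (- T) (J \<inter> {- T<..<T})"
      "\<And>\<omega>. visits (- T) L2 \<omega> \<longleftrightarrow> (\<forall>j\<in>J \<inter> {- T<..<T}. \<omega> j \<in> A j)"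
    by (rule finite_times_itinerary[of "J \<inter> {- T<..<T}" "- T" A]) (use J A in auto)
  obtain L3 where L3: "itinerary L3" "\<And>\<omega>. visits T L3 \<omega> \<longleftrightarrow> (\<forall>j\<in>J \<inter> {T<..}. \<omega> j \<in> A j)"
    by (rule finite_times_itinerary[of "J \<inter> {T<..}" T A]) (use J A in auto)
  have split: "J = {- T, T} \<union> (J \<inter> {..<- T}) \<union> (J \<inter> {- T<..<T}) \<union> (J \<inter> {T<..})" using J(2) by auto
  have eq: "(\<forall>j\<in>J. \<omega> j \<in> A j) \<longleftrightarrow> (\<omega> (- T) \<in> A (- T) \<and> visits (- T) L2 \<omega> \<and> \<omega> T \<in> A T) \<and>
      (visits T R (\<lambda>t. \<omega> (- t)) \<and> visits T L3 \<omega>)" for \<omega>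
    unfolding R(2) L2(3) L3(2) by (subst split) auto
  have sub: "visit_times (- T) L2 \<subseteq> {- T..<T}" using L2(2) T by auto
  have dur: "duration L2 < 2 * T" using times_ends(2)[of "- T" L2] sub by auto
  let ?L = "L2 @ [(2 * T - duration L2, A T)] @ L3"
  let ?S = "cylinder UNIV J A"
  have S: "?S \<in> sets (paths UNIV)" by (rule sets_cylinder[OF J(1,3) A])
  have itL: "itinerary ?L" using L2 L3 A dur by simp
  have zero: "0 \<in> visit_times (- T) ?L"
    unfolding times_append using L2(2) J(2) T by auto
  have SE: "\<omega> \<in> ?S \<longleftrightarrow> \<omega> \<in> space (paths UNIV) \<and> (\<omega> (- T) \<in> A (- T) \<and> visits (- T) L2 \<omega> \<and> \<omega> T \<in> A T) \<and>
              (visits T R (\<lambda>t. \<omega> (- t)) \<and> visits T L3 \<omega>)" for \<omega>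
    by (simp add: cylinder_def eq)
  have "?S = {\<omega> \<in> space \<mu>. zigzag (- T) R (A (- T)) ?L \<omega>}"
    unfolding set_eq_iff SE by (auto simp: zigzag_def visits_append space_\<mu>)
  then have "emeasure \<mu> ?S = zigzag_integral R (A (- T)) ?L"
    using \<mu>_zigzag[OF R(1) itL A zero] by simp
  also have "\<dots> = (\<integral>\<^sup>+\<omega>'. inverse (Zp \<omega>') * (indicator {\<omega>. visits T R (\<lambda>t. \<omega> (- t)) \<and> visits T L3 \<omega>} \<omega>' *
           (indicator (A (- T)) (\<omega>' (- T)) * indicator (A T) (\<omega>' T) * G L2 (\<omega>' (- T)) (\<omega>' T))) \<partial>\<mu>)"
    by (rule resampled_zigzag[OF L2(1) dur sub R(1) L3(1) A A, symmetric])
  also have "\<dots> = (\<integral>\<^sup>+\<omega>'. emeasure (resample \<omega>') ?S \<partial>\<mu>)"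
    by (intro nn_integral_cong)
      (simp add: emeasure_resample[OF S] space_\<mu> tilt_cylinder[OF L2(1) sub R(1) L3(1) A A SE])
  also have "\<dots> = emeasure (\<mu> \<bind> resample) ?S"
    by (rule emeasure_bind[OF not_empty resample_kernel S, symmetric])
  finally show "emeasure \<mu> ?S = emeasure (\<mu> \<bind> resample) ?S" .
qed

text \<open>At the time \<open>- T\<close>, which belongs to the exterior, the glued path takes its value from the bridge; the two values
  agree almost surely.\<close>

lemma tilt_Int_exterior:
  assumes E: "E \<in> sets (exterior_algebra T)" and w: "\<omega>' \<in> space (paths UNIV)"
  shows "tilt (A \<inter> E) \<omega>' = indicator E \<omega>' * tilt A \<omega>'"
proof -
  let ?x = "\<omega>' (- T)" and ?y = "\<omega>' T"
  have ae: "AE \<omega> in B ?x ?y. glue \<omega>' \<omega> \<in> E \<longleftrightarrow> \<omega>' \<in> E"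
    using B_ends[of ?x ?y] AE_space
  proof eventually_elim
    case (elim \<omega>)
    show ?case
    proof (rule exterior_event_cong[OF E])
      show "glue \<omega>' \<omega> \<in> space (paths UNIV)" using w elim by (intro glue_space) (auto simp: space_B)
      show "\<omega>' \<in> space (paths UNIV)" by (rule w)
      fix t assume "t \<le> - T \<or> T \<le> t"
      then show "glue \<omega>' \<omega> t = \<omega>' t"
        using elim T by (cases "t = - T") (auto simp: glue_def)
    qed
  qed
  show ?thesis
  proof (cases "\<omega>' \<in> E")
    case True
    have "tilt (A \<inter> E) \<omega>' = tilt A \<omega>'"
      unfolding tilt_def
    proof (rule nn_integral_cong_AE)
      show "AE \<omega> in B ?x ?y. W \<omega> * indicator (A \<inter> E) (glue \<omega>' \<omega>) = W \<omega> * indicator A (glue \<omega>' \<omega>)"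
        using ae by eventually_elim (use True in \<open>auto simp: indicator_def\<close>)
    qed
    then show ?thesis using True by simp
  next
    case False
    have "tilt (A \<inter> E) \<omega>' = (\<integral>\<^sup>+\<omega>. 0 \<partial>B ?x ?y)"
      unfolding tilt_def
    proof (rule nn_integral_cong_AE)
      show "AE \<omega> in B ?x ?y. W \<omega> * indicator (A \<inter> E) (glue \<omega>' \<omega>) = 0"
        using ae by eventually_elim (use False in \<open>auto simp: indicator_def\<close>)
    qed
    then show ?thesis using False by simp
  qed
qed

text \<open>For almost every boundary condition the partition function is finite and positive, so the quotient of real numbers
  in the Gibbs kernel is the mass under the resampling kernel. Its integral over an exterior event \<open>E\<close> is then the
  resampled mass of \<open>A \<inter> E\<close>, which equals the original one.\<close>

theorem gibbs_kernel_conditional: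
  assumes A: "A \<in> sets (paths UNIV)"
  shows "version_of_cond_prob \<mu> (exterior_algebra T) A (gibbs_kernel \<nu> V T A)"
proof -
  interpret prob_space \<mu> by (rule prob_space_\<mu>)
  interpret G: finite_measure_subalgebra \<mu> "exterior_algebra T" by standard (rule subalgebra_exterior)
  let ?g = "gibbs_kernel \<nu> V T A"
  have gm: "?g \<in> borel_measurable (exterior_algebra T)" by (rule gibbs_kernel_measurable[OF A])
  have gm' [measurable]: "?g \<in> borel_measurable \<mu>" by (rule measurable_from_subalg[OF subalgebra_exterior gm])
  have ae: "AE \<omega> in \<mu>. 0 \<le> ?g \<omega> \<and> ennreal (?g \<omega>) = emeasure (resample \<omega>) A"
    using Z_eq_v_\<mu> AE_space
  proof eventually_elim
    case (elim \<omega>)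
    then have w: "\<omega> \<in> space (paths UNIV)" by (simp add: space_\<mu>)
    let ?v = "v (2 * T) (\<omega> (- T)) (\<omega> T)"
    have vp: "0 < ?v" by (rule v_2T_pos)
    obtain r where r: "0 \<le> r" "tilt A \<omega> = ennreal r"
      using tilt_le_Z[of A \<omega>] elim(1) by (cases "tilt A \<omega>") (auto simp: top_unique)
    have "?g \<omega> = r / ?v" using gibbs_kernel_eq[OF A w] elim(1) r vp by simp
    moreover have "emeasure (resample \<omega>) A = ennreal (r / ?v)"
      unfolding emeasure_resample[OF A w] elim(1) r(2)
      using vp r by (simp add: inverse_ennreal ennreal_mult'[symmetric] divide_inverse mult.commute)
    ultimately show ?case using r vp by simp
  qed
  have int: "(\<integral>\<^sup>+\<omega>. ennreal (indicator E \<omega> * ?g \<omega>) \<partial>\<mu>) = emeasure \<mu> (A \<inter> E)" if E: "E \<in> sets (exterior_algebra T)" for E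
  proof -
    have AE': "A \<inter> E \<in> sets (paths UNIV)" using A E sets_exterior by blast
    have "(\<integral>\<^sup>+\<omega>. ennreal (indicator E \<omega> * ?g \<omega>) \<partial>\<mu>) = (\<integral>\<^sup>+\<omega>. emeasure (resample \<omega>) (A \<inter> E) \<partial>\<mu>)"
    proof (rule nn_integral_cong_AE)
      show "AE \<omega> in \<mu>. ennreal (indicator E \<omega> * ?g \<omega>) = emeasure (resample \<omega>) (A \<inter> E)"
        using ae AE_space
      proof eventually_elim
        case (elim \<omega>)
        then have w: "\<omega> \<in> space (paths UNIV)" by (simp add: space_\<mu>)
        have "emeasure (resample \<omega>) (A \<inter> E) = indicator E \<omega> * emeasure (resample \<omega>) A"
          unfolding emeasure_resample[OF AE' w] emeasure_resample[OF A w] tilt_Int_exterior[OF E w] by (simp add: ac_simps)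
        then show ?case using elim by (auto simp: indicator_def)
      qed
    qed
    also have "\<dots> = emeasure (\<mu> \<bind> resample) (A \<inter> E)"
      by (rule emeasure_bind[OF not_empty resample_kernel AE', symmetric])
    finally show ?thesis unfolding resample_invariant .
  qed
  have sE: "E \<in> sets (exterior_algebra T) \<Longrightarrow> E \<in> sets \<mu>" for E :: "(real \<Rightarrow> 'a) set" using sets_exterior by (auto simp: sets_\<mu>)
  have A' [measurable]: "A \<in> sets \<mu>" using A by (simp add: sets_\<mu>)
  have pos: "AE \<omega> in \<mu>. 0 \<le> ?g \<omega>" using ae by eventually_elim simp
  have gint: "integrable \<mu> ?g"
  proof (rule integrableI_nonneg[OF gm' pos])
    have "(\<integral>\<^sup>+\<omega>. ennreal (?g \<omega>) \<partial>\<mu>) = (\<integral>\<^sup>+\<omega>. ennreal (indicator (space \<mu>) \<omega> * ?g \<omega>) \<partial>\<mu>)"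
      by (intro nn_integral_cong) simp
    also have "\<dots> = emeasure \<mu> (A \<inter> space \<mu>)"
      using int[of "space \<mu>"] sets.top[of "exterior_algebra T :: (real \<Rightarrow> 'a) measure"] by (simp add: space_exterior space_\<mu>)
    finally show "(\<integral>\<^sup>+\<omega>. ennreal (?g \<omega>) \<partial>\<mu>) < \<infinity>" by (simp add: emeasure_eq_measure)
  qed
  have "AE \<omega> in \<mu>. real_cond_exp \<mu> (exterior_algebra T) (indicator A) \<omega> = ?g \<omega>"
  proof (rule G.real_cond_exp_charact[OF _ _ gint gm])
    show "integrable \<mu> (indicator A :: _ \<Rightarrow> real)"
      by (rule integrable_real_indicator[OF A']) (simp add: emeasure_eq_measure)
    fix E :: "(real \<Rightarrow> 'a) set" assume E: "E \<in> sets (exterior_algebra T)"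
    have [measurable]: "E \<in> sets \<mu>" by (rule sE[OF E])
    have "(\<integral>\<omega>\<in>E. ?g \<omega> \<partial>\<mu>) = enn2real (\<integral>\<^sup>+\<omega>. ennreal (indicator E \<omega> * ?g \<omega>) \<partial>\<mu>)"
      unfolding set_lebesgue_integral_def real_scaleR_def
    proof (rule integral_eq_nn_integral)
      show "(\<lambda>\<omega>. indicator E \<omega> * ?g \<omega>) \<in> borel_measurable \<mu>" by measurable
      show "AE \<omega> in \<mu>. 0 \<le> indicator E \<omega> * ?g \<omega>" using pos by eventually_elim simp
    qed
    also have "\<dots> = prob (A \<inter> E)" unfolding int[OF E] by (simp add: measure_def)
    also have "prob (A \<inter> E) = (\<integral>\<omega>\<in>E. indicator A \<omega> \<partial>\<mu>)"
    proof -
      have "(\<integral>\<omega>\<in>E. indicator A \<omega> \<partial>\<mu>) = (\<integral>\<omega>. (indicator (A \<inter> E) \<omega> :: real) \<partial>\<mu>)"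
        unfolding set_lebesgue_integral_def by (intro Bochner_Integration.integral_cong) (auto simp: indicator_def)
      then show ?thesis by simp
    qed
    finally show "(\<integral>\<omega>\<in>E. indicator A \<omega> \<partial>\<mu>) = (\<integral>\<omega>\<in>E. ?g \<omega> \<partial>\<mu>)" by simp
  qed
  then have "AE \<omega> in \<mu>. ?g \<omega> = real_cond_exp \<mu> (exterior_algebra T) (indicator A) \<omega>"
    by eventually_elim simp
  with gm show ?thesis unfolding version_of_cond_prob_def by blast
qed

end

section \<open>The ground state process is a Gibbs measure\<close>

theorem theorem5p4:
  fixes \<alpha> :: real
    and P :: "'a::euclidean_space \<Rightarrow> (real \<Rightarrow> 'a) measure"
    and p :: "real \<Rightarrow> 'a \<Rightarrow> real"
    and V :: "'a \<Rightarrow> real"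
    and H :: "'a l2_operator"
    and u :: "real \<Rightarrow> 'a \<Rightarrow> 'a \<Rightarrow> real"
    and \<phi>\<^sub>0 :: "'a \<Rightarrow> real"
    and \<mu>x :: "'a \<Rightarrow> (real \<Rightarrow> 'a) measure"
    and \<nu> :: "real \<Rightarrow> real \<Rightarrow> 'a \<Rightarrow> 'a \<Rightarrow> (real \<Rightarrow> 'a) measure"
  assumes "0 < \<alpha>" and "\<alpha> < 2"
    and "stable_process \<alpha> P"
    and "transition_density P p"
    and "kato_decomposable P V"
    and "fractional_schroedinger_operator P V H"
    and "feynman_kac_kernel P V u"
    and "isolated_eigenvalue H (complex_of_real (bottom_of_spectrum H))"
    and "ground_state H \<phi>\<^sub>0"
    and "\<And>x. pphi1_path_measure (bottom_of_spectrum H) u \<phi>\<^sub>0 x (\<mu>x x)"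
    and "\<And>s t x y. s < t \<Longrightarrow> bridge_measure p s t x y (\<nu> s t x y)"
  shows "(\<forall>T>0. \<forall>A\<in>sets (paths UNIV).
            version_of_cond_prob (pphi1_measure \<phi>\<^sub>0 \<mu>x) (exterior_algebra T) A (gibbs_kernel \<nu> V T A))
         \<and> gibbs_measure \<nu> V (pphi1_measure \<phi>\<^sub>0 \<mu>x)"
proof -
  have gs: "l2_eigenvector H (complex_of_real (bottom_of_spectrum H)) (\<lambda>x. complex_of_real (\<phi>\<^sub>0 x))"
    "l2_norm (\<lambda>x. complex_of_real (\<phi>\<^sub>0 x)) = 1" "\<And>x. 0 < \<phi>\<^sub>0 x" "continuous_on UNIV \<phi>\<^sub>0"
    using assms(9) by (auto simp: ground_state_def)
  have \<phi>m: "\<phi>\<^sub>0 \<in> borel_measurable borel" by (rule borel_measurable_continuous_onI[OF gs(4)])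
  have int1: "(\<integral>x. (\<phi>\<^sub>0 x)\<^sup>2 \<partial>lborel) = 1"
    using gs(2) by (simp add: l2_norm_def)
  have inte: "integrable lborel (\<lambda>x. (\<phi>\<^sub>0 x)\<^sup>2)"
    using int1 not_integrable_integral_eq[of lborel "\<lambda>x. (\<phi>\<^sub>0 x)\<^sup>2"] by fastforce
  have norm: "(\<integral>\<^sup>+x. ennreal ((\<phi>\<^sub>0 x)\<^sup>2) \<partial>lborel) = 1"
    using nn_integral_eq_integral[OF inte] int1 by simp
  have l2: "(\<lambda>x. complex_of_real (\<phi>\<^sub>0 x)) \<in> l2"
    using inte \<phi>m by (simp add: l2_def)
  have u: "continuous_on UNIV (\<lambda>(x, y). u d x y)" "u d x y = u d y x" "0 < u d x y"
    "\<forall>f\<in>l2. AE x in lborel. feynman_kac P V d f x = (\<integral>y. u d x y *\<^sub>R f y \<partial>lborel)" if "0 < d" for d x y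
    using assms(7) that unfolding feynman_kac_kernel_def by blast+
  have um: "(\<lambda>(x, y). u d x y) \<in> borel_measurable (borel \<Otimes>\<^sub>M borel)" if "0 < d" for d
    unfolding borel_prod by (rule borel_measurable_continuous_onI[OF u(1)[OF that]])
  interpret stable \<alpha> P p by standard (fact assms(3), fact assms(4))
  interpret ground_state_process "bottom_of_spectrum H" u \<phi>\<^sub>0 \<mu>x
    by standard (use um u gs \<phi>m norm assms(10) in auto)
  interpret feynman_kac_process \<alpha> P p "bottom_of_spectrum H" u \<phi>\<^sub>0 \<mu>x V
    by standard (use assms(5) u(4) l2 in auto)
  have ver: "version_of_cond_prob (pphi1_measure \<phi>\<^sub>0 \<mu>x) (exterior_algebra T) A (gibbs_kernel \<nu> V T A)"
    if "0 < T" "A \<in> sets (paths UNIV)" for T A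
  proof -
    interpret gibbs_window \<alpha> P p "bottom_of_spectrum H" u \<phi>\<^sub>0 \<mu>x V \<nu> T
      by standard (use assms(11) that in auto)
    show ?thesis by (rule gibbs_kernel_conditional[OF that(2)])
  qed
  then show ?thesis
    unfolding gibbs_measure_def using prob_space_\<mu> sets_\<mu> by blast
qed

end
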